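(* Let $\mu_1,\mu_2,\lambda_1,\lambda_2,c>0$. For $\pi=(\pi_1,\pi_2)\in[0,1]^2$ let $g(\pi)=1-\pi_1\pi_2$, $h(\pi)=c\,\pi_1\pi_2$, $$V(\pi)=\inf_\tau\mathbb E_\pi\left[g(\Pi_\tau)+\int_0^\tau h(\Pi_s)\,ds\right],$$ and let $\mathcal C=\{\pi\in[0,1]^2:V(\pi)<g(\pi)\}$ be the continuation region. For $i=1,2$ let $[0,B_i^* )$ be the continuation region of the one-dimensional quickest detection problem $QD(\mu_i,\lambda_i,c)$. Then there exists a non-increasing lower semi-continuous function $b:[B_1^*,1]\to[B_2^*,1]$ such that $$\mathcal C=\{\pi\in[0,1]^2:\pi_1\ge B_1^*,\ \pi_2<b(\pi_1)\}\cup\bigl([0,B_1^* )\times[0,1]\bigr).$$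
   Context: Set-up (two-dimensional quickest detection). For $\pi\in[0,1]^2$, under $\mathbb P_\pi$ (expectation $\mathbb E_\pi$): $Y^1,Y^2$ are continuous-time Markov chains on $\{0,1\}$, $Y^i$ having transition rate matrix $\begin{pmatrix}-\lambda_i&\lambda_i\\0&0\end{pmatrix}$ and $\mathbb P_\pi(Y^i_0=1)=\pi_i$; $W^1,W^2$ are standard Brownian motions; and $Y^1,Y^2,W^1,W^2$ are independent. One observes $X=(X^1,X^2)$ with $dX^i_t=\mu_iY^i_t\,dt+dW^i_t$, $X^i_0=0$, and $\mathcal F^X$ is the filtration generated by $X$. The posterior process $\Pi=(\Pi^1,\Pi^2)$ is $\Pi^i_t=\mathbb E_\pi[Y^i_t\mid\mathcal F^X_t]$ (continuous version); it satisfies $\Pi_0=\pi$ and $d\Pi^i_t=\lambda_i(1-\Pi^i_t)\,dt+\mu_i\Pi^i_t(1-\Pi^i_t)\,d\bar W^i_t$, where $\bar W^i_t=X^i_t-\mu_i\int_0^t\Pi^i_s\,ds$ and $(\bar W^1,\bar W^2)$ is a two-dimensional standard Brownian motion. The infimum in $V$ is over ($\mathbb P_\pi$-a.s. finite) $\mathcal F^X$-stopping times. One-dimensional problem $QD(\mu,\lambda,c)$, for $\mu,\lambda,c>0$: with $\Pi$ the one-dimensional posterior process defined in the same way from a single observation with parameters $\mu,\lambda$ and starting point $\pi\in[0,1]$ (so $d\Pi_t=\lambda(1-\Pi_t)\,dt+\mu\Pi_t(1-\Pi_t)\,d\bar W_t$, $\Pi_0=\pi$), set $u^{\mu,\lambda,c}(\pi)=\inf_\tau\mathbb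 E_\pi\left[1-\Pi_\tau+c\int_0^\tau\Pi_t\,dt\right]$. It is known that $u^{\mu,\lambda,c}$ is concave and non-increasing and that its continuation region $\{\pi\in[0,1]:u^{\mu,\lambda,c}(\pi)<1-\pi\}$ is of the form $[0,B^* )$ for some $B^*\in(0,1)$, and that the first time $\Pi$ enters $[B^*,1]$ is optimal for $u^{\mu,\lambda,c}$; $B_i^*$ denotes this $B^*$ for $QD(\mu_i,\lambda_i,c)$. *)

theory Defs
  imports "HOL-Probability.Probability"
begin

section \<open>Continuous-time Markov chains and Brownian motion\<close>

text \<open>Processes are indexed by \<^typ>\<open>real\<close>, and only their values at times \<open>t \<ge> 0\<close> matter.\<close>

text \<open>\<open>p\<close> is the transition semigroup \<open>p t = exp (t Q)\<close> of the rate matrix \<open>Q\<close> on the finite state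
  space \<open>S\<close>, characterised as the solution of Kolmogorov's backward equation \<open>p' = Q p\<close>,
  \<open>p 0 = I\<close>.\<close>

definition transition_semigroup ::
    "'s set \<Rightarrow> ('s \<Rightarrow> 's \<Rightarrow> real) \<Rightarrow> (real \<Rightarrow> 's \<Rightarrow> 's \<Rightarrow> real) \<Rightarrow> bool" where
  "transition_semigroup S Q p \<longleftrightarrow>
     (\<forall>i\<in>S. \<forall>j\<in>S. p 0 i j = (if i = j then 1 else 0)) \<and>
     (\<forall>i\<in>S. \<forall>j\<in>S. \<forall>t\<ge>0.
        ((\<lambda>u. p u i j) has_real_derivative (\<Sum>k\<in>S. Q i k * p t k j)) (at t within {0..}))"

text \<open>The second conjunct says that the paths are right-continuous for the discrete topology.\<close>

definition markov_chain ::
    "'w measure \<Rightarrow> 's set \<Rightarrow> ('s \<Rightarrow> 's \<Rightarrow> real) \<Rightarrow> (real \<Rightarrow> 'w \<Rightarrow> 's) \<Rightarrow> bool" where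
  "markov_chain M S Q Y \<longleftrightarrow>
     (\<forall>t\<ge>0. Y t \<in> M \<rightarrow>\<^sub>M count_space S) \<and>
     (\<forall>\<omega>\<in>space M. \<forall>t\<ge>0. \<forall>\<^sub>F s in at_right t. Y s \<omega> = Y t \<omega>) \<and>
     (\<exists>p. transition_semigroup S Q p \<and>
        (\<forall>(ts :: nat \<Rightarrow> real) n j. 0 \<le> ts 0 \<longrightarrow> strict_mono ts \<longrightarrow> (\<forall>k\<le>n. j k \<in> S) \<longrightarrow>
           measure M {\<omega> \<in> space M. \<forall>k\<le>n. Y (ts k) \<omega> = j k} =
           measure M {\<omega> \<in> space M. Y (ts 0) \<omega> = j 0} *
             (\<Prod>k<n. p (ts (Suc k) - ts k) (j k) (j (Suc k)))))"

definition brownian_motion :: "'w measure \<Rightarrow> (real \<Rightarrow> 'w \<Rightarrow> real) \<Rightarrow> bool" where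
  "brownian_motion M W \<longleftrightarrow>
     (\<forall>t\<ge>0. W t \<in> borel_measurable M) \<and>
     (\<forall>\<omega>\<in>space M. W 0 \<omega> = 0) \<and>
     (\<forall>\<omega>\<in>space M. continuous_on {0..} (\<lambda>t. W t \<omega>)) \<and>
     (\<forall>s t. 0 \<le> s \<longrightarrow> s < t \<longrightarrow>
        distributed M lborel (\<lambda>\<omega>. W t \<omega> - W s \<omega>) (normal_density 0 (sqrt (t - s)))) \<and>
     (\<forall>(ts :: nat \<Rightarrow> real) n. 0 \<le> ts 0 \<longrightarrow> strict_mono ts \<longrightarrow>
        prob_space.indep_vars M (\<lambda>_. borel) (\<lambda>k \<omega>. W (ts (Suc k)) \<omega> - W (ts k) \<omega>) {..<n})"

definition generated_by ::
    "'w measure \<Rightarrow> 'b measure \<Rightarrow> (real \<Rightarrow> 'w \<Rightarrow> 'b) \<Rightarrow> real set \<Rightarrow> 'w measure" where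
  "generated_by M N Z T = sigma (space M) (\<Union>t\<in>T. {Z t -` A \<inter> space M | A. A \<in> sets N})"

text \<open>The time index is \<^typ>\<open>ennreal\<close> so that stopping times may take the value \<open>\<infinity>\<close>.\<close>

definition generated_filtration ::
    "'w measure \<Rightarrow> 'b measure \<Rightarrow> (real \<Rightarrow> 'w \<Rightarrow> 'b) \<Rightarrow> ennreal \<Rightarrow> 'w measure" where
  "generated_filtration M N Z t = generated_by M N Z {s. 0 \<le> s \<and> ennreal s \<le> t}"


section \<open>The quickest detection model\<close>

text \<open>The number of coordinates is the size of the finite index type \<open>'n\<close>. An object of this type consists of
  a probability space carrying the hidden chains, the driving noises and the posterior process.\<close>

record ('w, 'n) qd_space =
  msr :: "'w measure"
  chain :: "'n \<Rightarrow> real \<Rightarrow> 'w \<Rightarrow> nat"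
  noise :: "'n \<Rightarrow> real \<Rightarrow> 'w \<Rightarrow> real"
  post :: "real \<Rightarrow> 'w \<Rightarrow> real ^ 'n"

definition obs :: "real ^ 'n \<Rightarrow> ('w, 'n) qd_space \<Rightarrow> real \<Rightarrow> 'w \<Rightarrow> real ^ 'n" where
  "obs \<mu> D t \<omega> = (\<chi> i. \<mu> $ i * (LBINT s:{0..t}. real (chain D i s \<omega>)) + noise D i t \<omega>)"

definition obs_filtration :: "real ^ 'n::finite \<Rightarrow> ('w, 'n) qd_space \<Rightarrow> ennreal \<Rightarrow> 'w measure" where
  "obs_filtration \<mu> D = generated_filtration (msr D) borel (obs \<mu> D)"

definition rate_matrix :: "real \<Rightarrow> nat \<Rightarrow> nat \<Rightarrow> real" where
  "rate_matrix l i j = (if i = 0 then (if j = 0 then - l else l) else 0)"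

text \<open>\<open>qd_model \<mu> lam \<pi> D\<close>: under the probability measure of \<open>D\<close> the processes have the laws
  required with prior \<open>\<pi>\<close>, and \<^term>\<open>post D\<close> is a continuous version of the posterior process.\<close>

definition qd_model ::
    "real ^ 'n::finite \<Rightarrow> real ^ 'n \<Rightarrow> real ^ 'n \<Rightarrow> ('w, 'n) qd_space \<Rightarrow> bool" where
  "qd_model \<mu> lam \<pi> D \<longleftrightarrow>
     prob_space (msr D) \<and>
     (\<forall>i. markov_chain (msr D) {0, 1} (rate_matrix (lam $ i)) (chain D i)) \<and>
     (\<forall>i. measure (msr D) {\<omega> \<in> space (msr D). chain D i 0 \<omega> = 1} = \<pi> $ i) \<and>
     (\<forall>i. brownian_motion (msr D) (noise D i)) \<and>
     prob_space.indep_sets (msr D)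
       (case_sum
          (\<lambda>i. sets (generated_by (msr D) (count_space {0, 1}) (chain D i) {0..}))
          (\<lambda>i. sets (generated_by (msr D) borel (noise D i) {0..})))
       (UNIV :: ('n + 'n) set) \<and>
     (\<forall>t\<ge>0. post D t \<in> borel_measurable (msr D)) \<and>
     (\<forall>\<omega>\<in>space (msr D). continuous_on {0..} (\<lambda>t. post D t \<omega>)) \<and>
     (\<forall>t\<ge>0. \<forall>i. AE \<omega> in msr D.
        post D t \<omega> $ i =
        real_cond_exp (msr D) (obs_filtration \<mu> D (ennreal t)) (\<lambda>\<omega>. real (chain D i t \<omega>)) \<omega>)"


section \<open>Optimal stopping\<close>

definition admissible :: "real ^ 'n::finite \<Rightarrow> ('w, 'n) qd_space \<Rightarrow> ('w \<Rightarrow> ennreal) set" where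
  "admissible \<mu> D =
     {\<tau>. stopping_time (obs_filtration \<mu> D) \<tau> \<and> (AE \<omega> in msr D. \<tau> \<omega> < \<infinity>)}"

text \<open>The costs are non-negative and need not be integrable, so expected cost and value are
  \<^typ>\<open>ennreal\<close>-valued.\<close>

definition expected_cost ::
    "('w, 'n) qd_space \<Rightarrow> (real ^ 'n \<Rightarrow> real) \<Rightarrow> (real ^ 'n \<Rightarrow> real) \<Rightarrow> ('w \<Rightarrow> ennreal) \<Rightarrow> ennreal" where
  "expected_cost D g h \<tau> =
     (\<integral>\<^sup>+ \<omega>. ennreal (g (post D (enn2real (\<tau> \<omega>)) \<omega>) +
                    (LBINT s:{0..enn2real (\<tau> \<omega>)}. h (post D s \<omega>))) \<partial>msr D)"

definition stopping_value ::
    "real ^ 'n::finite \<Rightarrow> ('w, 'n) qd_space \<Rightarrow> (real ^ 'n \<Rightarrow> real) \<Rightarrow> (real ^ 'n \<Rightarrow> real) \<Rightarrow> ennreal" where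
  "stopping_value \<mu> D g h = (INF \<tau>\<in>admissible \<mu> D. expected_cost D g h \<tau>)"

text \<open>\<open>D\<close> is a family of models indexed by the prior. In dimension one the prior is a real number.\<close>

definition QD_value :: "real \<Rightarrow> real \<Rightarrow> (real \<Rightarrow> ('w, 1) qd_space) \<Rightarrow> real \<Rightarrow> ennreal" where
  "QD_value \<mu> c D \<pi> = stopping_value (vec \<mu>) (D \<pi>) (\<lambda>p. 1 - p $ 1) (\<lambda>p. c * p $ 1)"

definition QD_continuation :: "real \<Rightarrow> real \<Rightarrow> (real \<Rightarrow> ('w, 1) qd_space) \<Rightarrow> real set" where
  "QD_continuation \<mu> c D = {\<pi> \<in> {0..1}. QD_value \<mu> c D \<pi> < ennreal (1 - \<pi>)}"

definition QD2_terminal :: "real ^ 2 \<Rightarrow> real" where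
  "QD2_terminal \<pi> = 1 - \<pi> $ 1 * \<pi> $ 2"

definition QD2_running :: "real \<Rightarrow> real ^ 2 \<Rightarrow> real" where
  "QD2_running c \<pi> = c * (\<pi> $ 1 * \<pi> $ 2)"

definition QD2_value :: "real ^ 2 \<Rightarrow> real \<Rightarrow> (real ^ 2 \<Rightarrow> ('w, 2) qd_space) \<Rightarrow> real ^ 2 \<Rightarrow> ennreal" where
  "QD2_value \<mu> c D \<pi> = stopping_value \<mu> (D \<pi>) QD2_terminal (QD2_running c)"

definition QD2_continuation :: "real ^ 2 \<Rightarrow> real \<Rightarrow> (real ^ 2 \<Rightarrow> ('w, 2) qd_space) \<Rightarrow> (real ^ 2) set" where
  "QD2_continuation \<mu> c D = {\<pi> \<in> cbox 0 1. QD2_value \<mu> c D \<pi> < ennreal (QD2_terminal \<pi>)}"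

definition lower_semicontinuous_on :: "'a::topological_space set \<Rightarrow> ('a \<Rightarrow> real) \<Rightarrow> bool" where
  "lower_semicontinuous_on S f \<longleftrightarrow>
     (\<forall>x\<in>S. \<forall>a<f x. \<forall>\<^sub>F y in at x within S. a < f y)"

end

theory Submission
  imports Defs
begin

text \<open>Compare every strategy with stopping at once. Discretising a stopping time from above shows that
  \<open>\<pi>\<close> lies in the continuation region iff some stopping rule on a time grid, given as a measurable
  functional of the observed path, has negative excess cost. Since \<open>\<Pi>\<^sup>1\<^sub>t \<Pi>\<^sup>2\<^sub>t\<close> is the conditional
  probability of \<open>Y\<^sup>1\<^sub>t = Y\<^sup>2\<^sub>t = 1\<close>, the excess of a fixed rule is a linear combination of probabilities of
  path events, hence affine in each coordinate of the prior. So the continuation region is open in each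
  variable, and a rule with negative excess at \<open>\<pi>\<close> and nonnegative excess at \<open>\<pi>\<^sub>i = 1\<close> has negative excess
  for all smaller values of \<open>\<pi>\<^sub>i\<close>. On the edge \<open>\<pi>\<^sub>2 = 1\<close> the second observation is independent noise,
  and conditioning on it reduces the problem to the one-dimensional one, so \<open>\<pi>\<^sub>1 \<ge> B\<^sub>1\<close> gives nonnegative
  excess there. Conversely, if \<open>\<pi>\<^sub>1 < B\<^sub>1\<close> then a good one-dimensional rule, truncated at the best
  deterministic time, is also good in dimension two, because the second chain only contributes the
  nondecreasing weight \<open>P(Y\<^sup>2\<^sub>t = 1)\<close>.\<close>

section \<open>Path laws\<close>

text \<open>The models \<open>D \<pi>\<close> of different priors sit on unrelated probability
  spaces, so a stopping time of one of them means nothing for another. Hence rules are sets of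
  trajectories in the canonical space \<open>model_paths\<close>, and a model enters only through
  the law of its trajectory. The value is awkward as a function of the prior, since a good rule
  changes with the prior. A strict inequality for an infimum, however, hands over one rule, and the
  sign of its excess can be followed along a coordinate axis. The strictness also pays for the
  discretisation: the gap is fixed while the error \<open>c * \<delta>\<close> tends to 0, and
  rounding a stopping time up to the grid never looks into the future. The posteriors must disappear
  before laws can be compared, because each is a conditional expectation on its own space.
  Integrating their product over an observed event turns it into a probability involving only chains
  and trajectory; for a product this needs conditional independence of the coordinates given all
  observations.\<close>

lemma affine_prob_on_sigma_sets:
  assumes prob: "prob_space N1" "prob_space N2" "prob_space N3"
    and sets: "sets N1 = sigma_sets \<Omega> G" "sets N2 = sigma_sets \<Omega> G" "sets N3 = sigma_sets \<Omega> G"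
    and G: "G \<subseteq> Pow \<Omega>" "Int_stable G"
    and affine: "\<And>A. A \<in> G \<Longrightarrow> measure N1 A = (1 - x) * measure N2 A + x * measure N3 A"
    and A: "A \<in> sets N1"
  shows "measure N1 A = (1 - x) * measure N2 A + x * measure N3 A"
proof -
  interpret N1: prob_space N1 by fact
  interpret N2: prob_space N2 by fact
  interpret N3: prob_space N3 by fact
  have sp: "space N1 = \<Omega>" "space N2 = \<Omega>" "space N3 = \<Omega>"
    using sets sets_eq_imp_space_eq[of _ "sigma \<Omega> G"] G by (simp_all add: sets_measure_of space_measure_of)
  from A[unfolded sets] show ?thesis
  proof (induct rule: sigma_sets_induct_disjoint[OF G(2,1), consumes 1, case_names basic empty compl union])
    case (basic A)
    then show ?case by (rule affine)
  next
    case empty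
    then show ?case by simp
  next
    case (compl A)
    then have A: "A \<in> N1.events" "A \<in> N2.events" "A \<in> N3.events" by (simp_all add: sets)
    have c: "measure N1 (\<Omega> - A) = 1 - measure N1 A" "measure N2 (\<Omega> - A) = 1 - measure N2 A"
      "measure N3 (\<Omega> - A) = 1 - measure N3 A"
      using N1.prob_compl[OF A(1)] N2.prob_compl[OF A(2)] N3.prob_compl[OF A(3)] by (simp_all add: sp)
    \<comment> \<open>The constant terms agree because the weights \<open>1 - x\<close> and
      \<open>x\<close> add up to 1.\<close>
    show ?case by (simp only: c compl(2)) (simp add: algebra_simps)
  next
    case (union F)
    then have r: "range F \<subseteq> N1.events" "range F \<subseteq> N2.events" "range F \<subseteq> N3.events"
      by (auto simp: sets)
    have "(\<lambda>i. (1 - x) * measure N2 (F i) + x * measure N3 (F i)) sums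
        ((1 - x) * measure N2 (\<Union>i. F i) + x * measure N3 (\<Union>i. F i))"
      using union(1) r
      by (intro sums_add sums_mult N2.finite_measure_UNION N3.finite_measure_UNION) auto
    moreover have "(\<lambda>i. measure N1 (F i)) sums measure N1 (\<Union>i. F i)"
      using union(1) r by (intro N1.finite_measure_UNION) auto
    ultimately show ?case
      using union(3) by (simp add: sums_unique2)
  qed
qed

text \<open>\<open>markov_chain\<close> and \<open>brownian_motion\<close> prescribe distributions
  along infinite strictly increasing time sequences, so the finitely many times of a cylinder are
  continued beyond the last one. Time 0 is added because the prior and the normalisation
  \<open>W 0 = 0\<close> are attached to it.\<close>

lemma finite_set_strict_mono_enumeration:
  fixes J :: "real set"
  assumes "finite J" "J \<subseteq> {0..}"
  shows "\<exists>ts n. strict_mono ts \<and> ts 0 = 0 \<and> insert 0 J = ts ` {..n::nat}"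
  using assms
proof (induct rule: finite_linorder_max_induct)
  case empty
  show ?case
    by (intro exI[of _ "real"] exI[of _ 0]) (auto simp: strict_mono_def)
next
  case (insert b A)
  then obtain ts n where ts: "strict_mono ts" "ts 0 = 0" "insert 0 A = ts ` {..n::nat}" by auto
  show ?case
  proof (cases "b = 0")
    case True
    with ts show ?thesis by auto
  next
    case False
    with insert have b: "\<And>a. a \<in> insert 0 A \<Longrightarrow> a < b" by auto
    \<comment> \<open>Index \<open>Suc n\<close> gets the new maximum \<open>b\<close>; later
      indices are padding at unit distance.\<close>
    define ts' where "ts' = (\<lambda>k. if k \<le> n then ts k else b + real (k - Suc n))"
    have lt: "ts k < b" if "k \<le> n" for k
      using that by (intro b) (auto simp: ts(3))
    have "strict_mono ts'"
    proof (rule strict_monoI)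
      fix i j :: nat assume "i < j"
      then show "ts' i < ts' j"
        using strict_monoD[OF ts(1) \<open>i < j\<close>] lt[of i] by (auto simp: ts'_def)
    qed
    moreover have "insert 0 (insert b A) = ts' ` {..Suc n}"
    proof -
      have "ts' ` {..n} = ts ` {..n}" by (auto simp: ts'_def)
      then show ?thesis using ts(3) by (auto simp: atMost_Suc ts'_def)
    qed
    moreover have "ts' 0 = 0" by (simp add: ts'_def ts)
    ultimately show ?thesis by blast
  qed
qed

definition chain_paths :: "(real \<Rightarrow> nat) measure" where
  "chain_paths = PiM {0..} (\<lambda>_. count_space {0, 1})"

definition noise_paths :: "(real \<Rightarrow> real) measure" where
  "noise_paths = PiM {0..} (\<lambda>_. borel)"

definition sample_path :: "(real \<Rightarrow> 'w \<Rightarrow> 'b) \<Rightarrow> 'w \<Rightarrow> real \<Rightarrow> 'b" where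
  "sample_path Z w = (\<lambda>t\<in>{0..}. Z t w)"

lemma cylinder_enumeration:
  assumes "C \<in> prod_algebra {0::real..} (\<lambda>_. N)"
  obtains ts n X where "strict_mono ts" "ts 0 = 0" "\<And>k::nat. X k \<in> sets N"
    "C = {z \<in> space (PiM {0..} (\<lambda>_. N)). \<forall>k\<le>n. z (ts k) \<in> X k}"
proof -
  from assms obtain J E where C: "C = prod_emb {0..} (\<lambda>_. N) J (\<Pi>\<^sub>E j\<in>J. E j)"
    "finite J" "J \<subseteq> {0..}" "\<And>i. i \<in> J \<Longrightarrow> E i \<in> sets N"
    by (elim prod_algebraE) blast
  obtain ts n where ts: "strict_mono ts" "ts 0 = 0" "insert 0 J = ts ` {..n::nat}"
    using finite_set_strict_mono_enumeration[OF C(2,3)] by blast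
  \<comment> \<open>Up to index \<open>n\<close> only time 0 can lie outside \<open>J\<close>; it
    then carries the vacuous constraint \<open>space N\<close>.\<close>
  define X where "X k = (if ts k \<in> J then E (ts k) else space N)" for k
  have X: "X k \<in> sets N" for k using C(4) by (auto simp: X_def)
  have nonneg: "0 \<le> ts k" for k
    using strict_mono_mono[OF ts(1), THEN monoD, of 0 k] ts(2) by simp
  have "C = {z \<in> space (PiM {0..} (\<lambda>_. N)). \<forall>k\<le>n. z (ts k) \<in> X k}"
  proof (intro set_eqI)
    fix z
    show "z \<in> C \<longleftrightarrow> z \<in> {z \<in> space (PiM {0..} (\<lambda>_. N)). \<forall>k\<le>n. z (ts k) \<in> X k}"
    proof (cases "z \<in> space (PiM {0..} (\<lambda>_. N))")
      case True
      have "z \<in> C \<longleftrightarrow> (\<forall>j\<in>J. z j \<in> E j)"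
        using True C(3) by (auto simp: C(1) prod_emb_def space_PiM)
      also have "\<dots> \<longleftrightarrow> (\<forall>j\<in>insert 0 J. z j \<in> (if j \<in> J then E j else space N))"
        using True by (auto simp: space_PiM PiE_iff)
      also have "\<dots> \<longleftrightarrow> (\<forall>k\<le>n. z (ts k) \<in> X k)"
        unfolding ts(3) by (auto simp: X_def)
      finally show ?thesis using True by blast
    next
      case False
      then show ?thesis by (auto simp: C(1) prod_emb_def space_PiM)
    qed
  qed
  with ts(1,2) X show ?thesis by (rule that)
qed

text \<open>The explicit \<open>exp (t Q)\<close> for \<open>rate_matrix l\<close>: an exponential
  waiting time in 0, then absorption in 1.\<close>

definition chain_semigroup :: "real \<Rightarrow> real \<Rightarrow> nat \<Rightarrow> nat \<Rightarrow> real" where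
  "chain_semigroup l t i j =
    (if i = 0 then (if j = 0 then exp (- l * t) else 1 - exp (- l * t)) else (if j = 1 then 1 else 0))"

text \<open>\<open>markov_chain\<close> only asserts that some semigroup exists; its uniqueness
  makes two models with the same rate comparable. State 1 has zero rates, so its row is constant,
  and the row of state 0 then solves a linear equation with integrating factor
  \<open>exp (l * u)\<close>.\<close>

lemma transition_semigroup_rate_matrix:
  assumes p: "transition_semigroup {0, 1} (rate_matrix l) p" and "0 \<le> t" "i \<in> {0, 1}" "j \<in> {0, 1}"
  shows "p t i j = chain_semigroup l t i j"
proof -
  have p0: "p 0 i j = (if i = j then 1 else 0)" if "i \<in> {0,1}" "j \<in> {0,1}" for i j
    using p that by (auto simp: transition_semigroup_def)
  have const: "f t = f 0" if "\<And>u. 0 \<le> u \<Longrightarrow> (f has_real_derivative 0) (at u within {0..})" for f :: "real \<Rightarrow> real"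
  proof -
    have "\<exists>c. \<forall>x\<in>{0..}. f x = c"
      by (rule has_field_derivative_zero_constant) (auto intro: that)
    with \<open>0 \<le> t\<close> show ?thesis by auto
  qed
  have d1: "((\<lambda>u. p u 1 j) has_real_derivative 0) (at u within {0..})" if "0 \<le> u" "j \<in> {0,1}" for u j
    using p that unfolding transition_semigroup_def rate_matrix_def by fastforce
  have p1: "p u 1 j = p 0 1 j" if "0 \<le> u" "j \<in> {0,1}" for u j
  proof -
    have "\<exists>c. \<forall>x\<in>{0..}. p x 1 j = c"
      by (rule has_field_derivative_zero_constant) (use d1[OF _ that(2)] in auto)
    with that show ?thesis by auto
  qed
  have d0: "((\<lambda>u. p u 0 j) has_real_derivative (l * p 0 1 j - l * p u 0 j)) (at u within {0..})"
    if "0 \<le> u" "j \<in> {0,1}" for u j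
  proof -
    have "((\<lambda>u. p u 0 j) has_real_derivative (\<Sum>k\<in>{0,1}. rate_matrix l 0 k * p u k j)) (at u within {0..})"
      using p that unfolding transition_semigroup_def by blast
    then show ?thesis using p1[OF that] by (simp add: rate_matrix_def algebra_simps)
  qed
  have "exp (l * t) * (p t 0 j - p 0 1 j) = exp (l * 0) * (p 0 0 j - p 0 1 j)" if "j \<in> {0,1}" for j
    by (rule const[of "\<lambda>u. exp (l * u) * (p u 0 j - p 0 1 j)"])
       (auto intro!: derivative_eq_intros d0[OF _ that] simp: algebra_simps)
  then have e: "exp (l * t) * (p t 0 j - p 0 1 j) = p 0 0 j - p 0 1 j"
    using assms by auto
  have "exp (- l * t) * (exp (l * t) * (p t 0 j - p 0 1 j)) = p t 0 j - p 0 1 j"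
    by (simp add: exp_minus)
  then have "p t 0 j = p 0 1 j + exp (- l * t) * (p 0 0 j - p 0 1 j)" unfolding e by simp
  then show ?thesis
    using assms(3,4) p1[OF assms(2)] p0 by (auto simp: chain_semigroup_def algebra_simps)
qed

lemma markov_chain_fdd:
  assumes "markov_chain M {0, 1} (rate_matrix l) Y" "0 \<le> ts 0" "strict_mono ts" "\<forall>k\<le>n. j k \<in> {0, 1}"
  shows "\<P>(w in M. \<forall>k\<le>n. Y (ts k) w = j k) =
    \<P>(w in M. Y (ts 0) w = j 0) *
      (\<Prod>k<n. chain_semigroup l (ts (Suc k) - ts k) (j k) (j (Suc k)))"
proof -
  obtain p where p: "transition_semigroup {0, 1} (rate_matrix l) p"
    and fdd: "\<And>(ts :: nat \<Rightarrow> real) n j. 0 \<le> ts 0 \<Longrightarrow> strict_mono ts \<Longrightarrow> \<forall>k\<le>n. j k \<in> {0, 1} \<Longrightarrow>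
           \<P>(w in M. \<forall>k\<le>n. Y (ts k) w = j k) =
           \<P>(w in M. Y (ts 0) w = j 0) *
             (\<Prod>k<n. p (ts (Suc k) - ts k) (j k) (j (Suc k)))"
    using assms(1) unfolding markov_chain_def by blast
  have "p (ts (Suc k) - ts k) (j k) (j (Suc k)) = chain_semigroup l (ts (Suc k) - ts k) (j k) (j (Suc k))"
    if "k < n" for k
  proof (rule transition_semigroup_rate_matrix[OF p])
    show "0 \<le> ts (Suc k) - ts k" using strict_monoD[OF assms(3), of k "Suc k"] by simp
    show "j k \<in> {0, 1}" "j (Suc k) \<in> {0, 1}"
      using assms(4) that by (metis less_or_eq_imp_le, metis Suc_leI)
  qed
  then show ?thesis by (subst fdd[OF assms(2-4)]) simp
qed

lemma measurable_chain_path: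
  "markov_chain M {0, 1} Q Y \<Longrightarrow> sample_path Y \<in> M \<rightarrow>\<^sub>M chain_paths"
  unfolding chain_paths_def sample_path_def[abs_def] markov_chain_def
  by (intro measurable_restrict) auto

lemma measurable_noise_path:
  "brownian_motion M W \<Longrightarrow> sample_path W \<in> M \<rightarrow>\<^sub>M noise_paths"
  unfolding noise_paths_def sample_path_def[abs_def] brownian_motion_def
  by (intro measurable_restrict) auto

text \<open>The prior enters only through the initial state: a cylinder splits into finitely many
  state sequences \<open>j\<close>, and each contributes an initial probability times a transition
  factor \<open>q j\<close> that is common to the three chains.\<close>

lemma chain_path_law_affine:
  assumes prob: "prob_space M1" "prob_space M2" "prob_space M3"
    and chain: "markov_chain M1 {0, 1} (rate_matrix l) Y1"
      "markov_chain M2 {0, 1} (rate_matrix l) Y2" "markov_chain M3 {0, 1} (rate_matrix l) Y3"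
    and init: "\<P>(w in M1. Y1 0 w = 1) =
      (1 - x) * \<P>(w in M2. Y2 0 w = 1) + x * \<P>(w in M3. Y3 0 w = 1)"
    and C: "C \<in> sets chain_paths"
  shows "measure (distr M1 chain_paths (sample_path Y1)) C =
    (1 - x) * measure (distr M2 chain_paths (sample_path Y2)) C + x * measure (distr M3 chain_paths (sample_path Y3)) C"
proof (rule affine_prob_on_sigma_sets[where \<Omega> = "space chain_paths" and G = "prod_algebra {0::real..} (\<lambda>_. count_space {0, 1})"])
  note path = chain[THEN measurable_chain_path]
  show "prob_space (distr M1 chain_paths (sample_path Y1))" "prob_space (distr M2 chain_paths (sample_path Y2))"
    "prob_space (distr M3 chain_paths (sample_path Y3))"
    using prob path by (auto intro: prob_space.prob_space_distr)
  let ?G = "prod_algebra {0::real..} (\<lambda>_. count_space {0, 1::nat})"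
  show "sets (distr M1 chain_paths (sample_path Y1)) = sigma_sets (space chain_paths) ?G"
    "sets (distr M2 chain_paths (sample_path Y2)) = sigma_sets (space chain_paths) ?G"
    "sets (distr M3 chain_paths (sample_path Y3)) = sigma_sets (space chain_paths) ?G"
    by (simp_all add: chain_paths_def sets_PiM space_PiM)
  show "?G \<subseteq> Pow (space chain_paths)"
    using prod_algebra_sets_into_space[of "{0::real..}" "\<lambda>_. count_space {0, 1::nat}"]
    by (simp add: chain_paths_def space_PiM)
  show "Int_stable ?G" by (rule Int_stable_prod_algebra)
  show "C \<in> sets (distr M1 chain_paths (sample_path Y1))" using C by simp
  fix A assume A: "A \<in> ?G"
  then obtain ts n X where ts: "strict_mono ts" "ts 0 = 0" and X: "\<And>k::nat. X k \<in> sets (count_space {0,1::nat})"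
    and A_eq: "A = {z \<in> space chain_paths. \<forall>k\<le>n. z (ts k) \<in> X k}"
    unfolding chain_paths_def by (rule cylinder_enumeration) blast
  have A': "A \<in> sets chain_paths"
    using A unfolding chain_paths_def sets_PiM by blast
  have nonneg: "0 \<le> ts k" for k
    using strict_mono_mono[OF ts(1), THEN monoD, of 0 k] ts(2) by simp
  define J where "J = PiE {..n} X"
  have "finite J"
    unfolding J_def using X by (intro finite_PiE) (auto intro: finite_subset)
  define q where "q j = (\<Prod>k<n. chain_semigroup l (ts (Suc k) - ts k) (j k) (j (Suc k)))" for j
  have J01: "\<forall>k\<le>n. j k \<in> {0,1}" if "j \<in> J" for j
    using that X by (fastforce simp: J_def)
  have sum: "measure (distr M chain_paths (sample_path Y)) A =
      (\<Sum>j\<in>J. \<P>(w in M. Y 0 w = j 0) * q j)"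
    if M: "prob_space M" and Y: "markov_chain M {0, 1} (rate_matrix l) Y"
    for M :: "'w measure" and Y
  proof -
    interpret prob_space M by fact
    have [measurable]: "Y t \<in> M \<rightarrow>\<^sub>M count_space {0,1}" if "0 \<le> t" for t
      using Y that by (simp add: markov_chain_def)
    have ev: "{w \<in> space M. \<forall>k\<le>n. Y (ts k) w = j k} \<in> events" for j
      using nonneg by measurable
    have cyl: "sample_path Y -` A \<inter> space M = (\<Union>j\<in>J. {w \<in> space M. \<forall>k\<le>n. Y (ts k) w = j k})"
    proof (intro set_eqI iffI)
      fix w assume "w \<in> sample_path Y -` A \<inter> space M"
      then show "w \<in> (\<Union>j\<in>J. {w \<in> space M. \<forall>k\<le>n. Y (ts k) w = j k})"
        by (intro UN_I[of "\<lambda>k\<in>{..n}. Y (ts k) w"])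
           (simp_all add: J_def A_eq sample_path_def nonneg PiE_iff)
    next
      fix w assume "w \<in> (\<Union>j\<in>J. {w \<in> space M. \<forall>k\<le>n. Y (ts k) w = j k})"
      then obtain j where "j \<in> J" "w \<in> space M" "\<forall>k\<le>n. Y (ts k) w = j k" by blast
      then have "\<forall>k\<le>n. Y (ts k) w \<in> X k" unfolding J_def by (metis PiE_E atMost_iff)
      then have "\<forall>k\<le>n. sample_path Y w (ts k) \<in> X k" unfolding sample_path_def using nonneg by simp
      with \<open>w \<in> space M\<close> show "w \<in> sample_path Y -` A \<inter> space M"
        using measurable_space[OF measurable_chain_path[OF Y], of w] unfolding A_eq by simp
    qed
    have "measure (distr M chain_paths (sample_path Y)) A = measure M (sample_path Y -` A \<inter> space M)"
      by (rule measure_distr[OF measurable_chain_path[OF Y] A'])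
    also have "\<dots> = measure M (\<Union>j\<in>J. {w \<in> space M. \<forall>k\<le>n. Y (ts k) w = j k})"
      by (simp only: cyl)
    also have "\<dots> = (\<Sum>j\<in>J. \<P>(w in M. \<forall>k\<le>n. Y (ts k) w = j k))"
    proof (rule finite_measure_finite_Union[OF \<open>finite J\<close>])
      show "(\<lambda>j. {w \<in> space M. \<forall>k\<le>n. Y (ts k) w = j k}) ` J \<subseteq> events"
        by (intro image_subsetI ev)
      show "disjoint_family_on (\<lambda>j. {w \<in> space M. \<forall>k\<le>n. Y (ts k) w = j k}) J"
        unfolding disjoint_family_on_def
      proof (intro ballI impI)
        fix j j' assume "j \<in> J" "j' \<in> J" "j \<noteq> j'"
        then obtain k where k: "k \<le> n" "j k \<noteq> j' k"
          using PiE_ext[of j "{..n}" X j'] unfolding J_def by blast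
        have False if "\<forall>k\<le>n. Y (ts k) w = j k" "\<forall>k\<le>n. Y (ts k) w = j' k" for w
          using k that(1)[rule_format, of k] that(2)[rule_format, of k] by simp
        then show "{w \<in> space M. \<forall>k\<le>n. Y (ts k) w = j k} \<inter> {w \<in> space M. \<forall>k\<le>n. Y (ts k) w = j' k} = {}"
          by blast
      qed
    qed
    also have "\<dots> = (\<Sum>j\<in>J. \<P>(w in M. Y 0 w = j 0) * q j)"
      unfolding q_def using ts J01 markov_chain_fdd[OF Y, of ts n]
      by (intro sum.cong refl) simp
    finally show ?thesis .
  qed
  have init': "\<P>(w in M. Y 0 w = 0) = 1 - \<P>(w in M. Y 0 w = (1::nat))"
    if M: "prob_space M" and Y: "markov_chain M {0, 1} (rate_matrix l) Y"
    for M :: "'w measure" and Y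
  proof -
    interpret prob_space M by fact
    have [measurable]: "Y 0 \<in> M \<rightarrow>\<^sub>M count_space {0,1}"
      using Y by (simp add: markov_chain_def)
    have Y01: "Y 0 w \<in> {0,1}" if "w \<in> space M" for w
      using Y measurable_space[of "Y 0" M "count_space {0,1}" w] that by (auto simp: markov_chain_def)
    have "{w \<in> space M. Y 0 w = 0} = space M - {w \<in> space M. Y 0 w = 1}"
      using Y01 by fastforce
    then show ?thesis by (simp add: prob_compl)
  qed
  have init_affine: "\<P>(w in M1. Y1 0 w = i) =
      (1 - x) * \<P>(w in M2. Y2 0 w = i) + x * \<P>(w in M3. Y3 0 w = i)"
    if "i = 0 \<or> i = 1" for i
  proof (cases "i = 1")
    case False
    with that have "i = 0" by simp
    show ?thesis
      unfolding \<open>i = 0\<close> init'[OF prob(1) chain(1)] init'[OF prob(2) chain(2)] init'[OF prob(3) chain(3)] init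
      by (simp add: algebra_simps)
  qed (use init in simp)
  have "\<P>(w in M1. Y1 0 w = j 0) * q j =
      (1 - x) * (\<P>(w in M2. Y2 0 w = j 0) * q j) +
      x * (\<P>(w in M3. Y3 0 w = j 0) * q j)" if "j \<in> J" for j
    using J01[OF that] by (subst init_affine) (simp_all add: algebra_simps)
  then show "measure (distr M1 chain_paths (sample_path Y1)) A =
    (1 - x) * measure (distr M2 chain_paths (sample_path Y2)) A + x * measure (distr M3 chain_paths (sample_path Y3)) A"
    unfolding sum[OF prob(1) chain(1)] sum[OF prob(2) chain(2)] sum[OF prob(3) chain(3)]
    by (simp add: sum.distrib sum_distrib_left)
qed

text \<open>Since \<open>W 0 = 0\<close>, every value is a partial sum of increments, so a cylinder
  probability is the probability of \<open>A''\<close> under a product of Gaussians that does not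
  depend on the chosen Brownian motion.\<close>

lemma noise_path_law_unique:
  assumes prob: "prob_space M1" "prob_space M2"
    and W: "brownian_motion M1 W1" "brownian_motion M2 W2"
    and C: "C \<in> sets noise_paths"
  shows "measure (distr M1 noise_paths (sample_path W1)) C = measure (distr M2 noise_paths (sample_path W2)) C"
proof -
  note path = W[THEN measurable_noise_path]
  let ?G = "prod_algebra {0::real..} (\<lambda>_. borel :: real measure)"
  let ?N1 = "distr M1 noise_paths (sample_path W1)"
  let ?N2 = "distr M2 noise_paths (sample_path W2)"
  \<comment> \<open>Uniqueness is the affine statement with weight 0 on a repeated measure.\<close>
  have "measure ?N1 C = (1 - 0) * measure ?N2 C + 0 * measure ?N2 C"
  proof (rule affine_prob_on_sigma_sets[where \<Omega> = "space noise_paths" and G = ?G])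
    show "prob_space ?N1" "prob_space ?N2" "prob_space ?N2"
      using prob path by (auto intro: prob_space.prob_space_distr)
    show "sets ?N1 = sigma_sets (space noise_paths) ?G" "sets ?N2 = sigma_sets (space noise_paths) ?G"
      "sets ?N2 = sigma_sets (space noise_paths) ?G"
      by (simp_all add: noise_paths_def sets_PiM space_PiM)
    show "?G \<subseteq> Pow (space noise_paths)"
      using prod_algebra_sets_into_space[of "{0::real..}" "\<lambda>_. borel :: real measure"]
      by (simp add: noise_paths_def space_PiM)
    show "Int_stable ?G" by (rule Int_stable_prod_algebra)
    show "C \<in> sets ?N1" using C by simp
    fix A assume A: "A \<in> ?G"
    then obtain ts n X where ts: "strict_mono ts" "ts 0 = 0" and X: "\<And>k::nat. X k \<in> sets (borel :: real measure)"
      and A_eq: "A = {z \<in> space noise_paths. \<forall>k\<le>n. z (ts k) \<in> X k}"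
      unfolding noise_paths_def by (rule cylinder_enumeration) blast
    have A': "A \<in> sets noise_paths"
      using A unfolding noise_paths_def sets_PiM by blast
    have nonneg: "0 \<le> ts k" for k
      using strict_mono_mono[OF ts(1), THEN monoD, of 0 k] ts(2) by simp
    \<comment> \<open>The index set \<open>{..<Suc n}\<close> is nonempty even for
      \<open>n = 0\<close>, as the product-law criterion for independence demands.\<close>
    define Q where "Q = PiM {..<Suc n} (\<lambda>k. density lborel (\<lambda>x. ennreal (normal_density 0 (sqrt (ts (Suc k) - ts k)) x)))"
    define A'' where "A'' = {v \<in> space (PiM {..<Suc n} (\<lambda>_. borel :: real measure)). \<forall>k\<in>{..n}. (\<Sum>l<k. v l) \<in> X k}"
    have A''[measurable]: "A'' \<in> sets (PiM {..<Suc n} (\<lambda>_. borel))"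
    proof -
      note [measurable] = X
      have [measurable]: "(\<lambda>v. \<Sum>l<k. v l) \<in> borel_measurable (PiM {..<Suc n} (\<lambda>_. borel :: real measure))" if "k \<le> n" for k
        using that by (intro borel_measurable_sum measurable_component_singleton) auto
      show ?thesis unfolding A''_def by measurable
    qed
    have law: "measure (distr M noise_paths (sample_path W)) A = measure Q A''"
      if M: "prob_space M" and W: "brownian_motion M W"
      for M :: "'w measure" and W
    proof -
      interpret prob_space M by fact
      have [measurable]: "W t \<in> borel_measurable M" if "0 \<le> t" for t
        using W that by (simp add: brownian_motion_def)
      have W0: "W 0 w = 0" if "w \<in> space M" for w
        using W that by (simp add: brownian_motion_def)
      define I where "I k w = W (ts (Suc k)) w - W (ts k) w" for k w
      have I_meas[measurable]: "I k \<in> borel_measurable M" for k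
        unfolding I_def using nonneg[of k] nonneg[of "Suc k"] by measurable
      have "indep_vars (\<lambda>_. borel) (\<lambda>k w. W (ts (Suc k)) w - W (ts k) w) {..<Suc n}"
        using W ts nonneg[of 0] unfolding brownian_motion_def by blast
      then have indep: "indep_vars (\<lambda>_. borel) I {..<Suc n}"
        by (simp add: I_def[abs_def])
      have dens: "distr M borel (I k) = density lborel (\<lambda>x. ennreal (normal_density 0 (sqrt (ts (Suc k) - ts k)) x))" for k
      proof -
        have "distributed M lborel (I k) (normal_density 0 (sqrt (ts (Suc k) - ts k)))"
          using W nonneg[of k] strict_monoD[OF ts(1), of k "Suc k"]
          unfolding I_def[abs_def] brownian_motion_def by auto
        then have "distr M lborel (I k) = density lborel (\<lambda>x. ennreal (normal_density 0 (sqrt (ts (Suc k) - ts k)) x))"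
          by (rule distributed_distr_eq_density)
        moreover have "distr M borel (I k) = distr M lborel (I k)"
          by (rule distr_cong) auto
        ultimately show ?thesis by simp
      qed
      have Q: "distr M (PiM {..<Suc n} (\<lambda>_. borel)) (\<lambda>w. \<lambda>k\<in>{..<Suc n}. I k w) = Q"
        using indep unfolding Q_def dens[symmetric]
        by (subst (asm) indep_vars_iff_distr_eq_PiM) auto
      have W_sum: "W (ts k) w = (\<Sum>l<k. I l w)" if "w \<in> space M" for k w
        using W0[OF that] using sum_lessThan_telescope[of "\<lambda>l. W (ts l) w" k] by (simp add: I_def ts)
      have "measure (distr M noise_paths (sample_path W)) A = measure M (sample_path W -` A \<inter> space M)"
        by (rule measure_distr[OF measurable_noise_path[OF W] A'])
      also have "sample_path W -` A \<inter> space M = (\<lambda>w. \<lambda>k\<in>{..<Suc n}. I k w) -` A'' \<inter> space M"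
      proof (intro set_eqI iffI; elim IntE; intro IntI; simp)
        fix w assume w: "sample_path W w \<in> A" "w \<in> space M"
        then have "\<forall>k\<in>{..n}. (\<Sum>l<k. I l w) \<in> X k"
          using nonneg W_sum by (auto simp: A_eq sample_path_def)
        moreover have "(\<Sum>l<k. if l < Suc n then I l w else undefined) = (\<Sum>l<k. I l w)" if "k \<le> n" for k
          using that by (intro sum.cong) auto
        ultimately show "(\<lambda>k\<in>{..<Suc n}. I k w) \<in> A''"
          by (simp add: A''_def space_PiM restrict_def PiE_def extensional_def)
      next
        fix w assume w: "(\<lambda>k\<in>{..<Suc n}. I k w) \<in> A''" "w \<in> space M"
        moreover have "(\<Sum>l<k. if l < Suc n then I l w else undefined) = (\<Sum>l<k. I l w)" if "k \<le> n" for k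
          using that by (intro sum.cong) auto
        ultimately have "\<forall>k\<in>{..n}. (\<Sum>l<k. I l w) \<in> X k"
          by (auto simp add: A''_def restrict_def)
        then show "sample_path W w \<in> A"
          using nonneg W_sum[OF w(2)] measurable_space[OF measurable_noise_path[OF W] w(2)]
          by (simp add: A_eq) (simp add: sample_path_def)
      qed
      also have "measure M \<dots> = measure Q A''"
        unfolding Q[symmetric] by (rule measure_distr[symmetric]) auto
      finally show ?thesis .
    qed
    show "measure ?N1 A = (1 - 0) * measure ?N2 A + 0 * measure ?N2 A"
      by (simp add: law[OF prob(1) W(1)] law[OF prob(2) W(2)])
  qed
  then show ?thesis by simp
qed

section \<open>Sigma-algebras generated by a process\<close>

lemma space_generated_by [simp]: "space (generated_by M N Z T) = space M"
  unfolding generated_by_def by (rule space_measure_of) auto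

lemma sets_generated_by:
  "sets (generated_by M N Z T) = sigma_sets (space M) (\<Union>t\<in>T. {Z t -` A \<inter> space M | A. A \<in> sets N})"
  unfolding generated_by_def by (rule sets_measure_of) auto

lemma sets_generated_by_Pow: "sets (generated_by M N Z T) \<subseteq> Pow (space M)"
  using sets.space_closed[of "generated_by M N Z T"] by simp

lemma measurable_generated_by_component:
  assumes "t \<in> T" "Z t \<in> space M \<rightarrow> space N"
  shows "Z t \<in> generated_by M N Z T \<rightarrow>\<^sub>M N"
  using assms by (intro measurableI) (auto simp: sets_generated_by)

lemma measurable_into_generated_by:
  assumes "f \<in> space L \<rightarrow> space M" "\<And>t. t \<in> T \<Longrightarrow> (\<lambda>x. Z t (f x)) \<in> L \<rightarrow>\<^sub>M N"
  shows "f \<in> L \<rightarrow>\<^sub>M generated_by M N Z T"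
proof (rule measurable_sigma_sets[OF sets_generated_by])
  fix A assume "A \<in> (\<Union>t\<in>T. {Z t -` A \<inter> space M | A. A \<in> sets N})"
  then obtain t B where t: "t \<in> T" and B: "B \<in> sets N" and A: "A = Z t -` B \<inter> space M" by blast
  have "f -` A \<inter> space L = (\<lambda>x. Z t (f x)) -` B \<inter> space L"
    using assms(1) by (auto simp: A)
  also have "\<dots> \<in> sets L" using assms(2)[OF t] B by (rule measurable_sets)
  finally show "f -` A \<inter> space L \<in> sets L" .
qed (use assms(1) in auto)

lemma sets_generated_by_mono:
  "S \<subseteq> T \<Longrightarrow> sets (generated_by M N Z S) \<subseteq> sets (generated_by M N Z T)"
  unfolding sets_generated_by by (rule sigma_sets_mono') blast

lemma sets_generated_by_subset:
  "(\<And>t. t \<in> T \<Longrightarrow> Z t \<in> M \<rightarrow>\<^sub>M N) \<Longrightarrow> sets (generated_by M N Z T) \<subseteq> sets M"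
  unfolding sets_generated_by by (intro sets.sigma_sets_subset) (auto intro: measurable_sets)

section \<open>Trajectories of a model and their product law\<close>

type_synonym coord_traj = "(real \<Rightarrow> nat) \<times> (real \<Rightarrow> real)"

definition coord_paths :: "coord_traj measure" where
  "coord_paths = chain_paths \<Otimes>\<^sub>M noise_paths"

definition coord_path :: "('w, 'n::finite) qd_space \<Rightarrow> 'n \<Rightarrow> 'w \<Rightarrow> coord_traj" where
  "coord_path D i w = (sample_path (chain D i) w, sample_path (noise D i) w)"

definition model_paths :: "('n \<Rightarrow> coord_traj) measure" where
  "model_paths = PiM UNIV (\<lambda>_. coord_paths)"

definition model_path :: "('w, 'n::finite) qd_space \<Rightarrow> 'w \<Rightarrow> 'n \<Rightarrow> coord_traj" where
  "model_path D w = (\<lambda>i. coord_path D i w)"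

definition coord_events :: "('w, 'n::finite) qd_space \<Rightarrow> 'n \<Rightarrow> 'w measure" where
  "coord_events D i = sigma (space (msr D))
    (sets (generated_by (msr D) (count_space {0, 1}) (chain D i) {0..}) \<union>
     sets (generated_by (msr D) borel (noise D i) {0..}))"

definition coord_law :: "('w, 'n::finite) qd_space \<Rightarrow> 'n \<Rightarrow> coord_traj measure" where
  "coord_law D i = distr (msr D) coord_paths (coord_path D i)"

lemma sets_coord_law [simp, measurable_cong]: "sets (coord_law D i) = sets coord_paths"
  by (simp add: coord_law_def)

lemma space_coord_law [simp]: "space (coord_law D i) = space coord_paths"
  by (simp add: coord_law_def)

locale detection_model =
  fixes \<mu> lam \<pi> :: "real ^ 'n::finite" and D :: "('w, 'n) qd_space"
  assumes model: "qd_model \<mu> lam \<pi> D"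

sublocale detection_model \<subseteq> prob_space "msr D"
  using model by (simp add: qd_model_def)

context detection_model
begin

abbreviation M :: "'w measure" where "M \<equiv> msr D"

abbreviation chain_events :: "'n \<Rightarrow> 'w measure" where
  "chain_events i \<equiv> generated_by (msr D) (count_space {0, 1}) (chain D i) {0..}"

abbreviation noise_events :: "'n \<Rightarrow> 'w measure" where
  "noise_events i \<equiv> generated_by (msr D) borel (noise D i) {0..}"

abbreviation source_events :: "'n + 'n \<Rightarrow> 'w set set" where
  "source_events \<equiv> case_sum (\<lambda>i. sets (chain_events i)) (\<lambda>i. sets (noise_events i))"

lemma markov_chain: "markov_chain M {0, 1} (rate_matrix (lam $ i)) (chain D i)"
  using model by (simp add: qd_model_def)

lemma brownian_motion: "brownian_motion M (noise D i)"
  using model by (simp add: qd_model_def)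

lemma prior: "\<P>(w in M. chain D i 0 w = 1) = \<pi> $ i"
  using model by (simp add: qd_model_def)

lemma chain_measurable: "0 \<le> t \<Longrightarrow> chain D i t \<in> M \<rightarrow>\<^sub>M count_space {0, 1}"
  using markov_chain[of i] by (simp add: markov_chain_def)

lemma chain_range: "0 \<le> t \<Longrightarrow> w \<in> space M \<Longrightarrow> chain D i t w = 0 \<or> chain D i t w = 1"
  using measurable_space[OF chain_measurable[of t i], of w] by simp

lemma indep_sources:
  "indep_sets source_events UNIV"
  using model by (simp add: qd_model_def)

lemma space_coord_events [simp]: "space (coord_events D i) = space M"
  unfolding coord_events_def by (rule space_measure_of) (intro Un_least sets_generated_by_Pow)

lemma sets_coord_events:
  "sets (coord_events D i) = sigma_sets (space M)
    (sets (chain_events i) \<union>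
     sets (noise_events i))"
  unfolding coord_events_def by (rule sets_measure_of) (intro Un_least sets_generated_by_Pow)

text \<open>The \<open>'n + 'n\<close> independent sources are grouped into the disjoint blocks
  \<open>{Inl j, Inr j}\<close>, the chain and the noise of one coordinate; disjoint blocks of an
  independent family are independent.\<close>

lemma indep_coord_events: "indep_sets (\<lambda>i. sets (coord_events D i)) UNIV"
proof -
  have "indep_sets (\<lambda>j. sigma_sets (space M) (\<Union>i\<in>{Inl j, Inr j}. source_events i)) UNIV"
  proof (rule indep_sets_collect_sigma)
    show "indep_sets source_events (\<Union>j\<in>UNIV. {Inl j, Inr j})"
      using indep_sources by (rule indep_sets_mono_index[rotated]) simp
    show "Int_stable (source_events i)" for i
      by (cases i) (auto simp: Int_stable_def)
    show "disjoint_family_on (\<lambda>j. {Inl j, Inr j}) (UNIV :: 'n set)"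
      by (auto simp: disjoint_family_on_def)
  qed
  then show ?thesis by (simp add: sets_coord_events)
qed

lemma coord_events_subset: "sets (coord_events D i) \<subseteq> events"
  using indep_coord_events by (simp add: indep_sets_def)

lemma measurable_coord_eventsD: "f \<in> coord_events D i \<rightarrow>\<^sub>M N \<Longrightarrow> f \<in> M \<rightarrow>\<^sub>M N"
  by (rule measurable_from_subalg[of _ "coord_events D i"]) (use coord_events_subset in \<open>simp_all add: subalgebra_def\<close>)

lemma measurable_chain_coord_events: "0 \<le> t \<Longrightarrow> chain D i t \<in> coord_events D i \<rightarrow>\<^sub>M count_space {0, 1}"
proof -
  assume t: "0 \<le> t"
  have "chain D i t \<in> chain_events i \<rightarrow>\<^sub>M count_space {0, 1}"
    by (rule measurable_generated_by_component) (use t chain_range in auto)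
  moreover have "subalgebra (coord_events D i) (chain_events i)"
    unfolding subalgebra_def sets_coord_events by simp blast
  ultimately show ?thesis by (rule measurable_from_subalg[rotated])
qed

lemma chain_event:
  assumes "0 \<le> t"
  shows "{w \<in> space M. chain D i t w = j} \<in> sets (coord_events D i)" "{w \<in> space M. chain D i t w = j} \<in> events"
proof -
  have "{w \<in> space M. chain D i t w = j} = chain D i t -` ({j} \<inter> {0, 1}) \<inter> space (coord_events D i)"
    using chain_range[OF assms, of _ i] by auto
  also have "\<dots> \<in> sets (coord_events D i)"
    by (rule measurable_sets[OF measurable_chain_coord_events[OF assms]]) simp
  finally show "{w \<in> space M. chain D i t w = j} \<in> sets (coord_events D i)" .
  then show "{w \<in> space M. chain D i t w = j} \<in> events" using coord_events_subset by blast
qed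

lemma measurable_noise_coord_events: "0 \<le> t \<Longrightarrow> noise D i t \<in> borel_measurable (coord_events D i)"
proof -
  assume t: "0 \<le> t"
  have "noise D i t \<in> noise_events i \<rightarrow>\<^sub>M borel"
    by (rule measurable_generated_by_component) (use t in auto)
  moreover have "subalgebra (coord_events D i) (noise_events i)"
    unfolding subalgebra_def sets_coord_events by simp blast
  ultimately show ?thesis by (rule measurable_from_subalg[rotated])
qed

lemma measurable_coord_path_coord_events: "coord_path D i \<in> coord_events D i \<rightarrow>\<^sub>M coord_paths"
proof -
  have "sample_path (chain D i) \<in> coord_events D i \<rightarrow>\<^sub>M chain_paths"
    unfolding chain_paths_def sample_path_def[abs_def]
    by (rule measurable_restrict, rule measurable_chain_coord_events) simp
  moreover have "sample_path (noise D i) \<in> coord_events D i \<rightarrow>\<^sub>M noise_paths"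
    unfolding noise_paths_def sample_path_def[abs_def]
    by (rule measurable_restrict, rule measurable_noise_coord_events) simp
  ultimately show ?thesis
    unfolding coord_path_def[abs_def] coord_paths_def by (rule measurable_Pair)
qed

lemma measurable_coord_path: "coord_path D i \<in> M \<rightarrow>\<^sub>M coord_paths"
  by (rule measurable_coord_eventsD[OF measurable_coord_path_coord_events])

lemma measurable_model_path: "model_path D \<in> M \<rightarrow>\<^sub>M model_paths"
proof -
  have "(\<lambda>w. \<lambda>i\<in>UNIV. coord_path D i w) \<in> M \<rightarrow>\<^sub>M model_paths"
    unfolding model_paths_def by (rule measurable_restrict) (rule measurable_coord_path)
  moreover have "(\<lambda>w. \<lambda>i\<in>UNIV. coord_path D i w) = model_path D"
    by (intro ext) (simp add: model_path_def)
  ultimately show ?thesis by simp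
qed

lemma indep_vars_coord_events:
  assumes "\<And>i. f i \<in> coord_events D i \<rightarrow>\<^sub>M N i"
  shows "indep_vars N f UNIV"
  unfolding indep_vars_def2
proof (intro conjI ballI)
  show "random_variable (N i) (f i)" for i
    using assms by (rule measurable_coord_eventsD)
  show "indep_sets (\<lambda>i. {f i -` A \<inter> space M |A. A \<in> sets (N i)}) UNIV"
    using indep_coord_events
  proof (rule indep_sets_mono_sets)
    fix i show "{f i -` A \<inter> space M |A. A \<in> sets (N i)} \<subseteq> sets (coord_events D i)"
      using measurable_sets[OF assms[of i]] by auto
  qed
qed

text \<open>Independence of the coordinates is the product form of the joint law. It confines a
  change of one coordinate of the prior to one factor.\<close>

lemma distr_model_path: "distr M model_paths (model_path D) = PiM UNIV (coord_law D)"
proof -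
  have "indep_vars (\<lambda>_. coord_paths) (coord_path D) UNIV"
    by (rule indep_vars_coord_events[OF measurable_coord_path_coord_events])
  then have "distr M (PiM UNIV (\<lambda>_. coord_paths)) (\<lambda>x. \<lambda>i\<in>UNIV. coord_path D i x) =
      PiM UNIV (\<lambda>i. distr M coord_paths (coord_path D i))"
    by (subst (asm) indep_vars_iff_distr_eq_PiM) (auto intro: measurable_coord_path)
  moreover have "(\<lambda>w. \<lambda>i\<in>UNIV. coord_path D i w) = model_path D"
    by (intro ext) (simp add: model_path_def)
  ultimately show ?thesis
    by (simp add: model_paths_def coord_law_def[abs_def])
qed

lemma prob_space_coord_law: "prob_space (coord_law D i)"
  unfolding coord_law_def by (rule prob_space_distr[OF measurable_coord_path])

lemma coord_law_rectangle:
  assumes C: "C \<in> sets chain_paths" and E: "E \<in> sets noise_paths"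
  shows "measure (coord_law D i) (C \<times> E) =
    measure (distr M chain_paths (sample_path (chain D i))) C *
    measure (distr M noise_paths (sample_path (noise D i))) E"
proof -
  have mC: "sample_path (chain D i) \<in> M \<rightarrow>\<^sub>M chain_paths"
    by (rule measurable_chain_path[OF markov_chain])
  have mE: "sample_path (noise D i) \<in> M \<rightarrow>\<^sub>M noise_paths"
    by (rule measurable_noise_path[OF brownian_motion])
  let ?A = "case_sum (\<lambda>_. sample_path (chain D i) -` C \<inter> space M) (\<lambda>_. sample_path (noise D i) -` E \<inter> space M) :: 'n + 'n \<Rightarrow> 'w set"
  have "sample_path (chain D i) \<in> chain_events i \<rightarrow>\<^sub>M chain_paths"
    unfolding chain_paths_def sample_path_def[abs_def]
    by (intro measurable_restrict measurable_generated_by_component) (use chain_range in auto)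
  from measurable_sets[OF this C] have A1: "?A (Inl i) \<in> source_events (Inl i)" by simp
  have "sample_path (noise D i) \<in> noise_events i \<rightarrow>\<^sub>M noise_paths"
    unfolding noise_paths_def sample_path_def[abs_def]
    by (intro measurable_restrict measurable_generated_by_component) auto
  from measurable_sets[OF this E] have A2: "?A (Inr i) \<in> source_events (Inr i)" by simp
  have "prob (\<Inter>j\<in>{Inl i, Inr i}. ?A j) = (\<Prod>j\<in>{Inl i, Inr i}. prob (?A j))"
    using indep_sources by (rule indep_setsD) (use A1 A2 in auto)
  moreover have "(\<Inter>j\<in>{Inl i, Inr i}. ?A j) = coord_path D i -` (C \<times> E) \<inter> space M"
    by (auto simp: coord_path_def)
  moreover have "C \<times> E \<in> sets coord_paths" using C E by (simp add: coord_paths_def)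
  ultimately show ?thesis
    by (simp add: coord_law_def measure_distr[OF measurable_coord_path] measure_distr[OF mC C] measure_distr[OF mE E])
qed

end

text \<open>On rectangles the law is a chain factor, affine in the prior, times a noise factor
  common to all models. The three index types may differ, so that a coordinate of the
  two-dimensional model can be compared with the one-dimensional one; \<open>\<mu>\<close> may
  differ as well, because trajectories record chain and noise rather than the observation.\<close>

lemma coord_law_affine:
  fixes i1 :: "'a::finite" and i2 :: "'b::finite" and i3 :: "'c::finite"
  assumes D: "detection_model \<mu>1 lam1 \<pi>1 D1" "detection_model \<mu>2 lam2 \<pi>2 D2" "detection_model \<mu>3 lam3 \<pi>3 D3"
    and lam: "lam2 $ i2 = lam1 $ i1" "lam3 $ i3 = lam1 $ i1"
    and prior: "\<pi>1 $ i1 = (1 - x) * \<pi>2 $ i2 + x * \<pi>3 $ i3"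
    and A: "A \<in> sets coord_paths"
  shows "measure (coord_law D1 i1) A = (1 - x) * measure (coord_law D2 i2) A + x * measure (coord_law D3 i3) A"
proof -
  interpret D1: detection_model \<mu>1 lam1 \<pi>1 D1 by fact
  interpret D2: detection_model \<mu>2 lam2 \<pi>2 D2 by fact
  interpret D3: detection_model \<mu>3 lam3 \<pi>3 D3 by fact
  let ?G = "{C \<times> E | C E. C \<in> sets chain_paths \<and> E \<in> sets noise_paths}"
  show ?thesis
  proof (rule affine_prob_on_sigma_sets[where \<Omega> = "space chain_paths \<times> space noise_paths" and G = ?G])
    show "prob_space (coord_law D1 i1)" "prob_space (coord_law D2 i2)" "prob_space (coord_law D3 i3)"
      by (rule D1.prob_space_coord_law D2.prob_space_coord_law D3.prob_space_coord_law)+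
    show "sets (coord_law D1 i1) = sigma_sets (space chain_paths \<times> space noise_paths) ?G"
      "sets (coord_law D2 i2) = sigma_sets (space chain_paths \<times> space noise_paths) ?G"
      "sets (coord_law D3 i3) = sigma_sets (space chain_paths \<times> space noise_paths) ?G"
      by (simp_all add: coord_paths_def sets_pair_measure)
    show "?G \<subseteq> Pow (space chain_paths \<times> space noise_paths)"
      by (rule pair_measure_closed)
    show "Int_stable ?G" by (rule Int_stable_pair_measure_generator)
    show "A \<in> sets (coord_law D1 i1)" using A by simp
    fix A assume "A \<in> ?G"
    then obtain C E where A: "A = C \<times> E" and C: "C \<in> sets chain_paths" and E: "E \<in> sets noise_paths" by blast
    have c: "measure (distr (msr D1) chain_paths (sample_path (chain D1 i1))) C =
        (1 - x) * measure (distr (msr D2) chain_paths (sample_path (chain D2 i2))) C +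
        x * measure (distr (msr D3) chain_paths (sample_path (chain D3 i3))) C"
    proof (rule chain_path_law_affine[where l = "lam1 $ i1"])
      show "prob_space (msr D1)" "prob_space (msr D2)" "prob_space (msr D3)"
        by (rule D1.prob_space_axioms D2.prob_space_axioms D3.prob_space_axioms)+
      show "markov_chain (msr D1) {0, 1} (rate_matrix (lam1 $ i1)) (chain D1 i1)"
        by (rule D1.markov_chain)
      show "markov_chain (msr D2) {0, 1} (rate_matrix (lam1 $ i1)) (chain D2 i2)"
        using D2.markov_chain[of i2] by (simp add: lam)
      show "markov_chain (msr D3) {0, 1} (rate_matrix (lam1 $ i1)) (chain D3 i3)"
        using D3.markov_chain[of i3] by (simp add: lam)
    qed (use prior C D1.prior D2.prior D3.prior in simp_all)
    have n2: "measure (distr (msr D1) noise_paths (sample_path (noise D1 i1))) E =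
        measure (distr (msr D2) noise_paths (sample_path (noise D2 i2))) E"
      by (intro noise_path_law_unique D1.prob_space_axioms D2.prob_space_axioms D1.brownian_motion D2.brownian_motion E)
    have n3: "measure (distr (msr D1) noise_paths (sample_path (noise D1 i1))) E =
        measure (distr (msr D3) noise_paths (sample_path (noise D3 i3))) E"
      by (intro noise_path_law_unique D1.prob_space_axioms D3.prob_space_axioms D1.brownian_motion D3.brownian_motion E)
    show "measure (coord_law D1 i1) A = (1 - x) * measure (coord_law D2 i2) A + x * measure (coord_law D3 i3) A"
      unfolding A D1.coord_law_rectangle[OF C E] D2.coord_law_rectangle[OF C E] D3.coord_law_rectangle[OF C E] c
        n2[symmetric] n3[symmetric]
      by (simp add: algebra_simps)
  qed
qed

text \<open>Affinity with weight \<open>x = 0\<close>. It identifies a coordinate in dimension two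
  with the one-dimensional model of equal rate and prior.\<close>

lemma coord_law_unique:
  fixes i1 :: "'a::finite" and i2 :: "'b::finite"
  assumes D: "detection_model \<mu>1 lam1 \<pi>1 D1" "detection_model \<mu>2 lam2 \<pi>2 D2"
    and "lam2 $ i2 = lam1 $ i1" "\<pi>2 $ i2 = \<pi>1 $ i1"
  shows "coord_law D1 i1 = coord_law D2 i2"
proof (rule measure_eqI)
  interpret N1: prob_space "coord_law D1 i1" using D(1) by (rule detection_model.prob_space_coord_law)
  interpret N2: prob_space "coord_law D2 i2" using D(2) by (rule detection_model.prob_space_coord_law)
  fix A assume "A \<in> sets (coord_law D1 i1)"
  then show "emeasure (coord_law D1 i1) A = emeasure (coord_law D2 i2) A"
    using coord_law_affine[OF D(1,2,2), of i2 i1 i2 0 A] assms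
    by (simp add: N1.emeasure_eq_measure N2.emeasure_eq_measure)
qed simp

text \<open>On a box the probability is a product over the coordinates. Factor \<open>i\<close> is
  affine in its prior and the others coincide by uniqueness, so the law is affine in each coordinate
  separately, not jointly.\<close>

lemma model_law_affine:
  fixes D1 :: "('u, 'n::finite) qd_space" and D2 :: "('v, 'n) qd_space" and D3 :: "('w, 'n) qd_space"
  assumes D: "detection_model \<mu> lam \<pi>1 D1" "detection_model \<mu> lam \<pi>2 D2" "detection_model \<mu> lam \<pi>3 D3"
    and prior: "\<pi>1 $ i = (1 - x) * \<pi>2 $ i + x * \<pi>3 $ i"
    and other: "\<And>j. j \<noteq> i \<Longrightarrow> \<pi>2 $ j = \<pi>1 $ j" "\<And>j. j \<noteq> i \<Longrightarrow> \<pi>3 $ j = \<pi>1 $ j"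
    and A: "A \<in> sets model_paths"
  shows "measure (distr (msr D1) model_paths (model_path D1)) A =
    (1 - x) * measure (distr (msr D2) model_paths (model_path D2)) A +
    x * measure (distr (msr D3) model_paths (model_path D3)) A"
proof -
  interpret D1: detection_model \<mu> lam \<pi>1 D1 by fact
  interpret D2: detection_model \<mu> lam \<pi>2 D2 by fact
  interpret D3: detection_model \<mu> lam \<pi>3 D3 by fact
  let ?\<Omega> = "\<Pi>\<^sub>E i\<in>UNIV. space coord_paths"
  let ?G = "{Pi\<^sub>E UNIV E | E. \<forall>i::'n. E i \<in> sets coord_paths}"
  have rect: "measure (PiM UNIV (coord_law D)) (Pi\<^sub>E UNIV E) = (\<Prod>i\<in>UNIV. measure (coord_law D i) (E i))"
    if "detection_model \<mu> lam \<pi> D" "\<And>i. E i \<in> sets coord_paths" for D :: "('z, 'n) qd_space" and \<pi> E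
  proof -
    interpret D: detection_model \<mu> lam \<pi> D by fact
    interpret product_prob_space "coord_law D" UNIV
      by (rule product_prob_spaceI) (rule D.prob_space_coord_law)
    interpret finite_product_prob_space "coord_law D" UNIV
      by standard simp
    show ?thesis using that(2) by (intro prob_times) auto
  qed
  have "measure (PiM UNIV (coord_law D1)) A =
    (1 - x) * measure (PiM UNIV (coord_law D2)) A + x * measure (PiM UNIV (coord_law D3)) A"
  proof (rule affine_prob_on_sigma_sets[where \<Omega> = ?\<Omega> and G = ?G])
    show "prob_space (PiM UNIV (coord_law D1))" "prob_space (PiM UNIV (coord_law D2))"
      "prob_space (PiM UNIV (coord_law D3))"
      by (auto intro!: prob_space_PiM D1.prob_space_coord_law D2.prob_space_coord_law D3.prob_space_coord_law)
    have gen: "sets (PiM UNIV (\<lambda>_::'n. coord_paths)) = sigma_sets ?\<Omega> ?G"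
      by (subst sets_PiM_finite) (auto simp: Pi_iff)
    have law: "sets (PiM UNIV (coord_law D)) = sigma_sets ?\<Omega> ?G" for D :: "('z, 'n) qd_space"
      unfolding gen[symmetric] by (rule sets_PiM_cong) simp_all
    show "sets (PiM UNIV (coord_law D1)) = sigma_sets ?\<Omega> ?G"
      "sets (PiM UNIV (coord_law D2)) = sigma_sets ?\<Omega> ?G" "sets (PiM UNIV (coord_law D3)) = sigma_sets ?\<Omega> ?G"
      by (rule law)+
    show "?G \<subseteq> Pow ?\<Omega>" by (auto simp: PiE_iff) (meson sets.sets_into_space subsetD)
    show "Int_stable ?G"
    proof (rule Int_stableI)
      fix a b assume "a \<in> ?G" "b \<in> ?G"
      then obtain E F where "a = Pi\<^sub>E UNIV E" "b = Pi\<^sub>E UNIV F" "\<forall>i. E i \<in> sets coord_paths" "\<forall>i. F i \<in> sets coord_paths"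
        by blast
      then show "a \<inter> b \<in> ?G" by (auto simp: PiE_Int)
    qed
    show "A \<in> sets (PiM UNIV (coord_law D1))"
      using A unfolding law gen[symmetric] by (simp add: model_paths_def)
    fix A assume "A \<in> ?G"
    then obtain E where A: "A = Pi\<^sub>E UNIV E" and E: "\<And>i. E i \<in> sets coord_paths" by blast
    have split: "(\<Prod>i\<in>UNIV. f i) = f i * (\<Prod>j\<in>UNIV - {i}. f j)" for f :: "'n \<Rightarrow> real"
      by (subst prod.remove[of _ i]) auto
    have c: "measure (coord_law D1 i) (E i) = (1 - x) * measure (coord_law D2 i) (E i) + x * measure (coord_law D3 i) (E i)"
      by (rule coord_law_affine[OF D]) (use prior E in auto)
    have p2: "(\<Prod>j\<in>UNIV - {i}. measure (coord_law D2 j) (E j)) = (\<Prod>j\<in>UNIV - {i}. measure (coord_law D1 j) (E j))"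
      using other by (intro prod.cong refl arg_cong2[where f=measure] coord_law_unique[OF D(2,1)]) auto
    have p3: "(\<Prod>j\<in>UNIV - {i}. measure (coord_law D3 j) (E j)) = (\<Prod>j\<in>UNIV - {i}. measure (coord_law D1 j) (E j))"
      using other by (intro prod.cong refl arg_cong2[where f=measure] coord_law_unique[OF D(3,1)]) auto
    show "measure (PiM UNIV (coord_law D1)) A =
      (1 - x) * measure (PiM UNIV (coord_law D2)) A + x * measure (PiM UNIV (coord_law D3)) A"
      unfolding A rect[OF D(1) E] rect[OF D(2) E] rect[OF D(3) E]
      by (simp only: split p2 p3 c) (simp add: algebra_simps)
  qed
  then show ?thesis
    by (simp add: D1.distr_model_path D2.distr_model_path D3.distr_model_path)
qed

section \<open>Observations as functionals of the paths\<close>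

lemma borel_measurable_vec_iff:
  fixes f :: "'a \<Rightarrow> real ^ 'n::finite"
  shows "f \<in> borel_measurable M \<longleftrightarrow> (\<forall>i. (\<lambda>x. f x $ i) \<in> borel_measurable M)"
proof -
  have "f \<in> borel_measurable M \<longleftrightarrow> (\<forall>b\<in>Basis. (\<lambda>x. f x \<bullet> b) \<in> borel_measurable M)"
    by (rule borel_measurable_euclidean_space)
  also have "\<dots> \<longleftrightarrow> (\<forall>i. (\<lambda>x. f x $ i) \<in> borel_measurable M)"
    by (simp add: Basis_vec_def inner_axis)
  finally show ?thesis .
qed

text \<open>The first multiple of \<open>1 / Suc n\<close> strictly after \<open>u\<close>.
  Strictness makes the approximation come from the right, where the chains are eventually constant;
  the countable range makes a process evaluated there jointly measurable.\<close>

definition right_grid :: "nat \<Rightarrow> real \<Rightarrow> real" where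
  "right_grid n u = (real_of_int \<lfloor>real (Suc n) * u\<rfloor> + 1) / real (Suc n)"

lemma right_grid_bounds: "u < right_grid n u" "right_grid n u \<le> u + 1 / real (Suc n)"
proof -
  have "real (Suc n) * u < real_of_int \<lfloor>real (Suc n) * u\<rfloor> + 1" by linarith
  then show "u < right_grid n u" by (simp add: right_grid_def pos_less_divide_eq mult.commute del: of_nat_Suc)
  have "real_of_int \<lfloor>real (Suc n) * u\<rfloor> + 1 \<le> (u + 1 / real (Suc n)) * real (Suc n)"
  proof -
    have "real_of_int \<lfloor>real (Suc n) * u\<rfloor> \<le> real (Suc n) * u" by linarith
    moreover have "(u + 1 / real (Suc n)) * real (Suc n) = real (Suc n) * u + 1"
      by (simp add: field_simps del: of_nat_Suc)
    ultimately show ?thesis by linarith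
  qed
  then show "right_grid n u \<le> u + 1 / real (Suc n)"
    unfolding right_grid_def by (subst pos_divide_le_eq) (auto simp del: of_nat_Suc)
qed

lemma filterlim_right_grid: "filterlim (\<lambda>n. right_grid n u) (at_right u) sequentially"
  unfolding filterlim_at
proof
  show "\<forall>\<^sub>F n in sequentially. right_grid n u \<in> {u<..} \<and> right_grid n u \<noteq> u"
  proof (intro always_eventually allI)
    fix n show "right_grid n u \<in> {u<..} \<and> right_grid n u \<noteq> u"
      using right_grid_bounds(1)[of u n] by simp
  qed
  show "(\<lambda>n. right_grid n u) \<longlonglongrightarrow> u"
  proof (rule real_tendsto_sandwich[where f = "\<lambda>_. u" and h = "\<lambda>n. u + 1 / real (Suc n)"])
    have "(\<lambda>n. u + 1 / real (Suc n)) \<longlonglongrightarrow> u + 0"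
      using LIMSEQ_inverse_real_of_nat by (intro tendsto_add tendsto_const) (simp add: inverse_eq_divide)
    then show "(\<lambda>n. u + 1 / real (Suc n)) \<longlonglongrightarrow> u" by simp
  qed (use right_grid_bounds[where u = u] in \<open>auto intro: always_eventually less_imp_le\<close>)
qed

lemma measurable_at_right_grid:
  fixes f :: "real \<Rightarrow> 'a \<Rightarrow> real"
  assumes "\<And>t. f t \<in> borel_measurable M"
  shows "(\<lambda>x. f (right_grid n (fst x)) (snd x)) \<in> borel_measurable (borel \<Otimes>\<^sub>M M)"
proof -
  have "(\<lambda>x. f ((real_of_int k + 1) / real (Suc n)) (snd x)) \<in> borel_measurable (borel \<Otimes>\<^sub>M M)" for k :: int
    using assms by measurable
  moreover have "(\<lambda>x. \<lfloor>real (Suc n) * fst x\<rfloor>) \<in> (borel :: real measure) \<Otimes>\<^sub>M M \<rightarrow>\<^sub>M count_space UNIV"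
    by measurable
  ultimately show ?thesis
    unfolding right_grid_def by (rule measurable_compose_countable)
qed

lemma jointly_measurable_right_continuous:
  fixes f :: "real \<Rightarrow> 'a \<Rightarrow> real"
  assumes "\<And>t. f t \<in> borel_measurable M"
    and "\<And>w u. w \<in> space M \<Longrightarrow> ((\<lambda>s. f s w) \<longlongrightarrow> f u w) (at_right u)"
  shows "(\<lambda>x. f (fst x) (snd x)) \<in> borel_measurable (borel \<Otimes>\<^sub>M M)"
proof (rule borel_measurable_LIMSEQ_real)
  show "(\<lambda>x. f (right_grid n (fst x)) (snd x)) \<in> borel_measurable (borel \<Otimes>\<^sub>M M)" for n
    using assms(1) by (rule measurable_at_right_grid)
  show "(\<lambda>n. f (right_grid n (fst x)) (snd x)) \<longlonglongrightarrow> f (fst x) (snd x)" if "x \<in> space (borel \<Otimes>\<^sub>M M)" for x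
    using that by (intro filterlim_compose[OF assms(2) filterlim_right_grid]) (simp add: space_pair_measure mem_Times_iff)
qed

text \<open>An arbitrary element of \<^const>\<open>chain_paths\<close> need not be Lebesgue measurable; the regularised path
  always is, and it agrees with the path if that is right-continuous.\<close>

definition regularised_path :: "(real \<Rightarrow> nat) \<Rightarrow> real \<Rightarrow> real" where
  "regularised_path y u = lim (\<lambda>n. real (y (max 0 (right_grid n u))))"

definition signal :: "real \<Rightarrow> real \<Rightarrow> coord_traj \<Rightarrow> real" where
  "signal m t z = m * (LBINT u:{0..t}. regularised_path (fst z) u) + snd z t"

lemma measurable_chain_coordinate: "0 \<le> t \<Longrightarrow> (\<lambda>z. fst z t) \<in> coord_paths \<rightarrow>\<^sub>M count_space {0, 1}"
proof -
  assume "0 \<le> t"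
  then have "(\<lambda>y. y t) \<in> chain_paths \<rightarrow>\<^sub>M count_space {0, 1}"
    unfolding chain_paths_def by (intro measurable_component_singleton) simp
  then show ?thesis unfolding coord_paths_def by (rule measurable_compose[OF measurable_fst])
qed

lemma measurable_noise_coordinate: "0 \<le> t \<Longrightarrow> (\<lambda>z. snd z t) \<in> borel_measurable coord_paths"
proof -
  assume "0 \<le> t"
  then have "(\<lambda>y. y t) \<in> borel_measurable noise_paths"
    unfolding noise_paths_def by (intro measurable_component_singleton) simp
  then show ?thesis unfolding coord_paths_def by (rule measurable_compose[OF measurable_snd])
qed

lemma measurable_signal:
  assumes "0 \<le> t"
  shows "signal m t \<in> borel_measurable coord_paths"
proof -
  have 1: "(\<lambda>z. real (fst z (max 0 u))) \<in> borel_measurable coord_paths" for u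
    by (rule measurable_compose[OF measurable_chain_coordinate]) auto
  have "(\<lambda>x. regularised_path (fst (snd x)) (fst x)) \<in> borel_measurable (borel \<Otimes>\<^sub>M coord_paths)"
    unfolding regularised_path_def
    using measurable_at_right_grid[of "\<lambda>u z. real (fst z (max 0 u))", OF 1]
    by (rule borel_measurable_lim_metric)
  then have "(\<lambda>x. regularised_path (fst (snd x)) (fst x)) \<in> borel_measurable (lborel \<Otimes>\<^sub>M coord_paths)"
    by (simp cong: measurable_cong_sets)
  from measurable_compose[OF measurable_pair_swap' this]
  have [measurable]: "(\<lambda>x. regularised_path (fst (fst x)) (snd x)) \<in> borel_measurable (coord_paths \<Otimes>\<^sub>M lborel)"
    by (simp add: case_prod_beta)
  have "(\<lambda>z. \<integral>u. indicator {0..t} u * regularised_path (fst z) u \<partial>lborel) \<in> borel_measurable coord_paths"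
    by (rule lborel.borel_measurable_lebesgue_integral) (simp add: case_prod_beta)
  then show ?thesis
    using measurable_noise_coordinate[OF assms]
    unfolding signal_def[abs_def] set_lebesgue_integral_def by (simp add: borel_measurable_add borel_measurable_times)
qed

definition model_signal :: "real ^ 'n::finite \<Rightarrow> real \<Rightarrow> ('n \<Rightarrow> coord_traj) \<Rightarrow> real ^ 'n" where
  "model_signal \<mu> t z = (\<chi> i. signal (\<mu> $ i) t (z i))"

text \<open>The observed information on path space, free of any prior; rules are formulated against
  it.\<close>

definition model_filtration :: "real ^ 'n::finite \<Rightarrow> real \<Rightarrow> ('n \<Rightarrow> coord_traj) measure" where
  "model_filtration \<mu> t = generated_by model_paths borel (model_signal \<mu>) {0..t}"

lemma space_model_filtration [simp]: "space (model_filtration \<mu> t) = space model_paths"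
  by (simp add: model_filtration_def)

lemma model_filtration_mono: "s \<le> t \<Longrightarrow> sets (model_filtration \<mu> s) \<subseteq> sets (model_filtration \<mu> t)"
  unfolding model_filtration_def by (rule sets_generated_by_mono) auto

lemma measurable_model_coordinate: "(\<lambda>z. z i) \<in> model_paths \<rightarrow>\<^sub>M coord_paths"
  unfolding model_paths_def by (rule measurable_component_singleton) simp

lemma measurable_model_signal: "0 \<le> t \<Longrightarrow> model_signal \<mu> t \<in> borel_measurable model_paths"
  unfolding borel_measurable_vec_iff model_signal_def
  by (auto intro!: measurable_compose[OF measurable_model_coordinate measurable_signal])

lemma model_filtration_subset: "sets (model_filtration \<mu> t) \<subseteq> sets model_paths"
  unfolding model_filtration_def
  by (rule sets_generated_by_subset) (auto intro: measurable_model_signal)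

lemma measurable_signal_model_filtration:
  assumes "0 \<le> s" "s \<le> t"
  shows "(\<lambda>z. signal (\<mu> $ i) s (z i)) \<in> borel_measurable (model_filtration \<mu> t)"
proof -
  have "model_signal \<mu> s \<in> borel_measurable (model_filtration \<mu> t)"
    unfolding model_filtration_def using assms by (intro measurable_generated_by_component) auto
  then show ?thesis by (simp add: borel_measurable_vec_iff model_signal_def)
qed

lemma measurable_into_model_filtration:
  assumes "f \<in> space L \<rightarrow> space model_paths"
    and "\<And>s i. 0 \<le> s \<Longrightarrow> s \<le> t \<Longrightarrow> (\<lambda>x. signal (\<mu> $ i) s (f x i)) \<in> borel_measurable L"
  shows "f \<in> L \<rightarrow>\<^sub>M model_filtration \<mu> t"
  unfolding model_filtration_def
  by (rule measurable_into_generated_by[OF assms(1)])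
     (use assms(2) in \<open>auto simp: borel_measurable_vec_iff model_signal_def\<close>)

text \<open>Preimages commute with generating a sigma-algebra. The result is an equality, so every
  event generated by \<open>Z\<close> can be lifted to the target space of \<open>f\<close>.\<close>

lemma vimage_generated_by:
  assumes f: "f \<in> \<Omega> \<rightarrow> space N" and \<Omega>: "\<Omega> = space M"
    and Z: "\<And>t w. t \<in> T \<Longrightarrow> w \<in> \<Omega> \<Longrightarrow> Z' t (f w) = Z t w"
  shows "sets (generated_by M L Z T) = {f -` A \<inter> \<Omega> | A. A \<in> sets (generated_by N L Z' T)}"
proof -
  have eq: "Z t -` A \<inter> \<Omega> = f -` (Z' t -` A \<inter> space N) \<inter> \<Omega>" if "t \<in> T" for t A
    using f Z[OF that] by auto
  have "{f -` A \<inter> \<Omega> | A. A \<in> (\<Union>t\<in>T. {Z' t -` A \<inter> space N | A. A \<in> sets L})} =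
      (\<Union>t\<in>T. {Z t -` A \<inter> \<Omega> | A. A \<in> sets L})" (is "?l = ?r")
  proof
    show "?l \<subseteq> ?r" using eq by fastforce
    show "?r \<subseteq> ?l"
    proof
      fix B assume "B \<in> ?r"
      then obtain t A where t: "t \<in> T" "A \<in> sets L" "B = Z t -` A \<inter> \<Omega>" by blast
      then have "B = f -` (Z' t -` A \<inter> space N) \<inter> \<Omega>" using eq by simp
      then show "B \<in> ?l" using t by blast
    qed
  qed
  then show ?thesis
    unfolding sets_generated_by sigma_sets_vimage_commute[OF f] by (simp only: \<Omega>)
qed

section \<open>The observation filtration of a model\<close>

context detection_model
begin

lemma model_path_space: "w \<in> space M \<Longrightarrow> model_path D w \<in> space model_paths"
  by (rule measurable_space[OF measurable_model_path])

lemma regularised_chain_path: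
  assumes "w \<in> space M" "0 \<le> u"
  shows "regularised_path (sample_path (chain D i) w) u = real (chain D i u w)"
proof -
  have "\<forall>\<^sub>F s in at_right u. chain D i s w = chain D i u w"
    using markov_chain[of i] assms by (simp add: markov_chain_def)
  then have "\<forall>\<^sub>F n in sequentially. chain D i (right_grid n u) w = chain D i u w"
    by (rule eventually_compose_filterlim[OF _ filterlim_right_grid])
  then have "\<forall>\<^sub>F n in sequentially. real (sample_path (chain D i) w (max 0 (right_grid n u))) = real (chain D i u w)"
  proof eventually_elim
    case (elim n)
    have "0 < right_grid n u" using right_grid_bounds(1)[of u n] assms(2) by linarith
    with elim show ?case by (simp add: sample_path_def)
  qed
  then show ?thesis
    unfolding regularised_path_def by (intro limI tendsto_eventually)
qed

lemma signal_coord_path: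
  assumes "0 \<le> t" "w \<in> space M"
  shows "signal (\<mu> $ i) t (coord_path D i w) = obs \<mu> D t w $ i"
proof -
  have "(LBINT u:{0..t}. regularised_path (sample_path (chain D i) w) u) = (LBINT u:{0..t}. real (chain D i u w))"
    by (rule set_lebesgue_integral_cong) (use assms regularised_chain_path in auto)
  then show ?thesis
    using assms by (simp add: signal_def coord_path_def obs_def sample_path_def)
qed

lemma model_signal_model_path:
  assumes "0 \<le> t" "w \<in> space M"
  shows "model_signal \<mu> t (model_path D w) = obs \<mu> D t w"
  using signal_coord_path[OF assms] by (simp add: model_signal_def model_path_def vec_eq_iff)

lemma obs_filtration_real:
  "0 \<le> t \<Longrightarrow> obs_filtration \<mu> D (ennreal t) = generated_by M borel (obs \<mu> D) {0..t}"
  unfolding obs_filtration_def generated_filtration_def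
  by (rule arg_cong[where f = "generated_by M borel (obs \<mu> D)"]) auto

lemma space_obs_filtration [simp]: "space (obs_filtration \<mu> D t) = space M"
  by (simp add: obs_filtration_def generated_filtration_def)

text \<open>The observation factors through the trajectory at every point of \<open>space M\<close>,
  not just almost surely. Hence an event known at time \<open>t\<close> in one model is given by a
  set of trajectories, which makes sense under every prior.\<close>

lemma sets_obs_filtration:
  assumes "0 \<le> t"
  shows "sets (obs_filtration \<mu> D (ennreal t)) = {model_path D -` A \<inter> space M | A. A \<in> sets (model_filtration \<mu> t)}"
  unfolding obs_filtration_real[OF assms] model_filtration_def
  by (rule vimage_generated_by) (auto simp: model_path_space model_signal_model_path)

lemma obs_coord_measurable:
  assumes "0 \<le> t"
  shows "(\<lambda>w. obs \<mu> D t w $ i) \<in> borel_measurable (coord_events D i)"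
proof -
  have "(\<lambda>w. signal (\<mu> $ i) t (coord_path D i w)) \<in> borel_measurable (coord_events D i)"
    by (rule measurable_compose[OF measurable_coord_path_coord_events measurable_signal[OF assms]])
  then show ?thesis
    by (rule measurable_cong[THEN iffD1, rotated]) (simp add: signal_coord_path assms)
qed

section \<open>Observation of single coordinates and conditional independence\<close>

definition coord_obs :: "'n \<Rightarrow> real \<Rightarrow> 'w measure" where
  "coord_obs i t = generated_by M borel (\<lambda>s w. obs \<mu> D s w $ i) {0..t}"

lemma space_coord_obs [simp]: "space (coord_obs i t) = space M"
  by (simp add: coord_obs_def)

lemma coord_obs_subset: "sets (coord_obs i t) \<subseteq> sets (coord_events D i)"
proof -
  have "(\<lambda>x. x) \<in> coord_events D i \<rightarrow>\<^sub>M coord_obs i t"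
    unfolding coord_obs_def by (rule measurable_into_generated_by) (auto intro: obs_coord_measurable)
  from measurable_sets[OF this] show ?thesis
    using sets.sets_into_space[of _ "coord_obs i t"] by (fastforce simp: Int_absorb2)
qed

lemma coord_obs_subset_events: "sets (coord_obs i t) \<subseteq> events"
  using coord_obs_subset coord_events_subset by blast

text \<open>An intersection-stable generator of the observation filtration whose members split into
  events of independent coordinates.\<close>

definition obs_rectangles :: "real \<Rightarrow> 'w set set" where
  "obs_rectangles t = {\<Inter>i\<in>UNIV. A i | A. \<forall>i. A i \<in> sets (coord_obs i t)}"

lemma Int_stable_obs_rectangles: "Int_stable (obs_rectangles t)"
proof (rule Int_stableI)
  fix a b assume "a \<in> obs_rectangles t" "b \<in> obs_rectangles t"
  then obtain A B where "a = (\<Inter>i\<in>UNIV. A i)" "b = (\<Inter>i\<in>UNIV. B i)"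
    "\<forall>i. A i \<in> sets (coord_obs i t)" "\<forall>i. B i \<in> sets (coord_obs i t)"
    by (auto simp: obs_rectangles_def)
  then have "a \<inter> b = (\<Inter>i\<in>UNIV. A i \<inter> B i)" "\<forall>i. A i \<inter> B i \<in> sets (coord_obs i t)"
    by auto
  then show "a \<inter> b \<in> obs_rectangles t"
    unfolding obs_rectangles_def by (intro CollectI exI[of _ "\<lambda>i. A i \<inter> B i"]) simp
qed

lemma obs_rectangles_Pow: "obs_rectangles t \<subseteq> Pow (space M)"
proof
  fix a assume "a \<in> obs_rectangles t"
  then obtain A where "a = (\<Inter>i\<in>UNIV. A i)" "\<forall>i. A i \<in> sets (coord_obs i t)"
    by (auto simp: obs_rectangles_def)
  then show "a \<in> Pow (space M)"
    using sets.sets_into_space[of "A undefined" "coord_obs undefined t"] by auto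
qed

lemma coord_obs_rectangle:
  assumes "A \<in> sets (coord_obs i t)"
  shows "A \<in> obs_rectangles t"
proof -
  have "A = (\<Inter>j\<in>UNIV. if j = i then A else space M)"
    using sets.sets_into_space[OF assms] by (auto split: if_splits)
  moreover have "(if j = i then A else space M) \<in> sets (coord_obs j t)" for j
    using assms sets.top[of "coord_obs j t"] by simp
  ultimately show ?thesis
    unfolding obs_rectangles_def by (intro CollectI exI[of _ "\<lambda>j. if j = i then A else space M"]) simp
qed

lemma sets_obs_filtration_rectangles:
  assumes "0 \<le> t"
  shows "sets (obs_filtration \<mu> D (ennreal t)) = sigma_sets (space M) (obs_rectangles t)"
proof
  define S where "S = sigma (space M) (obs_rectangles t)"
  have S: "space S = space M" "sets S = sigma_sets (space M) (obs_rectangles t)"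
    using obs_rectangles_Pow by (simp_all add: S_def space_measure_of sets_measure_of)
  have "(\<lambda>x. x) \<in> S \<rightarrow>\<^sub>M obs_filtration \<mu> D (ennreal t)"
    unfolding obs_filtration_real[OF assms]
  proof (rule measurable_into_generated_by)
    fix s assume s: "s \<in> {0..t}"
    show "obs \<mu> D s \<in> borel_measurable S"
      unfolding borel_measurable_vec_iff
    proof
      fix i
      have m: "(\<lambda>w. obs \<mu> D s w $ i) \<in> borel_measurable (coord_obs i t)"
        unfolding coord_obs_def by (rule measurable_generated_by_component[OF s]) simp
      have "subalgebra S (coord_obs i t)"
        unfolding subalgebra_def S using coord_obs_rectangle by auto
      then show "(\<lambda>w. obs \<mu> D s w $ i) \<in> borel_measurable S"
        using m by (rule measurable_from_subalg)
    qed
  qed (simp add: S)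
  from measurable_sets[OF this]
  show "sets (obs_filtration \<mu> D (ennreal t)) \<subseteq> sigma_sets (space M) (obs_rectangles t)"
    using sets.sets_into_space[of _ "obs_filtration \<mu> D (ennreal t)"] by (fastforce simp: Int_absorb2 S)
  show "sigma_sets (space M) (obs_rectangles t) \<subseteq> sets (obs_filtration \<mu> D (ennreal t))"
  proof -
    have "sets (coord_obs i t) \<subseteq> sets (obs_filtration \<mu> D (ennreal t))" for i
    proof -
      have "(\<lambda>x. x) \<in> obs_filtration \<mu> D (ennreal t) \<rightarrow>\<^sub>M coord_obs i t"
        unfolding coord_obs_def
      proof (rule measurable_into_generated_by)
        fix s assume "s \<in> {0..t}"
        then have "obs \<mu> D s \<in> borel_measurable (obs_filtration \<mu> D (ennreal t))"
          unfolding obs_filtration_real[OF assms] by (rule measurable_generated_by_component) simp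
        then show "(\<lambda>w. obs \<mu> D s w $ i) \<in> borel_measurable (obs_filtration \<mu> D (ennreal t))"
          by (simp add: borel_measurable_vec_iff)
      qed simp
      from measurable_sets[OF this] show ?thesis
        using sets.sets_into_space[of _ "coord_obs i t"] by (fastforce simp: Int_absorb2)
    qed
    then have "obs_rectangles t \<subseteq> sets (obs_filtration \<mu> D (ennreal t))"
      unfolding obs_rectangles_def by (auto intro!: sets.finite_INT)
    from sets.sigma_sets_subset[OF this] show ?thesis by simp
  qed
qed

lemma obs_filtration_subset: "0 \<le> t \<Longrightarrow> sets (obs_filtration \<mu> D (ennreal t)) \<subseteq> events"
  unfolding sets_obs_filtration_rectangles obs_rectangles_def
  using coord_obs_subset_events
  by (intro sets.sigma_sets_subset) (auto intro!: sets.finite_INT)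

lemma obs_filtration_mono: "0 \<le> s \<Longrightarrow> s \<le> t \<Longrightarrow> sets (obs_filtration \<mu> D (ennreal s)) \<subseteq> sets (obs_filtration \<mu> D (ennreal t))"
  by (simp add: obs_filtration_real sets_generated_by_mono)

text \<open>Both set integrals are countably additive in the set, so agreement spreads from the
  rectangles to the sigma-algebra they generate.\<close>

lemma set_integral_eq_obs_filtration:
  fixes f g :: "'w \<Rightarrow> real"
  assumes t: "0 \<le> t" and f: "integrable M f" and g: "integrable M g"
    and eq: "\<And>A. A \<in> obs_rectangles t \<Longrightarrow> (LINT w:A|M. f w) = (LINT w:A|M. g w)"
    and A: "A \<in> sets (obs_filtration \<mu> D (ennreal t))"
  shows "(LINT w:A|M. f w) = (LINT w:A|M. g w)"
proof -
  have sub: "sigma_sets (space M) (obs_rectangles t) \<subseteq> events"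
    using obs_filtration_subset[OF t] by (simp add: sets_obs_filtration_rectangles[OF t])
  have int: "set_integrable M B f" "set_integrable M B g" if "B \<in> events" for B
    unfolding set_integrable_def by (intro integrable_mult_indicator that f g)+
  \<comment> \<open>The total integrals must agree too, which is what passing to complements
    uses.\<close>
  have space: "space M \<in> obs_rectangles t"
    using coord_obs_rectangle[OF sets.top] by simp
  from A[unfolded sets_obs_filtration_rectangles[OF t]] show ?thesis
  proof (induct rule: sigma_sets_induct_disjoint[OF Int_stable_obs_rectangles obs_rectangles_Pow, consumes 1, case_names basic empty compl union])
    case (basic A)
    then show ?case by (rule eq)
  next
    case empty
    then show ?case by (simp add: set_lebesgue_integral_def)
  next
    case (compl A)
    then have A: "A \<in> events" using sub by blast
    have split: "(LINT w:space M - A|M. h w) = (LINT w:space M|M. h w) - (LINT w:A|M. h w)"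
      if "\<And>B. B \<in> events \<Longrightarrow> set_integrable M B h" for h :: "'w \<Rightarrow> real"
    proof -
      have "(LINT w:A \<union> (space M - A)|M. h w) = (LINT w:A|M. h w) + (LINT w:space M - A|M. h w)"
        using A by (intro set_integral_Un that) auto
      moreover have "A \<union> (space M - A) = space M" using sets.sets_into_space[OF A] by blast
      ultimately show ?thesis by simp
    qed
    show ?case
      using compl(2) eq[OF space] by (simp only: split[of f, OF int(1)] split[of g, OF int(2)])
  next
    case (union F)
    then have F: "F i \<in> events" for i using sub by blast
    have "(LINT w:(\<Union>i. F i)|M. h w) = (\<Sum>i. (LINT w:F i|M. h w))"
      if "\<And>B. B \<in> events \<Longrightarrow> set_integrable M B h" for h :: "'w \<Rightarrow> real"
      using F union(1) by (intro lebesgue_integral_countable_add that) (auto simp: disjoint_family_on_def)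
    then show ?case using int union(3) by simp
  qed
qed

text \<open>On a rectangle the integral of the product factors by independence, and each factor is
  integrated over an event of its own coordinate, where the two families agree.\<close>

lemma set_integral_prod_eq_obs_filtration:
  fixes f g :: "'n \<Rightarrow> 'w \<Rightarrow> real"
  assumes t: "0 \<le> t"
    and f: "\<And>i. f i \<in> borel_measurable (coord_events D i)" "\<And>i. integrable M (f i)"
    and g: "\<And>i. g i \<in> borel_measurable (coord_events D i)" "\<And>i. integrable M (g i)"
    and eq: "\<And>i A. A \<in> sets (coord_obs i t) \<Longrightarrow> (LINT w:A|M. f i w) = (LINT w:A|M. g i w)"
    and A: "A \<in> sets (obs_filtration \<mu> D (ennreal t))"
  shows "(LINT w:A|M. (\<Prod>i\<in>UNIV. f i w)) = (LINT w:A|M. (\<Prod>i\<in>UNIV. g i w))"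
proof -
  have int: "integrable M (\<lambda>w. \<Prod>i\<in>UNIV. h i w)"
    if "\<And>i. h i \<in> borel_measurable (coord_events D i)" "\<And>i. integrable M (h i)" for h :: "'n \<Rightarrow> 'w \<Rightarrow> real"
    by (rule indep_vars_integrable) (auto intro: indep_vars_coord_events that)
  have rect: "(LINT w:(\<Inter>i\<in>UNIV. A i)|M. (\<Prod>i\<in>UNIV. h i w)) = (\<Prod>i\<in>UNIV. LINT w:A i|M. h i w)"
    if h: "\<And>i. h i \<in> borel_measurable (coord_events D i)" "\<And>i. integrable M (h i)"
      and A: "\<forall>i. A i \<in> sets (coord_obs i t)" for h :: "'n \<Rightarrow> 'w \<Rightarrow> real" and A
  proof -
    have A': "A i \<in> sets (coord_events D i)" "A i \<in> events" for i
      using A coord_obs_subset coord_obs_subset_events by blast+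
    have "(LINT w:(\<Inter>i\<in>UNIV. A i)|M. (\<Prod>i\<in>UNIV. h i w)) = (\<integral>w. (\<Prod>i\<in>UNIV. indicator (A i) w * h i w) \<partial>M)"
      unfolding set_lebesgue_integral_def
      by (intro Bochner_Integration.integral_cong refl)
         (auto simp: prod.distrib indicator_def)
    also have "\<dots> = (\<Prod>i\<in>UNIV. \<integral>w. indicator (A i) w * h i w \<partial>M)"
    proof (rule indep_vars_lebesgue_integral)
      show "indep_vars (\<lambda>_. borel) (\<lambda>i w. indicator (A i) w * h i w) UNIV"
        using h(1) A'(1) by (intro indep_vars_coord_events borel_measurable_times borel_measurable_indicator)
      show "integrable M (\<lambda>w. indicator (A i) w * h i w)" for i
        using integrable_mult_indicator[OF A'(2) h(2), of i i] by simp
    qed simp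
    finally show ?thesis by (simp add: set_lebesgue_integral_def)
  qed
  show "(LINT w:A|M. (\<Prod>i\<in>UNIV. f i w)) = (LINT w:A|M. (\<Prod>i\<in>UNIV. g i w))"
    using t int[OF f] int[OF g] _ A
  proof (rule set_integral_eq_obs_filtration)
    fix B assume "B \<in> obs_rectangles t"
    then obtain R where R: "B = (\<Inter>i\<in>UNIV. R i)" "\<forall>i. R i \<in> sets (coord_obs i t)"
      by (auto simp: obs_rectangles_def)
    show "(LINT w:B|M. (\<Prod>i\<in>UNIV. f i w)) = (LINT w:B|M. (\<Prod>i\<in>UNIV. g i w))"
      unfolding R(1) rect[OF f R(2)] rect[OF g R(2)] using eq R(2) by simp
  qed
qed

lemma post_measurable: "0 \<le> t \<Longrightarrow> (\<lambda>w. post D t w $ i) \<in> borel_measurable M"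
  using model by (simp add: qd_model_def borel_measurable_vec_iff)

lemma prod_post_measurable: "0 \<le> t \<Longrightarrow> (\<lambda>w. \<Prod>i\<in>UNIV. post D t w $ i) \<in> borel_measurable M"
  by (intro borel_measurable_prod post_measurable)

lemma post_cond_exp:
  assumes "0 \<le> t"
  shows "AE w in M. post D t w $ i =
    real_cond_exp M (obs_filtration \<mu> D (ennreal t)) (\<lambda>w. real (chain D i t w)) w"
  using model assms by (simp add: qd_model_def)

lemma integrable_chain: "0 \<le> t \<Longrightarrow> integrable M (\<lambda>w. real (chain D i t w))"
proof (rule integrable_const_bound)
  assume t: "0 \<le> t"
  show "AE w in M. norm (real (chain D i t w)) \<le> 1"
    using chain_range[OF t, of _ i] by (intro AE_I2) (fastforce simp: of_nat_le_1_iff)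
  show "(\<lambda>w. real (chain D i t w)) \<in> borel_measurable M"
    by (rule measurable_compose[OF chain_measurable[OF t]]) simp
qed

lemma post_range:
  assumes t: "0 \<le> t"
  shows "AE w in M. 0 \<le> post D t w $ i \<and> post D t w $ i \<le> 1"
proof -
  interpret F: finite_measure_subalgebra "M" "obs_filtration \<mu> D (ennreal t)"
    by standard (use obs_filtration_subset[OF t] in \<open>simp add: subalgebra_def\<close>)
  note int = integrable_chain[OF t, of i]
  have "AE w in M. 0 \<le> real_cond_exp M (obs_filtration \<mu> D (ennreal t)) (\<lambda>w. real (chain D i t w)) w"
    by (rule F.real_cond_exp_ge_c[OF int]) auto
  moreover have "AE w in M. real_cond_exp M (obs_filtration \<mu> D (ennreal t)) (\<lambda>w. real (chain D i t w)) w \<le> 1"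
    by (rule F.real_cond_exp_le_c[OF int]) (use chain_range[OF t, of _ i] in \<open>intro AE_I2, fastforce\<close>)
  ultimately show ?thesis using post_cond_exp[OF t, of i] by eventually_elim simp
qed

text \<open>The coordinates are conditionally independent given the observations.\<close>

lemma set_integral_prod_post:
  assumes t: "0 \<le> t" and A: "A \<in> sets (obs_filtration \<mu> D (ennreal t))"
  shows "(LINT w:A|M. (\<Prod>i\<in>UNIV. post D t w $ i)) = prob {w \<in> A. \<forall>i. chain D i t w = 1}"
proof -
  define Y where "Y i w = real (chain D i t w)" for i w
  \<comment> \<open>Conditioning on the coordinate's own observation only; these variables are
    independent over \<open>i\<close>, which is not visible for the posteriors themselves.\<close>
  define P where "P i = real_cond_exp M (coord_obs i t) (Y i)" for i
  have sub: "finite_measure_subalgebra M (coord_obs i t)" for i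
    by standard (use coord_obs_subset_events in \<open>simp add: subalgebra_def\<close>)
  have sub': "sigma_finite_subalgebra M (coord_obs i t)" for i
    by (rule finite_measure_subalgebra_is_sigma_finite[OF sub])
  have Y_int: "integrable M (Y i)" for i
    unfolding Y_def[abs_def] by (rule integrable_chain[OF t])
  have Y_meas: "Y i \<in> borel_measurable (coord_events D i)" for i
    unfolding Y_def[abs_def] by (rule measurable_compose[OF measurable_chain_coord_events[OF t]]) simp
  have P_int: "integrable M (P i)" for i
    unfolding P_def by (rule sigma_finite_subalgebra.real_cond_exp_int[OF sub' Y_int])
  have P_obs: "P i \<in> borel_measurable (coord_obs i t)" for i
    unfolding P_def by (rule borel_measurable_cond_exp)
  have P_meas: "P i \<in> borel_measurable (coord_events D i)" for i
    by (rule measurable_from_subalg[OF _ P_obs]) (use coord_obs_subset in \<open>simp add: subalgebra_def\<close>)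
  have YP: "(LINT w:B|M. Y i w) = (LINT w:B|M. P i w)" if "B \<in> sets (coord_obs i t)" for i B
    unfolding P_def by (rule sigma_finite_subalgebra.real_cond_exp_intA[OF sub' Y_int that])
  interpret F: finite_measure_subalgebra "M" "obs_filtration \<mu> D (ennreal t)"
    by standard (use obs_filtration_subset[OF t] in \<open>simp add: subalgebra_def\<close>)
  have "AE w in M. real_cond_exp M (obs_filtration \<mu> D (ennreal t)) (Y i) w = P i w" for i
  proof (rule F.real_cond_exp_charact[OF _ Y_int P_int])
    fix B assume B: "B \<in> sets (obs_filtration \<mu> D (ennreal t))"
    \<comment> \<open>With 1 in all other factors, the product statement shows that observing the
      other coordinates does not change the conditional expectation of \<open>Y i\<close>.\<close>
    have "(LINT w:B|M. (\<Prod>j\<in>UNIV. if j = i then Y i w else 1)) =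
        (LINT w:B|M. (\<Prod>j\<in>UNIV. if j = i then P i w else 1))"
    proof (rule set_integral_prod_eq_obs_filtration[OF t _ _ _ _ _ B])
      show "(\<lambda>w. if j = i then Y i w else 1) \<in> borel_measurable (coord_events D j)"
        "(\<lambda>w. if j = i then P i w else 1) \<in> borel_measurable (coord_events D j)"
        "integrable M (\<lambda>w. if j = i then Y i w else 1)"
        "integrable M (\<lambda>w. if j = i then P i w else 1)" for j
        using Y_meas[of i] P_meas[of i] Y_int[of i] P_int[of i] by (cases "j = i"; simp)+
      show "(LINT w:C|M. if j = i then Y i w else 1) = (LINT w:C|M. if j = i then P i w else 1)"
        if "C \<in> sets (coord_obs j t)" for j C
        using YP[of C i] that by (cases "j = i") simp_all
    qed
    then show "(LINT w:B|M. Y i w) = (LINT w:B|M. P i w)" by simp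
  next
    have "subalgebra (obs_filtration \<mu> D (ennreal t)) (coord_obs i t)"
      using coord_obs_rectangle by (auto simp: subalgebra_def sets_obs_filtration_rectangles[OF t])
    then show "P i \<in> borel_measurable (obs_filtration \<mu> D (ennreal t))"
      using P_obs by (rule measurable_from_subalg)
  qed
  then have "AE w in M. post D t w $ i = P i w" for i
    using post_cond_exp[OF t, of i] unfolding Y_def[abs_def] by (rule AE_mp[OF _ AE_mp]) (intro AE_I2 impI, simp)
  then have "AE w in M. \<forall>i\<in>UNIV. post D t w $ i = P i w"
    by (intro AE_finite_allI) auto
  moreover have A': "A \<in> events" using A obs_filtration_subset[OF t] by blast
  moreover have "P i \<in> borel_measurable M" for i using P_int by simp
  ultimately have "(LINT w:A|M. (\<Prod>i\<in>UNIV. post D t w $ i)) = (LINT w:A|M. (\<Prod>i\<in>UNIV. P i w))"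
    unfolding set_lebesgue_integral_def
    by (intro integral_cong_AE borel_measurable_scaleR borel_measurable_indicator borel_measurable_prod
        prod_post_measurable[OF t]) auto
  \<comment> \<open>All factors are now exchanged at once, each against its own conditional
    expectation.\<close>
  also have "\<dots> = (LINT w:A|M. (\<Prod>i\<in>UNIV. Y i w))"
    by (rule set_integral_prod_eq_obs_filtration[OF t P_meas P_int Y_meas Y_int _ A]) (simp add: YP)
  also have "\<dots> = (LINT w|M. indicator {w \<in> A. \<forall>i. chain D i t w = 1} w)"
    unfolding set_lebesgue_integral_def
  proof (rule Bochner_Integration.integral_cong[OF refl])
    fix w assume w: "w \<in> space M"
    have "(\<Prod>i\<in>UNIV. Y i w) = (if \<forall>i. chain D i t w = 1 then 1 else 0)"
    proof (cases "\<forall>i. chain D i t w = 1")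
      case False
      then obtain i where "chain D i t w \<noteq> 1" by blast
      then have "Y i w = 0" using chain_range[OF t w, of i] by (simp add: Y_def)
      then show ?thesis using False by (auto intro!: prod_zero)
    qed (simp add: Y_def)
    then show "indicator A w *\<^sub>R (\<Prod>i\<in>UNIV. Y i w) = indicator {w \<in> A. \<forall>i. chain D i t w = 1} w"
      by (simp add: indicator_def)
  qed
  also have "\<dots> = prob ({w \<in> A. \<forall>i. chain D i t w = 1} \<inter> space M)"
    by simp
  also have "{w \<in> A. \<forall>i. chain D i t w = 1} \<inter> space M = {w \<in> A. \<forall>i. chain D i t w = 1}"
    using sets.sets_into_space[OF A'] by blast
  finally show ?thesis .
qed

end

section \<open>Stopping rules on a time grid\<close>

text \<open>The expectation of the posterior product at time \<open>t\<close> over the event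
  \<open>A\<close>, provided \<open>A\<close> is observed by then. In this form it depends only on
  the law of the trajectory.\<close>

definition hit_prob :: "('w, 'n::finite) qd_space \<Rightarrow> ('n \<Rightarrow> coord_traj) set \<Rightarrow> real \<Rightarrow> real" where
  "hit_prob D A t = \<P>(w in msr D. model_path D w \<in> A \<and> (\<forall>i. chain D i t w = 1))"

lemma set_integrable_const: "set_integrable lborel {a..b::real} (\<lambda>_. c :: real)"
  by (rule borel_integrable_atLeastAtMost') (rule continuous_on_const)

lemma set_integral_const: "a \<le> b \<Longrightarrow> (LBINT u:{a..b::real}. (c :: real)) = (b - a) * c"
  by (simp add: set_lebesgue_integral_def)

text \<open>For a down-closed \<open>P\<close> the count is the first index where \<open>P\<close>
  fails, capped at \<open>N\<close>; stopping indices are defined as such counts.\<close>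

lemma down_set_card:
  assumes "\<And>k l. l \<le> k \<Longrightarrow> P k \<Longrightarrow> P l"
  shows "k < card {k. k < N \<and> P k} \<longleftrightarrow> k < N \<and> P k" "card {k. k < N \<and> P k} \<le> (N::nat)"
proof -
  define m where "m = (LEAST m. m = N \<or> \<not> P m)"
  have m: "m = N \<or> \<not> P m" "\<And>k. k < m \<Longrightarrow> k \<noteq> N \<and> P k"
    unfolding m_def by (rule LeastI[of _ N], simp) (use not_less_Least in blast)
  have "m \<le> N" using m(2)[of N] by (cases "N < m") auto
  have "{k. k < N \<and> P k} = {..<m}"
  proof (intro set_eqI iffI)
    fix k assume k: "k \<in> {k. k < N \<and> P k}"
    show "k \<in> {..<m}"
    proof (rule ccontr)
      assume "k \<notin> {..<m}"
      then have "m \<le> k" by simp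
      with k assms[of m k] m(1) show False by auto
    qed
  next
    fix k assume "k \<in> {..<m}"
    with m(2)[of k] \<open>m \<le> N\<close> show "k \<in> {k. k < N \<and> P k}" by auto
  qed
  then show "k < card {k. k < N \<and> P k} \<longleftrightarrow> k < N \<and> P k" "card {k. k < N \<and> P k} \<le> N"
    using \<open>m \<le> N\<close> by (auto simp: set_eq_iff)
qed

section \<open>Hitting probabilities and the product of the posteriors\<close>

context detection_model
begin

lemma hit_set_measurable:
  assumes "0 \<le> t" "A \<in> sets model_paths"
  shows "{w \<in> space M. model_path D w \<in> A \<and> (\<forall>i. chain D i t w = 1)} \<in> events"
proof -
  have "{w \<in> space M. \<forall>i\<in>UNIV. chain D i t w = 1} \<in> events"
    by (intro sets.sets_Collect_finite_All chain_event assms) auto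
  moreover have "{w \<in> space M. model_path D w \<in> A} \<in> events"
    using measurable_sets[OF measurable_model_path assms(2)] by (simp add: vimage_def Int_def conj_commute)
  ultimately show ?thesis by (simp only: sets.sets_Collect_conj ball_UNIV)
qed

lemma chain_absorbed:
  assumes "0 \<le> s" "s \<le> t"
  shows "AE w in M. chain D i s w = 1 \<longrightarrow> chain D i t w = 1"
proof (cases "s = t")
  case False
  with assms have st: "s < t" by simp
  \<comment> \<open>\<open>ts 0 = s\<close> and \<open>ts 1 = t\<close>; the states
    \<open>1 - k\<close> describe the forbidden move from 1 back to 0.\<close>
  define ts where "ts k = s + real k * (t - s)" for k
  have "strict_mono ts" using st by (auto intro!: strict_monoI simp: ts_def)
  then have "\<P>(w in M. \<forall>k\<le>1. chain D i (ts k) w = 1 - k) =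
      \<P>(w in M. chain D i (ts 0) w = 1 - 0) *
      (\<Prod>k<1. chain_semigroup (lam $ i) (ts (Suc k) - ts k) (1 - k) (1 - Suc k))"
    by (intro markov_chain_fdd[OF markov_chain]) (use assms(1) in \<open>simp_all add: ts_def[of 0] le_Suc_eq\<close>)
  then have "\<P>(w in M. \<forall>k\<le>1. chain D i (ts k) w = 1 - k) = 0"
    by (simp add: chain_semigroup_def)
  moreover have "{w \<in> space M. \<forall>k\<le>1. chain D i (ts k) w = 1 - k} =
      {w \<in> space M. chain D i s w = 1 \<and> chain D i t w = 0}"
    by (auto simp: ts_def le_Suc_eq)
  ultimately have "\<P>(w in M. chain D i s w = 1 \<and> chain D i t w = 0) = 0" by simp
  moreover have "{w \<in> space M. chain D i s w = 1 \<and> chain D i t w = 0} \<in> events"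
    using assms by (intro sets.sets_Collect_conj chain_event) simp_all
  ultimately have "AE w in M. w \<notin> {w \<in> space M. chain D i s w = 1 \<and> chain D i t w = 0}"
    by (intro AE_not_in) (simp add: null_sets_def emeasure_eq_measure)
  then show ?thesis
    using AE_space
  proof eventually_elim
    case (elim w)
    then show ?case using chain_range[of t w i] assms by auto
  qed
qed simp

lemma hit_prob_mono:
  assumes "0 \<le> s" "s \<le> t" "A \<in> sets model_paths"
  shows "hit_prob D A s \<le> hit_prob D A t"
  unfolding hit_prob_def
proof (rule finite_measure_mono_AE)
  have "AE w in M. \<forall>i\<in>UNIV. chain D i s w = 1 \<longrightarrow> chain D i t w = 1"
    using assms by (intro AE_finite_allI chain_absorbed) auto
  then show "AE w in M. w \<in> {w \<in> space M. model_path D w \<in> A \<and> (\<forall>i. chain D i s w = 1)} \<longrightarrow>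
      w \<in> {w \<in> space M. model_path D w \<in> A \<and> (\<forall>i. chain D i t w = 1)}"
    by eventually_elim auto
  show "{w \<in> space M. model_path D w \<in> A \<and> (\<forall>i. chain D i t w = 1)} \<in> events"
    by (rule hit_set_measurable) (use assms in simp_all)
qed

text \<open>The product of the posteriors, modified on a null set so that it takes values in \<open>[0, 1]\<close>, and
  extended to negative times.\<close>

definition prod_post :: "real \<Rightarrow> 'w \<Rightarrow> real" where
  "prod_post t w = max 0 (min 1 (\<Prod>i\<in>UNIV. post D (max 0 t) w $ i))"

lemma prod_post_range: "0 \<le> prod_post t w" "prod_post t w \<le> 1"
  by (auto simp: prod_post_def)

lemma measurable_prod_post [measurable]: "prod_post t \<in> borel_measurable M"
  unfolding prod_post_def[abs_def]
  by (intro borel_measurable_max borel_measurable_min borel_measurable_const prod_post_measurable) simp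

lemma continuous_prod_post:
  assumes "w \<in> space M"
  shows "continuous_on S (\<lambda>t. prod_post t w)"
proof -
  have "continuous_on {0..} (\<lambda>t. post D t w)" using model assms by (simp add: qd_model_def)
  then have "continuous_on S (\<lambda>t. post D (max 0 t) w)"
    by (rule continuous_on_compose2) (auto intro!: continuous_intros)
  then show ?thesis unfolding prod_post_def by (intro continuous_intros)
qed

lemma jointly_measurable_prod_post:
  "(\<lambda>x. prod_post (fst x) (snd x)) \<in> borel_measurable (borel \<Otimes>\<^sub>M M)"
proof (rule jointly_measurable_right_continuous[OF measurable_prod_post])
  fix w u assume "w \<in> space M"
  then have "isCont (\<lambda>t. prod_post t w) u"
    using continuous_prod_post[of w UNIV] by (simp add: continuous_on_eq_continuous_at)
  then show "((\<lambda>s. prod_post s w) \<longlongrightarrow> prod_post u w) (at_right u)"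
    unfolding isCont_def by (rule filterlim_mono) (auto intro: at_le)
qed

text \<open>At a fixed time the posteriors lie in [0, 1] off a null set depending on that time.
  Rational times and path continuity give one null set for all times, which evaluation at a random
  time requires.\<close>

lemma prod_post_eq: "AE w in M. \<forall>t\<ge>0. prod_post t w = (\<Prod>i\<in>UNIV. post D t w $ i)"
proof -
  have "AE w in M. \<forall>r\<in>\<rat> \<inter> {0..}. \<forall>i\<in>UNIV. 0 \<le> post D r w $ i \<and> post D r w $ i \<le> 1"
    using countable_rat
    by (intro AE_ball_countable[THEN iffD2] ballI AE_finite_allI post_range) (auto intro: countable_Int1)
  then show ?thesis
    using AE_space
  proof eventually_elim
    case (elim w)
    show ?case
    proof (intro allI impI)
      fix t :: real assume t: "0 \<le> t"
      have "continuous_on {0..} (\<lambda>t. post D t w)" using model elim by (simp add: qd_model_def)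
      then have c: "continuous_on {0..} (\<lambda>t. post D t w $ i)" for i by (intro continuous_intros)
      have g: "right_grid n t \<in> \<rat> \<inter> {0..}" for n
        using right_grid_bounds(1)[of t n] t by (auto simp: right_grid_def simp del: of_nat_Suc)
      have lim: "(\<lambda>n. post D (right_grid n t) w $ i) \<longlonglongrightarrow> post D t w $ i" for i
        using c[of i] t g filterlim_right_grid[of t]
        by (intro continuous_on_tendsto_compose[OF c]) (auto simp: filterlim_at)
      have "0 \<le> post D t w $ i" "post D t w $ i \<le> 1" for i
        using elim g
        by (intro LIMSEQ_le_const[OF lim] LIMSEQ_le_const2[OF lim] exI[of _ 0] allI impI; blast)+
      then have "0 \<le> (\<Prod>i\<in>UNIV. post D t w $ i)" "(\<Prod>i\<in>UNIV. post D t w $ i) \<le> 1"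
        by (auto intro: prod_nonneg prod_le_1)
      then show "prod_post t w = (\<Prod>i\<in>UNIV. post D t w $ i)"
        using t by (simp add: prod_post_def)
    qed
  qed
qed

text \<open>\<open>A\<close> is decided by time \<open>s\<close>, hence by time \<open>t\<close>, so
  conditional independence applies at the later time \<open>t\<close>. Grid rules use this with
  \<open>s\<close> and \<open>t\<close> the two ends of a period.\<close>

lemma integral_prod_post_hit_prob:
  assumes "0 \<le> s" "s \<le> t" "A \<in> sets (model_filtration \<mu> s)"
  shows "(\<integral>w. indicator (model_path D -` A \<inter> space M) w * prod_post t w \<partial>M) = hit_prob D A t"
proof -
  let ?B = "model_path D -` A \<inter> space M"
  have t: "0 \<le> t" using assms by simp
  have A: "A \<in> sets (model_filtration \<mu> t)" using assms model_filtration_mono by blast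
  have B: "?B \<in> sets (obs_filtration \<mu> D (ennreal t))" using sets_obs_filtration[OF t] A by blast
  have B': "?B \<in> events" using B obs_filtration_subset[OF t] by blast
  have "(\<integral>w. indicator ?B w * prod_post t w \<partial>M) = (LINT w:?B|M. (\<Prod>i\<in>UNIV. post D t w $ i))"
    unfolding set_lebesgue_integral_def
  proof (rule integral_cong_AE)
    show "(\<lambda>w. indicator ?B w * prod_post t w) \<in> borel_measurable M"
      using B' by measurable
    show "(\<lambda>w. indicator ?B w *\<^sub>R (\<Prod>i\<in>UNIV. post D t w $ i)) \<in> borel_measurable M"
      using B' by (intro borel_measurable_scaleR borel_measurable_indicator prod_post_measurable[OF t])
    show "AE w in M. indicator ?B w * prod_post t w = indicator ?B w *\<^sub>R (\<Prod>i\<in>UNIV. post D t w $ i)"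
      using prod_post_eq by eventually_elim (simp add: t)
  qed
  also have "\<dots> = prob {w \<in> ?B. \<forall>i. chain D i t w = 1}"
    by (rule set_integral_prod_post[OF t B])
  also have "\<dots> = hit_prob D A t"
    unfolding hit_prob_def by (rule arg_cong[where f = prob]) auto
  finally show ?thesis .
qed

definition acc_post :: "real \<Rightarrow> 'w \<Rightarrow> real" where
  "acc_post t w = (LBINT u:{0..t}. prod_post u w)"

lemma set_integrable_prod_post:
  assumes "w \<in> space M"
  shows "set_integrable lborel {a..b} (\<lambda>u. prod_post u w)"
  by (rule borel_integrable_atLeastAtMost') (rule continuous_prod_post[OF assms])

lemma acc_post_diff:
  assumes "w \<in> space M" "0 \<le> a" "a \<le> b"
  shows "acc_post b w - acc_post a w = (LBINT u:{a..b}. prod_post u w)"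
    and "0 \<le> acc_post b w - acc_post a w" "acc_post b w - acc_post a w \<le> b - a"
proof -
  note int = set_integrable_prod_post[OF assms(1)]
  have "(LBINT u:{0..b}. prod_post u w) = (LBINT u:{0..a} \<union> {a..b}. prod_post u w)"
    using assms by (simp add: ivl_disj_un_two_touch)
  also have "\<dots> = (LBINT u:{0..a}. prod_post u w) + (LBINT u:{a..b}. prod_post u w)"
  proof (rule set_integral_Un_AE)
    have "AE u in lborel. u \<noteq> a" by (rule AE_lborel_singleton)
    then show "AE u in lborel. \<not> (u \<in> {0..a} \<and> u \<in> {a..b})"
      by eventually_elim auto
  qed (use int in auto)
  finally show eq: "acc_post b w - acc_post a w = (LBINT u:{a..b}. prod_post u w)"
    by (simp add: acc_post_def)
  show "0 \<le> acc_post b w - acc_post a w"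
    unfolding eq set_lebesgue_integral_def by (intro integral_nonneg_AE AE_I2) (simp add: prod_post_range)
  have "(LBINT u:{a..b}. prod_post u w) \<le> (LBINT u:{a..b}. 1)"
    by (rule set_integral_mono[OF int set_integrable_const]) (simp add: prod_post_range)
  then show "acc_post b w - acc_post a w \<le> b - a"
    unfolding eq using assms by (simp add: set_integral_const)
qed

lemma acc_post_0: "acc_post 0 w = 0"
proof -
  have "AE u in lborel. indicator {0..0::real} u *\<^sub>R prod_post u w = 0"
    using AE_lborel_singleton[of "0::real"] by eventually_elim simp
  then have "(\<integral>u. indicator {0..0} u *\<^sub>R prod_post u w \<partial>lborel) = 0"
    by (rule integral_eq_zero_AE)
  then show ?thesis by (simp add: acc_post_def set_lebesgue_integral_def)
qed

lemma acc_post_bounds: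
  assumes "w \<in> space M" "0 \<le> t"
  shows "0 \<le> acc_post t w" "acc_post t w \<le> t"
  using acc_post_diff[OF assms(1), of 0 t] assms(2) by (simp_all add: acc_post_0)

lemma continuous_acc_post:
  assumes "w \<in> space M"
  shows "continuous_on {0..} (\<lambda>t. acc_post t w)"
proof (rule continuous_on_iff[THEN iffD2], intro ballI allI impI)
  fix x e :: real assume x: "x \<in> {0..}" and e: "0 < e"
  have "\<bar>acc_post y w - acc_post x w\<bar> \<le> \<bar>y - x\<bar>" if "y \<in> {0..}" for y
    using acc_post_diff(2,3)[OF assms, of x y] acc_post_diff(2,3)[OF assms, of y x] x that
    by (cases "x \<le> y") auto
  then show "\<exists>d>0. \<forall>x'\<in>{0..}. dist x' x < d \<longrightarrow> dist (acc_post x' w) (acc_post x w) < e"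
    using e by (intro exI[of _ e]) (fastforce simp: dist_real_def)
qed

lemma measurable_prod_post_at:
  assumes "\<sigma> \<in> borel_measurable M"
  shows "(\<lambda>w. prod_post (\<sigma> w) w) \<in> borel_measurable M"
  using measurable_compose[OF measurable_Pair[OF assms measurable_ident_sets[OF refl]] jointly_measurable_prod_post]
  by simp

lemma measurable_acc_post_at:
  assumes [measurable]: "\<sigma> \<in> borel_measurable M"
  shows "(\<lambda>w. acc_post (\<sigma> w) w) \<in> borel_measurable M"
proof -
  have "(\<lambda>x. prod_post (fst x) (snd x)) \<in> borel_measurable (lborel \<Otimes>\<^sub>M M)"
    using jointly_measurable_prod_post by (simp cong: measurable_cong_sets)
  from measurable_compose[OF measurable_pair_swap' this]
  have [measurable]: "(\<lambda>x. prod_post (snd x) (fst x)) \<in> borel_measurable (M \<Otimes>\<^sub>M lborel)"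
    by (simp add: case_prod_beta)
  have "(\<lambda>w. \<integral>u. (if 0 \<le> u \<and> u \<le> \<sigma> w then prod_post u w else 0) \<partial>lborel) \<in> borel_measurable M"
    by (rule lborel.borel_measurable_lebesgue_integral) (simp add: case_prod_beta)
  moreover have "(if 0 \<le> u \<and> u \<le> \<sigma> w then prod_post u w else 0) = indicator {0..\<sigma> w} u *\<^sub>R prod_post u w" for u w
    by (simp add: indicator_def)
  ultimately show ?thesis
    unfolding acc_post_def set_lebesgue_integral_def by simp
qed

text \<open>By Fubini the integral is that of \<open>hit_prob D A u\<close> over \<open>u\<close> in
  \<open>{a..b}\<close>, and absorption makes this integrand nondecreasing, so its values at the end
  points bound it.\<close>

lemma integral_acc_post_bounds:
  assumes "0 \<le> a" "a \<le> b" and A: "A \<in> sets (model_filtration \<mu> a)"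
  defines "B \<equiv> model_path D -` A \<inter> space M"
  shows "(\<integral>w. indicator B w * (acc_post b w - acc_post a w) \<partial>M) \<le> (b - a) * hit_prob D A b"
    and "(b - a) * hit_prob D A a \<le> (\<integral>w. indicator B w * (acc_post b w - acc_post a w) \<partial>M)"
proof -
  interpret P: pair_sigma_finite "lborel :: real measure" "M" by standard
  have A': "A \<in> sets model_paths" using A model_filtration_subset by blast
  have B[measurable]: "B \<in> events" unfolding B_def by (rule measurable_sets[OF measurable_model_path A'])
  have [measurable]: "(\<lambda>x. prod_post (fst x) (snd x)) \<in> borel_measurable (lborel \<Otimes>\<^sub>M M)"
    using jointly_measurable_prod_post by (simp cong: measurable_cong_sets)
  define f where "f u w = indicator {a..b} u * (indicator B w * prod_post u w)" for u w
  have "integrable (lborel \<Otimes>\<^sub>M M) (\<lambda>x. indicator ({a..b} \<times> space M) x *\<^sub>R (indicator B (snd x) * prod_post (fst x) (snd x)))"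
  proof (rule integrableI_bounded_set_indicator)
    show "emeasure (lborel \<Otimes>\<^sub>M M) ({a..b} \<times> space M) < \<infinity>"
      using assms by (subst emeasure_pair_measure_Times) (auto simp: emeasure_space_1)
    show "AE x in lborel \<Otimes>\<^sub>M M. x \<in> {a..b} \<times> space M \<longrightarrow>
        norm (indicator B (snd x) * prod_post (fst x) (snd x)) \<le> 1"
      by (intro AE_I2) (auto simp: indicator_def prod_post_range)
    show "(\<lambda>x. indicator B (snd x) * prod_post (fst x) (snd x)) \<in> borel_measurable (lborel \<Otimes>\<^sub>M M)"
      by measurable
  qed auto
  also have "?this \<longleftrightarrow> integrable (lborel \<Otimes>\<^sub>M M) (\<lambda>(u, w). f u w)"
  proof (rule Bochner_Integration.integrable_cong[OF refl])
    fix x :: "real \<times> 'w" assume "x \<in> space (lborel \<Otimes>\<^sub>M M)"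
    then have "snd x \<in> space M" by (simp add: space_pair_measure mem_Times_iff)
    then show "indicator ({a..b} \<times> space M) x *\<^sub>R (indicator B (snd x) * prod_post (fst x) (snd x)) =
        (case x of (u, w) \<Rightarrow> f u w)"
      by (cases x) (simp add: f_def indicator_times)
  qed
  finally have fint: "integrable (lborel \<Otimes>\<^sub>M M) (\<lambda>(u, w). f u w)" .
  have "(\<integral>w. indicator B w * (acc_post b w - acc_post a w) \<partial>M) = (\<integral>w. (\<integral>u. f u w \<partial>lborel) \<partial>M)"
  proof (rule Bochner_Integration.integral_cong[OF refl])
    fix w assume w: "w \<in> space M"
    have "f u w = indicator B w * (indicator {a..b} u * prod_post u w)" for u
      by (simp only: f_def mult.left_commute)
    then show "indicator B w * (acc_post b w - acc_post a w) = (\<integral>u. f u w \<partial>lborel)"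
      unfolding acc_post_diff(1)[OF w assms(1,2)] set_lebesgue_integral_def by simp
  qed
  also have "\<dots> = (\<integral>u. (\<integral>w. f u w \<partial>M) \<partial>lborel)"
    by (rule P.Fubini_integral[OF fint])
  also have "\<dots> = (LBINT u:{a..b}. hit_prob D A u)"
    unfolding set_lebesgue_integral_def
  proof (rule Bochner_Integration.integral_cong[OF refl])
    fix u :: real
    show "(\<integral>w. f u w \<partial>M) = indicator {a..b} u *\<^sub>R hit_prob D A u"
      using integral_prod_post_hit_prob[OF assms(1) _ A, of u]
      by (cases "u \<in> {a..b}") (auto simp: f_def B_def)
  qed
  finally have eq: "(\<integral>w. indicator B w * (acc_post b w - acc_post a w) \<partial>M) = (LBINT u:{a..b}. hit_prob D A u)" .
  have "integrable lborel (\<lambda>u. \<integral>w. f u w \<partial>M)"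
    using P.integrable_fst[OF fint] .
  moreover have "(\<integral>w. f u w \<partial>M) = indicator {a..b} u *\<^sub>R hit_prob D A u" for u
    using integral_prod_post_hit_prob[OF assms(1) _ A, of u]
    by (cases "u \<in> {a..b}") (auto simp: f_def B_def)
  ultimately have int: "set_integrable lborel {a..b} (hit_prob D A)"
    by (simp add: set_integrable_def)
  have "(LBINT u:{a..b}. hit_prob D A u) \<le> (LBINT u:{a..b}. hit_prob D A b)"
    by (rule set_integral_mono[OF int set_integrable_const]) (use assms A' in \<open>auto intro: hit_prob_mono\<close>)
  then show "(\<integral>w. indicator B w * (acc_post b w - acc_post a w) \<partial>M) \<le> (b - a) * hit_prob D A b"
    unfolding eq using assms by (simp add: set_integral_const)
  have "(LBINT u:{a..b}. hit_prob D A a) \<le> (LBINT u:{a..b}. hit_prob D A u)"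
    by (rule set_integral_mono[OF set_integrable_const int]) (use assms A' in \<open>auto intro: hit_prob_mono\<close>)
  then show "(b - a) * hit_prob D A a \<le> (\<integral>w. indicator B w * (acc_post b w - acc_post a w) \<partial>M)"
    unfolding eq using assms by (simp add: set_integral_const)
qed

lemma hit_prob_0: "hit_prob D (space model_paths) 0 = (\<Prod>i\<in>UNIV. \<pi> $ i)"
proof -
  have "hit_prob D (space model_paths) 0 = (\<integral>w. indicator {w \<in> space M. \<forall>i. chain D i 0 w = 1} w \<partial>M)"
    unfolding hit_prob_def by (simp add: model_path_space cong: conj_cong) (rule arg_cong[where f = prob], blast)
  also have "\<dots> = (\<integral>w. (\<Prod>i\<in>UNIV. real (chain D i 0 w)) \<partial>M)"
  proof (rule Bochner_Integration.integral_cong[OF refl])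
    fix w assume w: "w \<in> space M"
    show "indicator {w \<in> space M. \<forall>i. chain D i 0 w = 1} w = (\<Prod>i\<in>UNIV. real (chain D i 0 w))"
    proof (cases "\<forall>i. chain D i 0 w = 1")
      case False
      then obtain i where "chain D i 0 w \<noteq> 1" by blast
      then have "real (chain D i 0 w) = 0" using chain_range[of 0 w i] w by simp
      then have "(\<Prod>i\<in>UNIV. real (chain D i 0 w)) = 0" by (intro prod_zero) auto
      then show ?thesis using False by (simp add: indicator_def)
    qed (use w in simp)
  qed
  also have "\<dots> = (\<Prod>i\<in>UNIV. \<integral>w. real (chain D i 0 w) \<partial>M)"
    by (rule indep_vars_lebesgue_integral)
       (auto intro!: indep_vars_coord_events integrable_chain measurable_compose[OF measurable_chain_coord_events])
  also have "\<dots> = (\<Prod>i\<in>UNIV. \<pi> $ i)"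
  proof (rule prod.cong[OF refl])
    fix i
    have "(\<integral>w. real (chain D i 0 w) \<partial>M) = (\<integral>w. indicator {w \<in> space M. chain D i 0 w = 1} w \<partial>M)"
      by (rule Bochner_Integration.integral_cong) (use chain_range[of 0 _ i] in \<open>fastforce simp: indicator_def\<close>)+
    also have "\<dots> = prob ({w \<in> space M. chain D i 0 w = 1} \<inter> space M)" by simp
    also have "{w \<in> space M. chain D i 0 w = 1} \<inter> space M = {w \<in> space M. chain D i 0 w = 1}" by blast
    finally show "(\<integral>w. real (chain D i 0 w) \<partial>M) = \<pi> $ i" unfolding prior .
  qed
  finally show ?thesis .
qed

end

text \<open>\<^term>\<open>A k\<close> is the set of paths on which the rule continues beyond time \<open>k \<delta>\<close>. The excess bounds the
  expected change of terminal plus running cost over the periods \<open>[k \<delta>, (k + 1) \<delta>]\<close>, \<open>k < N\<close>, with the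
  running cost evaluated at the right end point.\<close>

definition rule_excess ::
    "('w, 'n::finite) qd_space \<Rightarrow> real \<Rightarrow> real \<Rightarrow> nat \<Rightarrow> (nat \<Rightarrow> ('n \<Rightarrow> coord_traj) set) \<Rightarrow> real" where
  "rule_excess D c \<delta> N A =
    (\<Sum>k<N. hit_prob D (A k) (real k * \<delta>) - (1 - c * \<delta>) * hit_prob D (A k) (real (Suc k) * \<delta>))"

text \<open>\<open>decseq\<close> says that stopping is irrevocable, already on path space. The
  horizon \<open>N\<close> is chosen separately, so one rule can be truncated at different
  horizons.\<close>

definition stopping_rule ::
    "real ^ 'n::finite \<Rightarrow> real \<Rightarrow> (nat \<Rightarrow> ('n \<Rightarrow> coord_traj) set) \<Rightarrow> bool" where
  "stopping_rule \<mu> \<delta> A \<longleftrightarrow> 0 < \<delta> \<and> decseq A \<and> (\<forall>k. A k \<in> sets (model_filtration \<mu> (real k * \<delta>)))"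

text \<open>One pair of costs for all dimensions: over the index type \<open>1\<close> these are the
  costs of the one-dimensional problem, over \<open>2\<close> those of the two-dimensional
  one.\<close>

abbreviation prod_terminal :: "real ^ 'n::finite \<Rightarrow> real" where
  "prod_terminal \<equiv> \<lambda>p. 1 - (\<Prod>i\<in>UNIV. p $ i)"

abbreviation prod_running :: "real \<Rightarrow> real ^ 'n::finite \<Rightarrow> real" where
  "prod_running c \<equiv> \<lambda>p. c * (\<Prod>i\<in>UNIV. p $ i)"

section \<open>Costs of stopping on the grid\<close>

context detection_model
begin

definition cost :: "real \<Rightarrow> real \<Rightarrow> 'w \<Rightarrow> real" where
  "cost c t w = 1 - prod_post t w + c * acc_post t w"

definition mean_cost :: "real \<Rightarrow> ('w \<Rightarrow> real) \<Rightarrow> real" where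
  "mean_cost c \<sigma> = (\<integral>w. cost c (\<sigma> w) w \<partial>M)"

lemma expected_cost_eq:
  "expected_cost D prod_terminal (prod_running c) \<tau> =
    (\<integral>\<^sup>+ w. ennreal (cost c (enn2real (\<tau> w)) w) \<partial>M)"
  unfolding expected_cost_def
proof (rule nn_integral_cong_AE)
  show "AE w in M.
      ennreal (1 - (\<Prod>i\<in>UNIV. post D (enn2real (\<tau> w)) w $ i) +
        (LBINT s:{0..enn2real (\<tau> w)}. c * (\<Prod>i\<in>UNIV. post D s w $ i))) =
      ennreal (cost c (enn2real (\<tau> w)) w)"
    using prod_post_eq
  proof eventually_elim
    case (elim w)
    have "(LBINT s:{0..enn2real (\<tau> w)}. c * (\<Prod>i\<in>UNIV. post D s w $ i)) =
        (LBINT s:{0..enn2real (\<tau> w)}. c * prod_post s w)"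
      by (rule set_lebesgue_integral_cong) (use elim in auto)
    also have "\<dots> = c * acc_post (enn2real (\<tau> w)) w"
      unfolding acc_post_def by (rule set_integral_mult_right)
    finally show ?case using elim by (auto simp: cost_def)
  qed
qed

lemma cost_bounds:
  assumes "w \<in> space M" "0 \<le> t" "0 \<le> c"
  shows "0 \<le> cost c t w" "cost c t w \<le> 1 + c * t"
proof -
  have "0 \<le> c * acc_post t w" "c * acc_post t w \<le> c * t"
    using assms acc_post_bounds[OF assms(1,2)] by (auto intro: mult_left_mono)
  then show "0 \<le> cost c t w" "cost c t w \<le> 1 + c * t"
    using prod_post_range[of t w] by (auto simp: cost_def)
qed

lemma measurable_cost_at:
  assumes "\<sigma> \<in> borel_measurable M"
  shows "(\<lambda>w. cost c (\<sigma> w) w) \<in> borel_measurable M"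
  unfolding cost_def using measurable_prod_post_at[OF assms] measurable_acc_post_at[OF assms] by simp

lemma continuous_cost:
  assumes "w \<in> space M"
  shows "continuous_on {0..} (\<lambda>t. cost c t w)"
  unfolding cost_def by (intro continuous_intros continuous_prod_post continuous_acc_post assms)

lemma integrable_prod_post: "integrable M (prod_post t)"
  by (rule integrable_const_bound[where B = 1]) (auto simp: prod_post_range)

lemma integrable_acc_post:
  assumes "0 \<le> t"
  shows "integrable M (acc_post t)"
proof (rule integrable_const_bound[where B = t])
  show "AE w in M. norm (acc_post t w) \<le> t"
    using acc_post_bounds assms by (intro AE_I2) auto
  show "acc_post t \<in> borel_measurable M"
    using measurable_acc_post_at[of "\<lambda>_. t"] by simp
qed

lemma integral_prod_post_0: "(\<integral>w. prod_post 0 w \<partial>M) = (\<Prod>i\<in>UNIV. \<pi> $ i)"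
proof -
  have "(\<integral>w. prod_post 0 w \<partial>M) =
      (\<integral>w. indicator (model_path D -` space model_paths \<inter> space M) w * prod_post 0 w \<partial>M)"
    by (rule Bochner_Integration.integral_cong) (auto simp: model_path_space)
  also have "\<dots> = hit_prob D (space model_paths) 0"
    using sets.top[of "model_filtration \<mu> 0"] by (intro integral_prod_post_hit_prob[of 0]) auto
  finally show ?thesis by (simp add: hit_prob_0)
qed

lemma model_event: "A \<in> sets (model_filtration \<mu> t) \<Longrightarrow> model_path D -` A \<inter> space M \<in> events"
  using model_filtration_subset by (blast intro: measurable_sets[OF measurable_model_path])

text \<open>Telescoping up to the stopping index: the increment over period \<open>k\<close> counts
  exactly on the event \<open>B k\<close> that stopping has not yet happened. The relation between
  \<open>\<kappa>\<close> and \<open>B\<close> is only almost sure because stopping times are only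
  almost surely finite.\<close>

lemma grid_expectation:
  fixes F :: "real \<Rightarrow> 'w \<Rightarrow> real"
  assumes F: "\<And>t. 0 \<le> t \<Longrightarrow> integrable M (F t)" "(\<lambda>w. F (real (\<kappa> w) * \<delta>) w) \<in> borel_measurable M"
    and "0 \<le> \<delta>" and B: "\<And>k. B k \<in> events" and le: "\<And>w. \<kappa> w \<le> N"
    and \<kappa>: "AE w in M. \<forall>k<N. k < \<kappa> w \<longleftrightarrow> w \<in> B k"
  shows "integrable M (\<lambda>w. F (real (\<kappa> w) * \<delta>) w)"
    and "(\<integral>w. F (real (\<kappa> w) * \<delta>) w \<partial>M) = (\<integral>w. F 0 w \<partial>M) +
      (\<Sum>k<N. \<integral>w. indicator (B k) w * (F (real (Suc k) * \<delta>) w - F (real k * \<delta>) w) \<partial>M)"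
proof -
  define G where "G w = F 0 w + (\<Sum>k<N. indicator (B k) w * (F (real (Suc k) * \<delta>) w - F (real k * \<delta>) w))" for w
  have int: "integrable M (\<lambda>w. indicator (B k) w * (F (real (Suc k) * \<delta>) w - F (real k * \<delta>) w))" for k
  proof -
    have "integrable M (\<lambda>w. F (real (Suc k) * \<delta>) w - F (real k * \<delta>) w)"
      using \<open>0 \<le> \<delta>\<close> by (intro Bochner_Integration.integrable_diff F) auto
    from integrable_mult_indicator[OF B this] show ?thesis by simp
  qed
  have G: "integrable M G"
    unfolding G_def[abs_def] by (intro Bochner_Integration.integrable_add Bochner_Integration.integrable_sum int F) simp
  have eq: "AE w in M. G w = F (real (\<kappa> w) * \<delta>) w"
    using \<kappa>
  proof eventually_elim
    case (elim w)
    have "(\<Sum>k<N. indicator (B k) w * (F (real (Suc k) * \<delta>) w - F (real k * \<delta>) w)) =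
        (\<Sum>k<\<kappa> w. F (real (Suc k) * \<delta>) w - F (real k * \<delta>) w)"
    proof (rule sum.mono_neutral_cong_right)
      show "indicator (B k) w * (F (real (Suc k) * \<delta>) w - F (real k * \<delta>) w) = F (real (Suc k) * \<delta>) w - F (real k * \<delta>) w"
        if "k \<in> {..<\<kappa> w}" for k
        using elim[rule_format, of k] that le[of w] by simp
    qed (use elim le[of w] in auto)
    also have "\<dots> = F (real (\<kappa> w) * \<delta>) w - F 0 w"
      using sum_lessThan_telescope[of "\<lambda>k. F (real k * \<delta>) w" "\<kappa> w"] by simp
    finally show ?case by (simp add: G_def)
  qed
  show "integrable M (\<lambda>w. F (real (\<kappa> w) * \<delta>) w)"
    using integrable_cong_AE_imp[OF G F(2)] eq by (simp add: eq_commute)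
  have "(\<integral>w. F (real (\<kappa> w) * \<delta>) w \<partial>M) = (\<integral>w. G w \<partial>M)"
    using eq G F(2) by (intro integral_cong_AE) (auto simp: eq_commute)
  also have "\<dots> = (\<integral>w. F 0 w \<partial>M) + (\<integral>w. (\<Sum>k<N. indicator (B k) w * (F (real (Suc k) * \<delta>) w - F (real k * \<delta>) w)) \<partial>M)"
    unfolding G_def by (intro Bochner_Integration.integral_add F Bochner_Integration.integrable_sum int) simp
  also have "(\<integral>w. (\<Sum>k<N. indicator (B k) w * (F (real (Suc k) * \<delta>) w - F (real k * \<delta>) w)) \<partial>M) =
      (\<Sum>k<N. \<integral>w. indicator (B k) w * (F (real (Suc k) * \<delta>) w - F (real k * \<delta>) w) \<partial>M)"
    by (intro Bochner_Integration.integral_sum int)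
  finally show "(\<integral>w. F (real (\<kappa> w) * \<delta>) w \<partial>M) = (\<integral>w. F 0 w \<partial>M) +
      (\<Sum>k<N. \<integral>w. indicator (B k) w * (F (real (Suc k) * \<delta>) w - F (real k * \<delta>) w) \<partial>M)" .
qed

text \<open>The excess overestimates the running cost by at most \<open>c \<delta>\<close> in total, since the increments of the
  product of the posteriors telescope.\<close>

lemma grid_cost:
  assumes c: "0 \<le> c" and \<delta>: "0 < \<delta>" and A: "\<And>k. A k \<in> sets (model_filtration \<mu> (real k * \<delta>))"
    and meas: "(\<lambda>w. real (\<kappa> w) * \<delta>) \<in> borel_measurable M" and le: "\<And>w. \<kappa> w \<le> N"
    and \<kappa>: "AE w in M. \<forall>k<N. k < \<kappa> w \<longleftrightarrow> model_path D w \<in> A k"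
  shows "integrable M (\<lambda>w. cost c (real (\<kappa> w) * \<delta>) w)"
    and "mean_cost c (\<lambda>w. real (\<kappa> w) * \<delta>) \<le> 1 - (\<Prod>i\<in>UNIV. \<pi> $ i) + rule_excess D c \<delta> N A"
    and "1 - (\<Prod>i\<in>UNIV. \<pi> $ i) + rule_excess D c \<delta> N A \<le> mean_cost c (\<lambda>w. real (\<kappa> w) * \<delta>) + c * \<delta>"
proof -
  define B where "B k = model_path D -` A k \<inter> space M" for k
  have B: "B k \<in> events" for k unfolding B_def by (rule model_event[OF A])
  have \<kappa>': "AE w in M. \<forall>k<N. k < \<kappa> w \<longleftrightarrow> w \<in> B k"
    using \<kappa> AE_space by eventually_elim (simp add: B_def)
  define h where "h k = hit_prob D (A k) (real k * \<delta>)" for k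
  define h' where "h' k = hit_prob D (A k) (real (Suc k) * \<delta>)" for k
  define I where "I k = (\<integral>w. indicator (B k) w * (acc_post (real (Suc k) * \<delta>) w - acc_post (real k * \<delta>) w) \<partial>M)" for k
  have "(\<integral>w. indicator (B k) w * (prod_post (real (Suc k) * \<delta>) w - prod_post (real k * \<delta>) w) \<partial>M) = h' k - h k" for k
  proof -
    have int: "integrable M (\<lambda>w. indicator (B k) w * prod_post t w)" for t
      using integrable_mult_indicator[OF B integrable_prod_post] by simp
    have "(\<integral>w. indicator (B k) w * (prod_post (real (Suc k) * \<delta>) w - prod_post (real k * \<delta>) w) \<partial>M) =
        (\<integral>w. indicator (B k) w * prod_post (real (Suc k) * \<delta>) w \<partial>M) - (\<integral>w. indicator (B k) w * prod_post (real k * \<delta>) w \<partial>M)"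
      unfolding right_diff_distrib by (rule Bochner_Integration.integral_diff[OF int int])
    also have "\<dots> = h' k - h k"
      unfolding B_def h_def h'_def using \<delta>
      by (intro arg_cong2[where f = "(-)"] integral_prod_post_hit_prob[OF _ _ A]) (auto simp: mult_right_mono)
    finally show ?thesis .
  qed
  with grid_expectation[OF integrable_prod_post measurable_prod_post_at[OF meas] less_imp_le[OF \<delta>] B le \<kappa>']
  have P: "integrable M (\<lambda>w. prod_post (real (\<kappa> w) * \<delta>) w)"
    "(\<integral>w. prod_post (real (\<kappa> w) * \<delta>) w \<partial>M) = (\<Prod>i\<in>UNIV. \<pi> $ i) + (\<Sum>k<N. h' k - h k)"
    by (simp_all add: integral_prod_post_0 del: of_nat_Suc)
  from grid_expectation[OF integrable_acc_post measurable_acc_post_at[OF meas] less_imp_le[OF \<delta>] B le \<kappa>']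
  have Q: "integrable M (\<lambda>w. acc_post (real (\<kappa> w) * \<delta>) w)"
    "(\<integral>w. acc_post (real (\<kappa> w) * \<delta>) w \<partial>M) = (\<Sum>k<N. I k)"
    by (simp_all add: acc_post_0 I_def del: of_nat_Suc)
  show "integrable M (\<lambda>w. cost c (real (\<kappa> w) * \<delta>) w)"
    unfolding cost_def using P(1) Q(1) by simp
  have "mean_cost c (\<lambda>w. real (\<kappa> w) * \<delta>) =
      1 - (\<integral>w. prod_post (real (\<kappa> w) * \<delta>) w \<partial>M) + c * (\<integral>w. acc_post (real (\<kappa> w) * \<delta>) w \<partial>M)"
    unfolding mean_cost_def cost_def using P(1) Q(1) by (simp add: prob_space)
  then have cost: "mean_cost c (\<lambda>w. real (\<kappa> w) * \<delta>) =
      1 - (\<Prod>i\<in>UNIV. \<pi> $ i) + (\<Sum>k<N. h k - h' k + c * I k)"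
    unfolding P(2) Q(2) by (simp add: sum.distrib sum_subtractf sum_distrib_left)
  have step: "real (Suc k) * \<delta> - real k * \<delta> = \<delta>" "0 \<le> real k * \<delta>" "real k * \<delta> \<le> real (Suc k) * \<delta>" for k
    using \<delta> by (auto simp: algebra_simps)
  have I: "I k \<le> \<delta> * h' k" "\<delta> * h k \<le> I k" for k
    using integral_acc_post_bounds[OF step(2,3) A, of k]
    unfolding step(1) I_def B_def h_def h'_def by auto
  have "h k - h' k + c * I k \<le> h k - (1 - c * \<delta>) * h' k" for k
    using mult_left_mono[OF I(1)[of k] c] by (simp add: algebra_simps)
  then have "(\<Sum>k<N. h k - h' k + c * I k) \<le> rule_excess D c \<delta> N A"
    unfolding rule_excess_def h_def[symmetric] h'_def[symmetric] by (rule sum_mono)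
  then show "mean_cost c (\<lambda>w. real (\<kappa> w) * \<delta>) \<le> 1 - (\<Prod>i\<in>UNIV. \<pi> $ i) + rule_excess D c \<delta> N A"
    unfolding cost by simp
  \<comment> \<open>The overestimate in period \<open>k\<close> is
    \<open>c * (\<delta> * h' k - I k)\<close>, and \<open>I k\<close> is at least
    \<open>\<delta> * h k\<close>.\<close>
  have "h k - (1 - c * \<delta>) * h' k \<le> h k - h' k + c * I k + c * \<delta> * (h' k - h k)" for k
    using mult_left_mono[OF I(2)[of k] c] by (simp add: algebra_simps)
  then have "rule_excess D c \<delta> N A \<le> (\<Sum>k<N. h k - h' k + c * I k + c * \<delta> * (h' k - h k))"
    unfolding rule_excess_def h_def[symmetric] h'_def[symmetric] by (rule sum_mono)
  also have "\<dots> = (\<Sum>k<N. h k - h' k + c * I k) + c * \<delta> * (\<Sum>k<N. h' k - h k)"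
    by (simp add: sum.distrib sum_distrib_left)
  \<comment> \<open>The sum is the expected gain of the posterior product from time 0 to stopping,
    hence at most 1 for every horizon \<open>N\<close>.\<close>
  also have "c * \<delta> * (\<Sum>k<N. h' k - h k) \<le> c * \<delta> * 1"
  proof (rule mult_left_mono)
    have "(\<integral>w. prod_post (real (\<kappa> w) * \<delta>) w \<partial>M) \<le> (\<integral>w. 1 \<partial>M)"
      by (rule integral_mono[OF P(1)]) (auto simp: prod_post_range)
    moreover have "0 \<le> (\<integral>w. prod_post 0 w \<partial>M)"
      by (rule integral_nonneg_AE) (simp add: prod_post_range)
    ultimately show "(\<Sum>k<N. h' k - h k) \<le> 1"
      unfolding P(2) integral_prod_post_0 by (simp add: prob_space)
  qed (use c \<delta> in simp)
  finally show "1 - (\<Prod>i\<in>UNIV. \<pi> $ i) + rule_excess D c \<delta> N A \<le> mean_cost c (\<lambda>w. real (\<kappa> w) * \<delta>) + c * \<delta>"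
    unfolding cost by simp
qed

text \<open>Stopping at \<open>\<kappa> * \<delta>\<close> is admissible and bounded. Its cost is at
  most the immediate cost plus the excess, so the right end point in \<open>rule_excess\<close>
  makes this direction free of discretisation error.\<close>

lemma stopping_value_less_if_rule:
  assumes c: "0 \<le> c" and A: "stopping_rule \<mu> \<delta> A" and neg: "rule_excess D c \<delta> N A < 0"
  shows "stopping_value \<mu> D prod_terminal (prod_running c) < ennreal (prod_terminal \<pi>)"
proof -
  have \<delta>: "0 < \<delta>" and dec: "decseq A" and A: "\<And>k. A k \<in> sets (model_filtration \<mu> (real k * \<delta>))"
    using A by (auto simp: stopping_rule_def)
  define \<kappa> where "\<kappa> w = card {k. k < N \<and> model_path D w \<in> A k}" for w
  have less: "k < \<kappa> w \<longleftrightarrow> k < N \<and> model_path D w \<in> A k" and le: "\<kappa> w \<le> N" for k w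
    unfolding \<kappa>_def using dec by (intro down_set_card; auto simp: decseq_def)+
  define \<tau> where "\<tau> w = ennreal (real (\<kappa> w) * \<delta>)" for w
  have past: "{w \<in> space M. \<not> m < \<kappa> w} \<in> sets (obs_filtration \<mu> D (ennreal (real m * \<delta>)))" for m
  proof -
    have t: "0 \<le> real m * \<delta>" using \<delta> by simp
    have "model_path D -` A m \<inter> space M \<in> sets (obs_filtration \<mu> D (ennreal (real m * \<delta>)))"
      using sets_obs_filtration[OF t] A by blast
    from sets.compl_sets[OF this]
    have 1: "{w \<in> space M. model_path D w \<notin> A m} \<in> sets (obs_filtration \<mu> D (ennreal (real m * \<delta>)))"
      by (rule back_subst[where P = "\<lambda>S. S \<in> _"]) auto
    have 2: "space M \<in> sets (obs_filtration \<mu> D (ennreal (real m * \<delta>)))"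
      using sets.top[of "obs_filtration \<mu> D (ennreal (real m * \<delta>))"] by simp
    \<comment> \<open>From \<open>N\<close> on the rule has always stopped, so the event is all of
      \<open>space M\<close>.\<close>
    show ?thesis
    proof (cases "m < N")
      case True
      then show ?thesis using 1 by (simp add: less)
    next
      case False
      then show ?thesis using 2 by (simp add: less)
    qed
  qed
  have "stopping_time (obs_filtration \<mu> D) \<tau>"
  proof
    fix t :: ennreal
    show "Measurable.pred (obs_filtration \<mu> D t) (\<lambda>w. \<tau> w \<le> t)"
    proof (cases t)
      case (real r)
      \<comment> \<open>The last grid index not after time \<open>r\<close>: whether stopping occurs
        by \<open>r\<close> is already decided at \<open>m * \<delta>\<close>.\<close>
      define m where "m = nat \<lfloor>r / \<delta>\<rfloor>"
      have "\<tau> w \<le> t \<longleftrightarrow> \<not> m < \<kappa> w" for w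
      proof -
        have "\<tau> w \<le> t \<longleftrightarrow> real (\<kappa> w) \<le> r / \<delta>"
          using real \<delta> by (simp add: \<tau>_def pos_le_divide_eq)
        also have "\<dots> \<longleftrightarrow> \<kappa> w \<le> m"
          using real \<delta> by (simp add: m_def le_nat_floor le_nat_iff le_floor_iff)
        finally show ?thesis by auto
      qed
      moreover have "real m * \<delta> \<le> r"
      proof -
        have "real m \<le> r / \<delta>" using real \<delta> by (simp add: m_def)
        then show ?thesis using \<delta> by (simp add: pos_le_divide_eq)
      qed
      then have "sets (obs_filtration \<mu> D (ennreal (real m * \<delta>))) \<subseteq> sets (obs_filtration \<mu> D t)"
        using obs_filtration_mono[of "real m * \<delta>" r] real \<delta> by simp
      ultimately show ?thesis using past[of m] by (auto simp: pred_def)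
    qed simp
  qed
  then have adm: "\<tau> \<in> admissible \<mu> D" by (simp add: admissible_def \<tau>_def)
  have meas: "(\<lambda>w. real (\<kappa> w) * \<delta>) \<in> borel_measurable M"
  proof -
    have "(\<lambda>w. real (\<kappa> w)) \<in> borel_measurable M"
    proof (rule borel_measurableI_greater)
      fix y :: real
      have "{w \<in> space M. y < real (\<kappa> w)} = (if y < 0 then space M else {w \<in> space M. nat \<lfloor>y\<rfloor> < \<kappa> w})"
        by (auto simp: nat_less_iff floor_less_iff)
      moreover have "{w \<in> space M. m < \<kappa> w} \<in> events" for m
      proof -
        have "{w \<in> space M. \<not> m < \<kappa> w} \<in> events"
          using past[of m] obs_filtration_subset[of "real m * \<delta>"] \<delta> by auto
        from sets.compl_sets[OF this] show ?thesis
          by (rule back_subst[where P = "\<lambda>S. S \<in> _"]) auto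
      qed
      ultimately show "{w \<in> space M. y < real (\<kappa> w)} \<in> events" by simp
    qed
    then show ?thesis by simp
  qed
  have "AE w in M. \<forall>k<N. k < \<kappa> w \<longleftrightarrow> model_path D w \<in> A k" by (simp add: less)
  note grid = grid_cost[OF c \<delta> A meas le this]
  have pos: "0 \<le> mean_cost c (\<lambda>w. real (\<kappa> w) * \<delta>)"
    unfolding mean_cost_def using c \<delta> by (intro integral_nonneg_AE AE_I2 cost_bounds) auto
  have "stopping_value \<mu> D prod_terminal (prod_running c) \<le>
      expected_cost D prod_terminal (prod_running c) \<tau>"
    unfolding stopping_value_def by (rule INF_lower[OF adm])
  also have "\<dots> = (\<integral>\<^sup>+ w. ennreal (cost c (real (\<kappa> w) * \<delta>) w) \<partial>M)"
    unfolding expected_cost_eq using \<delta> by (simp add: \<tau>_def)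
  also have "\<dots> = ennreal (mean_cost c (\<lambda>w. real (\<kappa> w) * \<delta>))"
    unfolding mean_cost_def using c \<delta> by (intro nn_integral_eq_integral grid(1) AE_I2 cost_bounds) auto
  also have "\<dots> < ennreal (prod_terminal \<pi>)"
    using pos grid(2) neg by (intro ennreal_lessI) auto
  finally show ?thesis .
qed

text \<open>Take a stopping time with cost strictly below that of stopping at once, truncate it at a
  deterministic time \<open>m\<close>, and round up to a grid. Both costs converge by dominated
  convergence, so the strict inequality survives, together with the error
  \<open>c * d n\<close>.\<close>

lemma rule_if_stopping_value_less:
  assumes c: "0 \<le> c"
    and less: "stopping_value \<mu> D prod_terminal (prod_running c) < ennreal (prod_terminal \<pi>)"
  shows "\<exists>\<delta> N A. stopping_rule \<mu> \<delta> A \<and> rule_excess D c \<delta> N A < 0"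
proof -
  define v where "v = 1 - (\<Prod>i\<in>UNIV. \<pi> $ i)"
  obtain \<tau> where st: "stopping_time (obs_filtration \<mu> D) \<tau>" and fin: "AE w in M. \<tau> w < \<infinity>"
    and \<tau>: "(\<integral>\<^sup>+ w. ennreal (cost c (enn2real (\<tau> w)) w) \<partial>M) < ennreal v"
    using less unfolding stopping_value_def INF_less_iff admissible_def expected_cost_eq v_def by blast
  have after: "{w \<in> space M. ennreal s < \<tau> w} \<in> sets (obs_filtration \<mu> D (ennreal s))" if "0 \<le> s" for s
    using stopping_timeD2[OF st, of "ennreal s"] by (simp add: pred_def)
  have [measurable]: "\<tau> \<in> borel_measurable M"
  proof (rule borel_measurableI_greater)
    fix y :: ennreal
    show "{w \<in> space M. y < \<tau> w} \<in> events"
      using after[of "enn2real y"] obs_filtration_subset[of "enn2real y"] by (cases y) auto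
  qed
  define \<sigma> where "\<sigma> w = enn2real (\<tau> w)" for w
  have [measurable]: "\<sigma> \<in> borel_measurable M" unfolding \<sigma>_def by measurable
  have \<sigma>: "0 \<le> \<sigma> w" for w by (simp add: \<sigma>_def)
  have cost_int: "integrable M (\<lambda>w. cost c (\<sigma> w) w)"
  proof (rule integrableI_nonneg)
    show "(\<lambda>w. cost c (\<sigma> w) w) \<in> borel_measurable M" by (rule measurable_cost_at) simp
    show "AE w in M. 0 \<le> cost c (\<sigma> w) w" using cost_bounds \<sigma> c by (intro AE_I2) auto
    show "(\<integral>\<^sup>+ w. ennreal (cost c (\<sigma> w) w) \<partial>M) < \<infinity>"
      using \<tau> unfolding \<sigma>_def by (rule less_trans) simp
  qed
  have "ennreal (mean_cost c \<sigma>) < ennreal v"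
    using \<tau> nn_integral_eq_integral[OF cost_int] cost_bounds \<sigma> c by (simp add: mean_cost_def \<sigma>_def AE_I2)
  then have lt: "mean_cost c \<sigma> < v"
    by (meson ennreal_leI linorder_not_le)
  have "(\<lambda>m. mean_cost c (\<lambda>w. min (\<sigma> w) (real m))) \<longlonglongrightarrow> mean_cost c \<sigma>"
    unfolding mean_cost_def
  proof (rule integral_dominated_convergence[where w = "\<lambda>w. 1 + cost c (\<sigma> w) w"])
    show "(\<lambda>w. cost c (\<sigma> w) w) \<in> borel_measurable M" using cost_int by simp
    show "(\<lambda>w. cost c (min (\<sigma> w) (real m)) w) \<in> borel_measurable M" for m
      by (rule measurable_cost_at) simp
    show "integrable M (\<lambda>w. 1 + cost c (\<sigma> w) w)" using cost_int by simp
    show "AE w in M. (\<lambda>m. cost c (min (\<sigma> w) (real m)) w) \<longlonglongrightarrow> cost c (\<sigma> w) w"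
    proof (intro AE_I2 tendsto_eventually)
      fix w
      obtain m0 :: nat where "\<sigma> w \<le> real m0" using real_arch_simple by blast
      show "\<forall>\<^sub>F m in sequentially. cost c (min (\<sigma> w) (real m)) w = cost c (\<sigma> w) w"
        using eventually_ge_at_top[of m0]
      proof eventually_elim
        case (elim m)
        then have "\<sigma> w \<le> real m" using \<open>\<sigma> w \<le> real m0\<close> by simp
        then show ?case by (simp add: min_def)
      qed
    qed
    \<comment> \<open>The running cost only grows with time and the terminal cost is at most
      1.\<close>
    show "AE w in M. norm (cost c (min (\<sigma> w) (real m)) w) \<le> 1 + cost c (\<sigma> w) w" for m
    proof (rule AE_I2)
      fix w assume w: "w \<in> space M"
      have "acc_post (min (\<sigma> w) (real m)) w \<le> acc_post (\<sigma> w) w"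
        using acc_post_diff(2)[OF w, of "min (\<sigma> w) (real m)" "\<sigma> w"] \<sigma>[of w] by simp
      then have "c * acc_post (min (\<sigma> w) (real m)) w \<le> c * acc_post (\<sigma> w) w"
        using c by (rule mult_left_mono)
      then show "norm (cost c (min (\<sigma> w) (real m)) w) \<le> 1 + cost c (\<sigma> w) w"
        using cost_bounds(1)[OF w _ c, of "min (\<sigma> w) (real m)"] \<sigma>[of w]
          prod_post_range[of "\<sigma> w" w] prod_post_range[of "min (\<sigma> w) (real m)" w]
        by (simp add: cost_def)
    qed
  qed
  from order_tendstoD(2)[OF this lt] obtain m where m: "mean_cost c (\<lambda>w. min (\<sigma> w) (real m)) < v"
    unfolding eventually_sequentially by blast
  define d where "d n = 1 / real (Suc n)" for n
  have d: "0 < d n" "d n \<le> 1" for n by (simp_all add: d_def)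
  have d_lim: "d \<longlonglongrightarrow> 0"
    unfolding d_def using LIMSEQ_inverse_real_of_nat by (simp add: inverse_eq_divide)
  \<comment> \<open>Chosen so that the truncation time \<open>m\<close> is the grid point with index
    \<open>N n\<close>.\<close>
  define N where "N n = m * Suc n" for n
  have Nd: "real (N n) * d n = real m" for n unfolding N_def d_def of_nat_mult by simp
  \<comment> \<open>Counting the grid times strictly before \<open>\<sigma> w\<close> rounds up: the
    decision to continue at \<open>k * d n\<close> is the event that stopping comes later, which is
    observable at that time.\<close>
  define \<kappa> where "\<kappa> n w = card {k. k < N n \<and> real k * d n < \<sigma> w}" for n w
  have down: "real l * d n < \<sigma> w" if "l \<le> k" "real k * d n < \<sigma> w" for k l n w
    using that d(1)[of n] by (meson le_less_trans mult_right_mono less_imp_le of_nat_mono)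
  have less: "k < \<kappa> n w \<longleftrightarrow> k < N n \<and> real k * d n < \<sigma> w" for k n w
    unfolding \<kappa>_def by (rule down_set_card(1)) (rule down)
  have le: "\<kappa> n w \<le> N n" for n w
    unfolding \<kappa>_def by (rule down_set_card(2)) (rule down)
  have lower: "min (\<sigma> w) (real m) \<le> real (\<kappa> n w) * d n" for n w
  proof (cases "\<kappa> n w < N n")
    case True
    then show ?thesis using less[of "\<kappa> n w" n w] by auto
  next
    case False
    then have "\<kappa> n w = N n" using le[of n w] by simp
    then show ?thesis by (simp add: Nd)
  qed
  have upper: "real (\<kappa> n w) * d n \<le> min (\<sigma> w) (real m) + d n" for n w
  proof (cases "\<kappa> n w")
    case 0
    then show ?thesis using \<sigma>[of w] d(1)[of n] by simp
  next
    case (Suc k)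
    then have "real k * d n < \<sigma> w" using less[of k n w] by simp
    moreover have "real (\<kappa> n w) * d n \<le> real (N n) * d n"
      using le[of n w] d(1)[of n] by (intro mult_right_mono) auto
    moreover have "real (\<kappa> n w) * d n = real k * d n + d n" by (simp add: Suc distrib_right)
    ultimately show ?thesis
      using d(1)[of n] unfolding Nd by linarith
  qed
  have \<kappa>_meas: "(\<lambda>w. real (\<kappa> n w) * d n) \<in> borel_measurable M" for n
  proof -
    have "real (\<kappa> n w) = (\<Sum>k<N n. if real k * d n < \<sigma> w then 1 else 0)" for w
      unfolding \<kappa>_def by (simp add: sum.If_cases Int_def)
    then show ?thesis by simp
  qed
  have lim: "(\<lambda>n. mean_cost c (\<lambda>w. real (\<kappa> n w) * d n) + c * d n) \<longlonglongrightarrow>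
      mean_cost c (\<lambda>w. min (\<sigma> w) (real m)) + c * 0"
  proof (intro tendsto_add tendsto_mult tendsto_const d_lim)
    show "(\<lambda>n. mean_cost c (\<lambda>w. real (\<kappa> n w) * d n)) \<longlonglongrightarrow> mean_cost c (\<lambda>w. min (\<sigma> w) (real m))"
      unfolding mean_cost_def
  proof (rule integral_dominated_convergence[where w = "\<lambda>_. 1 + c * (real m + 1)"])
      show "(\<lambda>w. cost c (min (\<sigma> w) (real m)) w) \<in> borel_measurable M"
        by (rule measurable_cost_at) simp
      show "(\<lambda>w. cost c (real (\<kappa> n w) * d n) w) \<in> borel_measurable M" for n
        by (rule measurable_cost_at[OF \<kappa>_meas])
      show "AE w in M. (\<lambda>n. cost c (real (\<kappa> n w) * d n) w) \<longlonglongrightarrow> cost c (min (\<sigma> w) (real m)) w"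
      proof (rule AE_I2)
        fix w assume w: "w \<in> space M"
        have "(\<lambda>n. min (\<sigma> w) (real m) + d n) \<longlonglongrightarrow> min (\<sigma> w) (real m) + 0"
          by (intro tendsto_add tendsto_const d_lim)
        then have "(\<lambda>n. min (\<sigma> w) (real m) + d n) \<longlonglongrightarrow> min (\<sigma> w) (real m)"
          by (simp only: add_0_right)
        with always_eventually[OF allI[OF lower]] always_eventually[OF allI[OF upper]] tendsto_const
        have "(\<lambda>n. real (\<kappa> n w) * d n) \<longlonglongrightarrow> min (\<sigma> w) (real m)"
          by (rule real_tendsto_sandwich)
        then show "(\<lambda>n. cost c (real (\<kappa> n w) * d n) w) \<longlonglongrightarrow> cost c (min (\<sigma> w) (real m)) w"
          by (rule continuous_on_tendsto_compose[OF continuous_cost[OF w]])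
             (use \<sigma>[of w] d(1) in \<open>simp_all add: less_imp_le\<close>)
      qed
      show "AE w in M. norm (cost c (real (\<kappa> n w) * d n) w) \<le> 1 + c * (real m + 1)" for n
      proof (rule AE_I2)
        fix w assume w: "w \<in> space M"
        have "0 \<le> real (\<kappa> n w) * d n" "real (\<kappa> n w) * d n \<le> real m + 1"
          using upper[of n w] d[of n] by auto
        then show "norm (cost c (real (\<kappa> n w) * d n) w) \<le> 1 + c * (real m + 1)"
          using cost_bounds[OF w _ c, of "real (\<kappa> n w) * d n"] mult_left_mono[OF _ c, of "real (\<kappa> n w) * d n" "real m + 1"]
          by simp
      qed
    qed simp
  qed
  have "mean_cost c (\<lambda>w. min (\<sigma> w) (real m)) + c * 0 < v" using m by simp
  from order_tendstoD(2)[OF lim this] obtain n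
    where n: "mean_cost c (\<lambda>w. real (\<kappa> n w) * d n) + c * d n < v"
    unfolding eventually_sequentially by blast
  have "\<exists>A. A \<in> sets (model_filtration \<mu> (real k * d n)) \<and>
      {w \<in> space M. ennreal (real k * d n) < \<tau> w} = model_path D -` A \<inter> space M" for k
    using after[of "real k * d n"] sets_obs_filtration[of "real k * d n"] d(1)[of n] by auto
  then obtain A' where A': "\<And>k. A' k \<in> sets (model_filtration \<mu> (real k * d n))"
    "\<And>k. {w \<in> space M. ennreal (real k * d n) < \<tau> w} = model_path D -` A' k \<inter> space M"
    by metis
  \<comment> \<open>The preimages of \<open>A' k\<close> decrease in \<open>k\<close>, but
    \<open>A' k\<close> itself need not, since trajectories that the model does not produce are
    unconstrained. Intersecting restores monotonicity on all of path space.\<close>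
  define A where "A k = (\<Inter>j\<in>{..k}. A' j)" for k
  have A: "A k \<in> sets (model_filtration \<mu> (real k * d n))" for k
    unfolding A_def
  proof (rule sets.finite_INT)
    fix j assume "j \<in> {..k}"
    then have "real j * d n \<le> real k * d n" using d(1)[of n] by (intro mult_right_mono) auto
    then show "A' j \<in> sets (model_filtration \<mu> (real k * d n))"
      using A'(1)[of j] model_filtration_mono by blast
  qed auto
  have rule: "stopping_rule \<mu> (d n) A"
    using A d(1) by (auto simp: stopping_rule_def A_def decseq_def)
  have "AE w in M. \<forall>k<N n. k < \<kappa> n w \<longleftrightarrow> model_path D w \<in> A k"
    using fin AE_space
  proof eventually_elim
    case (elim w)
    have A'_iff: "model_path D w \<in> A' k \<longleftrightarrow> real k * d n < \<sigma> w" for k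
    proof -
      have "model_path D w \<in> A' k \<longleftrightarrow> ennreal (real k * d n) < \<tau> w"
        using A'(2)[of k] elim(2) by blast
      also have "\<dots> \<longleftrightarrow> real k * d n < \<sigma> w"
        using elim(1) d(1)[of n] by (cases "\<tau> w") (auto simp: \<sigma>_def ennreal_less_iff)
      finally show ?thesis .
    qed
    have "model_path D w \<in> A k \<longleftrightarrow> real k * d n < \<sigma> w" for k
      unfolding A_def using A'_iff down[of _ k n w] by auto
    then show ?case by (simp add: less)
  qed
  from grid_cost(3)[OF c d(1) A \<kappa>_meas le this] n
  have "rule_excess D c (d n) (N n) A < 0" by (simp add: v_def)
  with rule show ?thesis by blast
qed

text \<open>From here on the value is replaced by the existence of a rule, a statement in which the
  prior enters only through the law of the trajectory.\<close>

lemma stopping_value_less_iff: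
  assumes "0 \<le> c"
  shows "stopping_value \<mu> D prod_terminal (prod_running c) < ennreal (prod_terminal \<pi>) \<longleftrightarrow>
    (\<exists>\<delta> N A. stopping_rule \<mu> \<delta> A \<and> rule_excess D c \<delta> N A < 0)"
  using stopping_value_less_if_rule[OF assms] rule_if_stopping_value_less[OF assms] by blast

end

section \<open>Shape of the continuation region\<close>

text \<open>\<open>R\<close> is built from \<open>A\<close> and \<open>t\<close> alone, so the same
  event serves all priors and affinity of the path law carries over.\<close>

lemma hit_prob_law:
  assumes "detection_model \<mu> lam \<pi> D" "0 \<le> t" "A \<in> sets model_paths"
  defines "R \<equiv> {z \<in> space model_paths. z \<in> A \<and> (\<forall>i. fst (z i) t = 1)}"
  shows "R \<in> sets model_paths" "hit_prob D A t = measure (distr (msr D) model_paths (model_path D)) R"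
proof -
  interpret detection_model \<mu> lam \<pi> D by fact
  have R_eq: "R = A \<inter> (\<Inter>i\<in>UNIV. (\<lambda>z. fst (z i) t) -` {1} \<inter> space model_paths)"
    using sets.sets_into_space[OF assms(3)] by (auto simp: R_def)
  have ev: "(\<lambda>z. fst (z i) t) -` {1} \<inter> space model_paths \<in> sets model_paths" for i
    by (rule measurable_sets[OF measurable_compose[OF measurable_model_coordinate measurable_chain_coordinate[OF assms(2)]]]) simp
  show R: "R \<in> sets model_paths"
    unfolding R_eq by (intro sets.Int sets.finite_INT assms(3) ev) auto
  show "hit_prob D A t = measure (distr (msr D) model_paths (model_path D)) R"
    unfolding measure_distr[OF measurable_model_path R] hit_prob_def
    by (rule arg_cong[where f = prob])
       (use assms(2) model_path_space in \<open>auto simp: R_def model_path_def coord_path_def sample_path_def\<close>)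
qed

lemma rule_excess_affine:
  fixes D1 :: "('u, 'n::finite) qd_space" and D2 :: "('v, 'n) qd_space" and D3 :: "('w, 'n) qd_space"
  assumes D: "detection_model \<mu> lam \<pi>1 D1" "detection_model \<mu> lam \<pi>2 D2" "detection_model \<mu> lam \<pi>3 D3"
    and prior: "\<pi>1 $ i = (1 - x) * \<pi>2 $ i + x * \<pi>3 $ i"
    and other: "\<And>j. j \<noteq> i \<Longrightarrow> \<pi>2 $ j = \<pi>1 $ j" "\<And>j. j \<noteq> i \<Longrightarrow> \<pi>3 $ j = \<pi>1 $ j"
    and rule: "stopping_rule \<mu> \<delta> A"
  shows "rule_excess D1 c \<delta> N A = (1 - x) * rule_excess D2 c \<delta> N A + x * rule_excess D3 c \<delta> N A"
proof -
  have A: "A k \<in> sets model_paths" and \<delta>: "0 < \<delta>" for k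
    using rule model_filtration_subset by (auto simp: stopping_rule_def)
  have hit: "hit_prob D1 (A k) t = (1 - x) * hit_prob D2 (A k) t + x * hit_prob D3 (A k) t" if "0 \<le> t" for k t
    unfolding hit_prob_law(2)[OF D(1) that A] hit_prob_law(2)[OF D(2) that A] hit_prob_law(2)[OF D(3) that A]
    by (rule model_law_affine[OF D prior other hit_prob_law(1)[OF D(1) that A]])
  have nonneg: "0 \<le> real k * \<delta>" for k using \<delta> by simp
  have "rule_excess D1 c \<delta> N A = (\<Sum>k<N.
      (1 - x) * (hit_prob D2 (A k) (real k * \<delta>) - (1 - c * \<delta>) * hit_prob D2 (A k) (real (Suc k) * \<delta>)) +
      x * (hit_prob D3 (A k) (real k * \<delta>) - (1 - c * \<delta>) * hit_prob D3 (A k) (real (Suc k) * \<delta>)))"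
    unfolding rule_excess_def
    by (intro sum.cong refl, subst hit[OF nonneg], subst hit[OF nonneg]) (simp add: algebra_simps)
  then show ?thesis
    by (simp only: sum.distrib sum_distrib_left[symmetric] rule_excess_def)
qed

text \<open>Over the one-element index type a trajectory is a constant function, so the event lives
  on a single coordinate and can be evaluated under the law of either coordinate in dimension
  two.\<close>

lemma hit_prob_1:
  fixes D :: "('w, 1) qd_space"
  assumes "detection_model \<mu> lam \<pi> D" "0 \<le> t" "A \<in> sets model_paths"
  defines "R \<equiv> {z \<in> space coord_paths. (\<lambda>_. z) \<in> A \<and> fst z t = 1}"
  shows "R \<in> sets coord_paths" "hit_prob D A t = measure (coord_law D 1) R"
proof -
  interpret detection_model \<mu> lam \<pi> D by fact
  have "(\<lambda>z. \<lambda>_\<in>UNIV. z) \<in> coord_paths \<rightarrow>\<^sub>M (model_paths :: (1 \<Rightarrow> _) measure)"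
    unfolding model_paths_def by (rule measurable_restrict) (rule measurable_ident_sets[OF refl])
  then have const: "(\<lambda>z. \<lambda>_. z) \<in> coord_paths \<rightarrow>\<^sub>M (model_paths :: (1 \<Rightarrow> _) measure)"
    by (rule back_subst[where P = "\<lambda>f. f \<in> _"]) (intro ext, simp only: restrict_apply UNIV_I if_True)
  have R_eq: "R = ((\<lambda>z. \<lambda>_. z) -` A \<inter> space coord_paths) \<inter> ((\<lambda>z. fst z t) -` {1} \<inter> space coord_paths)"
    by (auto simp: R_def)
  have ev: "(\<lambda>z. fst z t) -` {1} \<inter> space coord_paths \<in> sets coord_paths"
    by (rule measurable_sets[OF measurable_chain_coordinate[OF assms(2)]]) simp
  show R: "R \<in> sets coord_paths"
    unfolding R_eq by (intro sets.Int measurable_sets[OF const assms(3)] ev)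
  have mp: "model_path D w = (\<lambda>_. coord_path D 1 w)" for w
    by (intro ext) (metis (full_types) model_path_def num1_eq1)
  have "(\<forall>i. chain D i t w = 1) \<longleftrightarrow> chain D 1 t w = 1" for w
    by (metis (full_types) num1_eq1)
  then show "hit_prob D A t = measure (coord_law D 1) R"
    unfolding coord_law_def measure_distr[OF measurable_coord_path R] hit_prob_def
    by (intro arg_cong[where f = prob])
       (use assms(2) measurable_space[OF measurable_coord_path] in \<open>auto simp: R_def mp coord_path_def sample_path_def\<close>)
qed

text \<open>Only partial sums up to the minimising index are compared, so every tail sum is nonpositive and
  summation by parts applies.\<close>

lemma weighted_sum_up_to_argmin:
  fixes w \<alpha> :: "nat \<Rightarrow> real"
  assumes w: "\<And>k. w k \<le> w (Suc k)" and min: "\<And>n. n \<le> N \<Longrightarrow> (\<Sum>k<N. \<alpha> k) \<le> (\<Sum>k<n. \<alpha> k)"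
  shows "(\<Sum>k<N. w k * \<alpha> k) \<le> w 0 * (\<Sum>k<N. \<alpha> k)"
proof -
  \<comment> \<open>Invariant: the first \<open>n\<close> terms carry their own weights, the whole
    tail carries \<open>w n\<close>. One step raises the weight of a tail whose sum is nonpositive;
    at \<open>n = N\<close> the tail is empty.\<close>
  have "(\<Sum>k<n. w k * \<alpha> k) + w n * ((\<Sum>k<N. \<alpha> k) - (\<Sum>k<n. \<alpha> k)) \<le> w 0 * (\<Sum>k<N. \<alpha> k)" if "n \<le> N" for n
    using that
  proof (induction n)
    case (Suc n)
    have "(w (Suc n) - w n) * ((\<Sum>k<N. \<alpha> k) - (\<Sum>k<Suc n. \<alpha> k)) \<le> 0"
      using w[of n] min[OF Suc.prems] by (intro mult_nonneg_nonpos) auto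
    moreover have "(\<Sum>k<n. w k * \<alpha> k) + w n * ((\<Sum>k<N. \<alpha> k) - (\<Sum>k<n. \<alpha> k)) \<le> w 0 * (\<Sum>k<N. \<alpha> k)"
      using Suc by simp
    ultimately show ?case unfolding sum.lessThan_Suc by argo
  qed simp
  from this[of N] show ?thesis by simp
qed

text \<open>Some initial state has positive probability, and from either state the chain is in 1 at
  time \<open>t\<close> with positive probability.\<close>

lemma chain_prob_pos:
  assumes "detection_model \<mu> lam \<pi> D" "0 < lam $ i" "0 < t"
  shows "0 < \<P>(w in msr D. chain D i t w = 1)"
proof -
  interpret detection_model \<mu> lam \<pi> D by fact
  have "\<P>(w in msr D. chain D i 0 w = 0) + \<P>(w in msr D. chain D i 0 w = 1) =
      prob ({w \<in> space (msr D). chain D i 0 w = 0} \<union> {w \<in> space (msr D). chain D i 0 w = 1})"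
    by (rule finite_measure_Union[symmetric]) (auto intro: chain_event)
  also have "{w \<in> space (msr D). chain D i 0 w = 0} \<union> {w \<in> space (msr D). chain D i 0 w = 1} = space (msr D)"
    using chain_range[of 0 _ i] by blast
  finally have "\<P>(w in msr D. chain D i 0 w = 0) + \<P>(w in msr D. chain D i 0 w = 1) = 1"
    by (simp only: prob_space)
  then have "\<P>(w in msr D. chain D i 0 w = 0) \<noteq> 0 \<or> \<P>(w in msr D. chain D i 0 w = 1) \<noteq> 0"
    by linarith
  then have "\<exists>j. (j = 0 \<or> j = 1) \<and> \<P>(w in msr D. chain D i 0 w = j) \<noteq> 0"
    by (elim disjE) (rule exI, rule conjI[rotated], assumption, simp)+
  then obtain j where j: "j = 0 \<or> j = 1" "\<P>(w in msr D. chain D i 0 w = j) \<noteq> 0" by (elim exE conjE)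
  define ts where "ts k = real k * t" for k
  define js where "js k = (if k = 0 then j else 1)" for k :: nat
  have "\<P>(w in msr D. \<forall>k\<le>1. chain D i (ts k) w = js k) =
      \<P>(w in msr D. chain D i (ts 0) w = js 0) *
      (\<Prod>k<1. chain_semigroup (lam $ i) (ts (Suc k) - ts k) (js k) (js (Suc k)))"
  proof (rule markov_chain_fdd[OF markov_chain])
    show "strict_mono ts" using \<open>0 < t\<close> by (auto intro!: strict_monoI simp: ts_def)
    show "\<forall>k\<le>1. js k \<in> {0, 1}" using j(1) by (auto simp: js_def)
  qed (simp add: ts_def)
  also have "\<dots> = \<P>(w in msr D. chain D i 0 w = j) * chain_semigroup (lam $ i) t j 1"
    by (simp add: ts_def js_def)
  also have "0 < \<dots>"
    using j assms(2,3) by (intro mult_pos_pos) (auto simp: chain_semigroup_def zero_less_measure_iff)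
  finally have "0 < \<P>(w in msr D. \<forall>k\<le>1. chain D i (ts k) w = js k)" .
  also have "\<dots> \<le> \<P>(w in msr D. chain D i t w = 1)"
  proof (rule finite_measure_mono)
    show "{w \<in> space (msr D). \<forall>k\<le>1. chain D i (ts k) w = js k} \<subseteq> {w \<in> space (msr D). chain D i t w = 1}"
    proof safe
      fix w assume "\<forall>k\<le>1. chain D i (ts k) w = js k"
      from this[rule_format, of 1] show "chain D i t w = 1" by (simp add: ts_def js_def)
    qed
    show "{w \<in> space (msr D). chain D i t w = 1} \<in> events" using assms(3) by (intro chain_event) simp
  qed
  finally show ?thesis .
qed

text \<open>The rule that ignores coordinate \<open>i\<close>: since that chain is independent of the rule, it enters only
  through the nondecreasing function \<open>t \<mapsto> P(Y\<^sup>i\<^sub>t = 1)\<close>, which acts as a weight.\<close>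

lemma rule_from_one_coordinate:
  fixes D :: "('w, 2) qd_space" and D' :: "('v, 1) qd_space" and i j :: 2
  assumes D: "detection_model \<mu> lam \<pi> D" and D': "detection_model (vec (\<mu> $ j)) (vec (lam $ j)) (vec (\<pi> $ j)) D'"
    and ij: "i \<noteq> j" and lam: "0 < lam $ i"
    and rule': "stopping_rule (vec (\<mu> $ j)) \<delta> A'" and neg: "rule_excess D' c \<delta> N A' < 0"
  shows "\<exists>\<delta> N A. stopping_rule \<mu> \<delta> A \<and> rule_excess D c \<delta> N A < 0"
proof -
  interpret D: detection_model \<mu> lam \<pi> D by fact
  interpret D': detection_model "vec (\<mu> $ j)" "vec (lam $ j)" "vec (\<pi> $ j)" D' by fact
  have UNIV2: "(UNIV :: 2 set) = {i, j}"
    using ij exhaust_2[of i] exhaust_2[of j] by (auto simp: UNIV_2)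
  have \<delta>: "0 < \<delta>" and dec: "decseq A'" and A': "\<And>k. A' k \<in> sets (model_filtration (vec (\<mu> $ j)) (real k * \<delta>))"
    using rule' by (auto simp: stopping_rule_def)
  \<comment> \<open>Projection to coordinate \<open>j\<close>. It maps the two-dimensional
    information to the one-dimensional one at each time, so pulling back a rule keeps it
    nonanticipating.\<close>
  define \<phi> where "\<phi> z = (\<lambda>_::1. z j)" for z :: "2 \<Rightarrow> coord_traj"
  define A where "A k = \<phi> -` A' k \<inter> space model_paths" for k
  have \<phi>: "\<phi> \<in> model_filtration \<mu> t \<rightarrow>\<^sub>M model_filtration (vec (\<mu> $ j)) t" for t
  proof (rule measurable_into_model_filtration)
    show "\<phi> \<in> space (model_filtration \<mu> t) \<rightarrow> space model_paths"
      by (auto simp: \<phi>_def model_paths_def space_PiM PiE_iff)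
    show "(\<lambda>x. signal (vec (\<mu> $ j) $ i) s (\<phi> x i)) \<in> borel_measurable (model_filtration \<mu> t)"
      if "0 \<le> s" "s \<le> t" for s i
      using measurable_signal_model_filtration[OF that, of \<mu> j] by (simp add: \<phi>_def)
  qed
  have A: "A k \<in> sets (model_filtration \<mu> (real k * \<delta>))" for k
    using measurable_sets[OF \<phi> A'[of k]] by (simp add: A_def)
  have rule: "stopping_rule \<mu> \<delta> A"
    using \<delta> dec A by (auto simp: stopping_rule_def A_def decseq_def)
  define m where "m t = \<P>(w in msr D. chain D i t w = 1)" for t
  have m_mono: "m s \<le> m t" if "0 \<le> s" "s \<le> t" for s t
    unfolding m_def
  proof (rule D.finite_measure_mono_AE)
    show "AE w in msr D. w \<in> {w \<in> space (msr D). chain D i s w = 1} \<longrightarrow> w \<in> {w \<in> space (msr D). chain D i t w = 1}"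
      using D.chain_absorbed[OF that, of i] by eventually_elim simp
    show "{w \<in> space (msr D). chain D i t w = 1} \<in> D.events"
      using that by (intro D.chain_event) simp
  qed
  have prod: "hit_prob D (A k) t = m t * hit_prob D' (A' k) t" if t: "0 \<le> t" for k t
  proof -
    have A'k: "A' k \<in> sets model_paths" using A' model_filtration_subset by blast
    define R where "R = {z \<in> space coord_paths. (\<lambda>_. z) \<in> A' k \<and> fst z t = 1}"
    note R = hit_prob_1[OF D' t A'k, folded R_def]
    \<comment> \<open>The state of chain \<open>i\<close> and everything concerning coordinate
      \<open>j\<close> are separated into independent events, which produces the weight
      \<open>m t\<close>.\<close>
    define E where "E l = (if l = i then {w \<in> space (msr D). chain D i t w = 1} else coord_path D j -` R \<inter> space (msr D))" for l
    have E: "E l \<in> sets (coord_events D l)" for l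
    proof (cases "l = i")
      case True
      then show ?thesis using D.chain_event(1)[OF t] by (simp add: E_def)
    next
      case False
      then have "l = j" using UNIV2 by blast
      then show ?thesis
        using measurable_sets[OF D.measurable_coord_path_coord_events R(1), of j] False by (simp add: E_def)
    qed
    have "hit_prob D (A k) t = D.prob (\<Inter>l\<in>UNIV. E l)"
      unfolding hit_prob_def
    proof (rule arg_cong[where f = D.prob], intro set_eqI iffI)
      fix w assume "w \<in> {w \<in> space (msr D). model_path D w \<in> A k \<and> (\<forall>i. chain D i t w = 1)}"
      then show "w \<in> (\<Inter>l\<in>UNIV. E l)"
        using t measurable_space[OF D.measurable_coord_path]
        by (auto simp: E_def R_def A_def \<phi>_def model_path_def coord_path_def sample_path_def)
    next
      fix w assume "w \<in> (\<Inter>l\<in>UNIV. E l)"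
      then have "w \<in> E i" "w \<in> E j" by auto
      then have w: "w \<in> space (msr D)" "chain D i t w = 1" "coord_path D j w \<in> R"
        using ij by (auto simp: E_def)
      then have "chain D j t w = 1" using t by (simp add: R_def coord_path_def sample_path_def)
      then have "\<forall>l. chain D l t w = 1" using w(2) UNIV2 by (metis UNIV_I empty_iff insert_iff)
      then show "w \<in> {w \<in> space (msr D). model_path D w \<in> A k \<and> (\<forall>i. chain D i t w = 1)}"
        using w D.model_path_space by (auto simp: R_def A_def \<phi>_def model_path_def)
    qed
    also have "\<dots> = (\<Prod>l\<in>UNIV. D.prob (E l))"
      using D.indep_coord_events E by (intro D.indep_setsD) auto
    also have "\<dots> = m t * D.prob (coord_path D j -` R \<inter> space (msr D))"
      using ij by (simp add: UNIV2 E_def m_def)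
    also have "D.prob (coord_path D j -` R \<inter> space (msr D)) = measure (coord_law D j) R"
      unfolding coord_law_def by (rule measure_distr[OF D.measurable_coord_path R(1), symmetric])
    also have "coord_law D j = coord_law D' 1"
      by (rule coord_law_unique[OF D D']) simp_all
    finally show ?thesis by (simp add: R(2))
  qed
  define r where "r k = hit_prob D' (A' k) (real k * \<delta>)" for k
  define \<alpha> where "\<alpha> k = hit_prob D' (A' k) (real k * \<delta>) - (1 - c * \<delta>) * hit_prob D' (A' k) (real (Suc k) * \<delta>)" for k
  define S where "S n = (\<Sum>k<n. \<alpha> k)" for n
  \<comment> \<open>The horizon with the smallest partial sum; without this truncation growing
    weights could favour late periods of positive excess.\<close>
  obtain N' where N': "N' \<le> N" "\<And>n. n \<le> N \<Longrightarrow> S N' \<le> S n"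
  proof -
    have "finite {..N}" "{..N} \<noteq> {}" by auto
    from ex_min_if_finite[of "S ` {..N}"] obtain N' where "N' \<le> N" "\<not> (\<exists>s\<in>S ` {..N}. s < S N')" by auto
    then show ?thesis by (intro that[of N']) force+
  qed
  have "S N < 0" using neg by (simp add: S_def \<alpha>_def rule_excess_def)
  with N'(2)[of N] have SN': "S N' < 0" by simp
  have "rule_excess D c \<delta> N' A \<le> (\<Sum>k<N'. m (real (Suc k) * \<delta>) * \<alpha> k)"
    unfolding rule_excess_def
  proof (rule sum_mono)
    fix k
    have k: "0 \<le> real k * \<delta>" "real k * \<delta> \<le> real (Suc k) * \<delta>" "0 \<le> real (Suc k) * \<delta>" using \<delta> by (auto simp: mult_right_mono)
    \<comment> \<open>Moving the weight to the right end of the period gives both terms of the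
      excess the same factor.\<close>
    have "m (real k * \<delta>) * r k \<le> m (real (Suc k) * \<delta>) * r k"
      by (intro mult_right_mono m_mono k) (simp add: r_def hit_prob_def)
    then show "hit_prob D (A k) (real k * \<delta>) - (1 - c * \<delta>) * hit_prob D (A k) (real (Suc k) * \<delta>) \<le>
        m (real (Suc k) * \<delta>) * \<alpha> k"
      unfolding prod[OF k(1)] prod[OF k(3)] by (simp add: \<alpha>_def r_def algebra_simps)
  qed
  also have "\<dots> \<le> m (real (Suc 0) * \<delta>) * S N'"
    unfolding S_def
  proof (rule weighted_sum_up_to_argmin)
    show "m (real (Suc k) * \<delta>) \<le> m (real (Suc (Suc k)) * \<delta>)" for k
      using \<delta> by (intro m_mono mult_right_mono) auto
    show "(\<Sum>k<N'. \<alpha> k) \<le> (\<Sum>k<n. \<alpha> k)" if "n \<le> N'" for n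
      using N'(2)[of n] N'(1) that by (simp add: S_def)
  qed
  \<comment> \<open>The weight is taken at time \<open>\<delta>\<close> rather than 0, where it
    would vanish if \<open>\<pi> $ i = 0\<close>.\<close>
  also have "\<dots> < 0"
    using chain_prob_pos[OF D lam, of \<delta>] SN' \<delta> by (intro mult_pos_neg) (simp_all add: m_def)
  finally show ?thesis using rule by blast
qed

text \<open>If chain \<open>j\<close> starts in state 1 then observing coordinate \<open>j\<close> only provides independent noise:
  freezing that noise turns a rule into a rule for coordinate \<open>i\<close> alone.\<close>

lemma no_rule_if_other_coordinate_certain:
  fixes D :: "('w, 2) qd_space" and D' :: "('v, 1) qd_space" and i j :: 2
  assumes D: "detection_model \<mu> lam \<pi> D" and D': "detection_model (vec (\<mu> $ i)) (vec (lam $ i)) (vec (\<pi> $ i)) D'"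
    and ij: "i \<noteq> j" and certain: "\<pi> $ j = 1"
    and no_rule: "\<And>\<delta> N A. stopping_rule (vec (\<mu> $ i)) \<delta> A \<Longrightarrow> 0 \<le> rule_excess D' c \<delta> N A"
    and rule: "stopping_rule \<mu> \<delta> A"
  shows "0 \<le> rule_excess D c \<delta> N A"
proof -
  interpret D: detection_model \<mu> lam \<pi> D by fact
  interpret D': detection_model "vec (\<mu> $ i)" "vec (lam $ i)" "vec (\<pi> $ i)" D' by fact
  interpret Li: prob_space "coord_law D i" by (rule D.prob_space_coord_law)
  interpret Lj: prob_space "coord_law D j" by (rule D.prob_space_coord_law)
  interpret L: pair_prob_space "coord_law D i" "coord_law D j" ..
  have UNIV2: "(UNIV :: 2 set) = {i, j}"
    using ij exhaust_2[of i] exhaust_2[of j] by (auto simp: UNIV_2)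
  have \<delta>: "0 < \<delta>" and dec: "decseq A" and A: "\<And>k. A k \<in> sets (model_filtration \<mu> (real k * \<delta>))"
    using rule by (auto simp: stopping_rule_def)
  have A_paths: "A k \<in> sets model_paths" for k using A model_filtration_subset by blast
  define glue :: "coord_traj \<Rightarrow> coord_traj \<Rightarrow> 2 \<Rightarrow> coord_traj"
    where "glue z y = (\<lambda>l. if l = i then z else y)" for z y
  \<comment> \<open>The rule for coordinate \<open>i\<close> obtained by fixing the trajectory of
    coordinate \<open>j\<close> to be \<open>y\<close>.\<close>
  define A' where "A' y k = {z \<in> space (model_paths :: (1 \<Rightarrow> _) measure). glue (z 1) y \<in> A k}" for y k
  have rule': "stopping_rule (vec (\<mu> $ i)) \<delta> (A' y)" if y: "y \<in> space coord_paths" for y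
    unfolding stopping_rule_def
  proof (intro conjI allI)
    show "decseq (A' y)" using dec by (auto simp: A'_def decseq_def)
    fix k
    have "(\<lambda>z. glue (z 1) y) \<in> model_filtration (vec (\<mu> $ i)) (real k * \<delta>) \<rightarrow>\<^sub>M model_filtration \<mu> (real k * \<delta>)"
    proof (rule measurable_into_model_filtration)
      show "(\<lambda>z. glue (z 1) y) \<in> space (model_filtration (vec (\<mu> $ i)) (real k * \<delta>)) \<rightarrow> space model_paths"
        using y by (auto simp: glue_def model_paths_def space_PiM PiE_iff)
      show "(\<lambda>z. signal (\<mu> $ l) s (glue (z 1) y l)) \<in> borel_measurable (model_filtration (vec (\<mu> $ i)) (real k * \<delta>))"
        if "0 \<le> s" "s \<le> real k * \<delta>" for s l
        using measurable_signal_model_filtration[OF that, of "vec (\<mu> $ i)" 1] by (cases "l = i") (simp_all add: glue_def)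
    qed
    from measurable_sets[OF this A[of k]]
    show "A' y k \<in> sets (model_filtration (vec (\<mu> $ i)) (real k * \<delta>))"
      by (rule back_subst[where P = "\<lambda>S. S \<in> _"]) (auto simp: A'_def)
  qed (rule \<delta>)
  define R where "R k t = {x \<in> space (coord_paths \<Otimes>\<^sub>M coord_paths). glue (fst x) (snd x) \<in> A k \<and> fst (fst x) t = 1}" for k t
  have R: "R k t \<in> sets (coord_paths \<Otimes>\<^sub>M coord_paths)" if "0 \<le> t" for k t
  proof -
    have "(\<lambda>x. \<lambda>l\<in>UNIV. if l = i then fst x else snd x) \<in> coord_paths \<Otimes>\<^sub>M coord_paths \<rightarrow>\<^sub>M (model_paths :: (2 \<Rightarrow> _) measure)"
      unfolding model_paths_def by (rule measurable_restrict) simp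
    then have glue: "(\<lambda>x. glue (fst x) (snd x)) \<in> coord_paths \<Otimes>\<^sub>M coord_paths \<rightarrow>\<^sub>M model_paths"
      by (rule back_subst[where P = "\<lambda>f. f \<in> _"]) (intro ext, simp only: restrict_apply UNIV_I if_True glue_def)
    have "R k t = ((\<lambda>x. glue (fst x) (snd x)) -` A k \<inter> space (coord_paths \<Otimes>\<^sub>M coord_paths)) \<inter>
        ((\<lambda>x. fst (fst x) t) -` {1} \<inter> space (coord_paths \<Otimes>\<^sub>M coord_paths))"
      by (auto simp: R_def)
    also have "\<dots> \<in> sets (coord_paths \<Otimes>\<^sub>M coord_paths)"
      by (intro sets.Int measurable_sets[OF glue A_paths]
          measurable_sets[OF measurable_compose[OF measurable_fst measurable_chain_coordinate[OF that]]]) simp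
    finally show ?thesis .
  qed
  \<comment> \<open>Sections at fixed \<open>y\<close> are one-dimensional hitting events, because
    coordinate \<open>i\<close> has the same law in \<open>D\<close> and in
    \<open>D'\<close>.\<close>
  have freeze: "measure (coord_law D i) ((\<lambda>z. (z, y)) -` R k t) = hit_prob D' (A' y k) t"
    if t: "0 \<le> t" and y: "y \<in> space coord_paths" for k t y
  proof -
    have "A' y k \<in> sets model_paths"
      using rule'[OF y] model_filtration_subset by (auto simp: stopping_rule_def)
    then have "hit_prob D' (A' y k) t = measure (coord_law D' 1) {z \<in> space coord_paths. (\<lambda>_. z) \<in> A' y k \<and> fst z t = 1}"
      by (rule hit_prob_1(2)[OF D' t])
    also have "{z \<in> space coord_paths. (\<lambda>_. z) \<in> A' y k \<and> fst z t = 1} = (\<lambda>z. (z, y)) -` R k t"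
      using y by (auto simp: A'_def R_def space_pair_measure model_paths_def space_PiM PiE_iff simp del: UNIV_1)
    also have "coord_law D' 1 = coord_law D i"
      by (rule coord_law_unique[OF D' D]) simp_all
    finally show ?thesis by simp
  qed
  have indep: "D.indep_var coord_paths (coord_path D i) coord_paths (coord_path D j)"
  proof -
    have "D.indep_vars (\<lambda>_. coord_paths) (coord_path D) UNIV"
      by (rule D.indep_vars_coord_events[OF D.measurable_coord_path_coord_events])
    then have "D.indep_var coord_paths ((\<lambda>f. f i) \<circ> (\<lambda>w. \<lambda>l\<in>{i}. coord_path D l w))
        coord_paths ((\<lambda>f. f j) \<circ> (\<lambda>w. \<lambda>l\<in>{j}. coord_path D l w))"
      using ij by (intro D.indep_var_compose[OF D.indep_var_restrict] measurable_component_singleton) auto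
    then show ?thesis by (simp add: comp_def)
  qed
  have joint: "distr (msr D) (coord_paths \<Otimes>\<^sub>M coord_paths) (\<lambda>w. (coord_path D i w, coord_path D j w)) =
      coord_law D i \<Otimes>\<^sub>M coord_law D j"
    using indep by (simp add: D.indep_var_distribution_eq coord_law_def)
  have pair: "(\<lambda>w. (coord_path D i w, coord_path D j w)) \<in> msr D \<rightarrow>\<^sub>M coord_paths \<Otimes>\<^sub>M coord_paths"
    by (intro measurable_Pair D.measurable_coord_path)
  \<comment> \<open>State 1 is absorbing, so the requirement that both chains are in 1 reduces
    almost surely to one on chain \<open>i\<close>.\<close>
  have always_one: "AE w in msr D. chain D j t w = 1" if "0 \<le> t" for t
  proof -
    have "AE w in msr D. chain D j 0 w = 1"
      using D.prob_Collect_eq_1[OF D.chain_event(2)[OF order_refl, of j 1]] D.prior[of j] unfolding certain by blast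
    then show ?thesis using D.chain_absorbed[OF order_refl that, of j] by eventually_elim simp
  qed
  have hit: "integrable (coord_law D j) (\<lambda>y. hit_prob D' (A' y k) t)"
    "hit_prob D (A k) t = (\<integral>y. hit_prob D' (A' y k) t \<partial>coord_law D j)" if t: "0 \<le> t" for k t
  proof -
    have Rm: "R k t \<in> sets (coord_law D i \<Otimes>\<^sub>M coord_law D j)"
      using R[OF t] by (simp cong: sets_pair_measure_cong)
    have glue_path: "glue (coord_path D i w) (coord_path D j w) = model_path D w" for w
      using UNIV2 by (auto simp: glue_def model_path_def fun_eq_iff)
    have "hit_prob D (A k) t = D.prob ((\<lambda>w. (coord_path D i w, coord_path D j w)) -` R k t \<inter> space (msr D))"
      unfolding hit_prob_def
    proof (rule D.finite_measure_eq_AE)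
      show "AE w in msr D. w \<in> {w \<in> space (msr D). model_path D w \<in> A k \<and> (\<forall>i. chain D i t w = 1)} \<longleftrightarrow>
          w \<in> (\<lambda>w. (coord_path D i w, coord_path D j w)) -` R k t \<inter> space (msr D)"
        using always_one[OF t] AE_space
      proof eventually_elim
        case (elim w)
        have "(\<forall>l. chain D l t w = 1) \<longleftrightarrow> chain D i t w = 1"
          using elim UNIV2 by (metis UNIV_I empty_iff insert_iff)
        then show ?case
          using elim t measurable_space[OF pair, of w]
          by (auto simp: R_def glue_path) (simp_all add: coord_path_def sample_path_def)
      qed
      show "{w \<in> space (msr D). model_path D w \<in> A k \<and> (\<forall>i. chain D i t w = 1)} \<in> D.events"
        by (rule D.hit_set_measurable[OF t A_paths])
    qed (rule measurable_sets[OF pair R[OF t]])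
    also have "\<dots> = measure (coord_law D i \<Otimes>\<^sub>M coord_law D j) (R k t)"
      unfolding joint[symmetric] by (rule measure_distr[OF pair R[OF t], symmetric])
    finally have "ennreal (hit_prob D (A k) t) = emeasure (coord_law D i \<Otimes>\<^sub>M coord_law D j) (R k t)"
      by (simp add: L.emeasure_eq_measure)
    also have "\<dots> = (\<integral>\<^sup>+ y. emeasure (coord_law D i) ((\<lambda>z. (z, y)) -` R k t) \<partial>coord_law D j)"
      by (rule L.emeasure_pair_measure_alt2[OF Rm])
    also have "\<dots> = (\<integral>\<^sup>+ y. ennreal (hit_prob D' (A' y k) t) \<partial>coord_law D j)"
      by (rule nn_integral_cong) (simp add: Li.emeasure_eq_measure freeze[OF t])
    finally have nn: "ennreal (hit_prob D (A k) t) = (\<integral>\<^sup>+ y. ennreal (hit_prob D' (A' y k) t) \<partial>coord_law D j)" .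
    have "(\<lambda>y. measure (coord_law D i) ((\<lambda>z. (z, y)) -` R k t)) \<in> borel_measurable (coord_law D j)"
      using L.measurable_emeasure_Pair2[OF Rm] unfolding measure_def by (rule borel_measurable_enn2real)
    then have meas: "(\<lambda>y. hit_prob D' (A' y k) t) \<in> borel_measurable (coord_law D j)"
      by (rule measurable_cong[THEN iffD1, rotated]) (simp add: freeze[OF t])
    show int: "integrable (coord_law D j) (\<lambda>y. hit_prob D' (A' y k) t)"
      by (rule Lj.integrable_const_bound[where B = 1, OF _ meas]) (auto simp: hit_prob_def)
    have "(\<integral>\<^sup>+ y. ennreal (hit_prob D' (A' y k) t) \<partial>coord_law D j) = ennreal (\<integral>y. hit_prob D' (A' y k) t \<partial>coord_law D j)"
      by (rule nn_integral_eq_integral[OF int]) (simp add: hit_prob_def)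
    then show "hit_prob D (A k) t = (\<integral>y. hit_prob D' (A' y k) t \<partial>coord_law D j)"
      using nn by (simp add: hit_prob_def integral_nonneg_AE)
  qed
  have nonneg: "0 \<le> real k * \<delta>" for k using \<delta> by simp
  have "rule_excess D c \<delta> N A = (\<integral>y. rule_excess D' c \<delta> N (A' y) \<partial>coord_law D j)"
  proof -
    have "(\<integral>y. rule_excess D' c \<delta> N (A' y) \<partial>coord_law D j) =
        (\<Sum>k<N. \<integral>y. hit_prob D' (A' y k) (real k * \<delta>) - (1 - c * \<delta>) * hit_prob D' (A' y k) (real (Suc k) * \<delta>) \<partial>coord_law D j)"
      unfolding rule_excess_def
      by (intro Bochner_Integration.integral_sum Bochner_Integration.integrable_diff integrable_mult_right hit(1) nonneg)
    also have "\<dots> = rule_excess D c \<delta> N A"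
      unfolding rule_excess_def
    proof (rule sum.cong[OF refl])
      fix k
      show "(\<integral>y. hit_prob D' (A' y k) (real k * \<delta>) - (1 - c * \<delta>) * hit_prob D' (A' y k) (real (Suc k) * \<delta>) \<partial>coord_law D j) =
          hit_prob D (A k) (real k * \<delta>) - (1 - c * \<delta>) * hit_prob D (A k) (real (Suc k) * \<delta>)"
        unfolding hit(2)[OF nonneg]
        by (subst Bochner_Integration.integral_diff) (simp_all only: integral_mult_right_zero integrable_mult_right hit(1) nonneg)
    qed
    finally show ?thesis by simp
  qed
  also have "0 \<le> \<dots>"
    by (rule integral_nonneg_AE) (use no_rule rule' in \<open>auto intro!: AE_I2\<close>)
  finally show ?thesis .
qed

section \<open>From rules to the shape of the region\<close>

lemma stopping_value_less_iff_QD2: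
  assumes "detection_model \<mu> lam \<pi> D" "0 \<le> c"
  shows "stopping_value \<mu> D QD2_terminal (QD2_running c) < ennreal (QD2_terminal \<pi>) \<longleftrightarrow>
    (\<exists>\<delta> N A. stopping_rule \<mu> \<delta> A \<and> rule_excess D c \<delta> N A < 0)"
proof -
  have eq: "QD2_terminal = prod_terminal" "QD2_running c = prod_running c"
    by (simp_all add: fun_eq_iff QD2_terminal_def QD2_running_def UNIV_2)
  show ?thesis unfolding eq by (rule detection_model.stopping_value_less_iff[OF assms])
qed

lemma QD_continuation_iff:
  assumes "detection_model (vec \<mu>) (vec lam) (vec x) (D x)" "0 \<le> c" "x \<in> {0..1}"
  shows "x \<in> QD_continuation \<mu> c D \<longleftrightarrow>
    (\<exists>\<delta> N A. stopping_rule (vec \<mu>) \<delta> A \<and> rule_excess (D x) c \<delta> N A < 0)"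
  using detection_model.stopping_value_less_iff[OF assms(1,2)] assms(3)
  by (simp add: QD_continuation_def QD_value_def)

text \<open>If the excess were nonnegative at both \<open>\<pi>2\<close> and \<open>\<pi>3\<close>,
  so would be the convex combination at \<open>\<pi>1\<close>.\<close>

lemma rule_excess_neg_decreasing:
  fixes D1 :: "('u, 'n::finite) qd_space" and D2 :: "('v, 'n) qd_space" and D3 :: "('w, 'n) qd_space"
  assumes D: "detection_model \<mu> lam \<pi>1 D1" "detection_model \<mu> lam \<pi>2 D2" "detection_model \<mu> lam \<pi>3 D3"
    and le: "\<pi>2 $ i \<le> \<pi>1 $ i" "\<pi>1 $ i \<le> \<pi>3 $ i"
    and other: "\<And>j. j \<noteq> i \<Longrightarrow> \<pi>2 $ j = \<pi>1 $ j" "\<And>j. j \<noteq> i \<Longrightarrow> \<pi>3 $ j = \<pi>1 $ j"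
    and rule: "stopping_rule \<mu> \<delta> A"
    and neg: "rule_excess D1 c \<delta> N A < 0" and nonneg: "0 \<le> rule_excess D3 c \<delta> N A"
  shows "rule_excess D2 c \<delta> N A < 0"
proof -
  \<comment> \<open>If \<open>\<pi>3 $ i = \<pi>2 $ i\<close> then \<open>s = 0\<close>, which is still correct.\<close>
  define s where "s = (\<pi>1 $ i - \<pi>2 $ i) / (\<pi>3 $ i - \<pi>2 $ i)"
  have s: "0 \<le> s" "s \<le> 1" using le by (auto simp: s_def divide_le_eq)
  have "s * (\<pi>3 $ i - \<pi>2 $ i) = \<pi>1 $ i - \<pi>2 $ i"
    using le by (cases "\<pi>3 $ i = \<pi>2 $ i") (auto simp: s_def)
  then have "\<pi>1 $ i = (1 - s) * \<pi>2 $ i + s * \<pi>3 $ i" by (simp add: algebra_simps)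
  from rule_excess_affine[OF D this other rule, of c N] neg
  have "(1 - s) * rule_excess D2 c \<delta> N A + s * rule_excess D3 c \<delta> N A < 0" by simp
  moreover have "0 \<le> s * rule_excess D3 c \<delta> N A" using s nonneg by simp
  ultimately have "(1 - s) * rule_excess D2 c \<delta> N A < 0" by linarith
  then show ?thesis using s by (simp add: mult_less_0_iff)
qed

lemma affine_neg_nearby:
  fixes a b x :: real
  assumes "(1 - x) * a + x * b < 0"
  shows "\<exists>d>0. \<forall>x'. \<bar>x' - x\<bar> < d \<longrightarrow> (1 - x') * a + x' * b < 0"
proof -
  have "open {x. (1 - x) * a + x * b < 0}"
    by (intro open_Collect_less continuous_intros)
  then show ?thesis using assms unfolding open_dist dist_real_def by blast
qed

text \<open>The rule is kept while \<open>x\<close> moves; its excess is then affine in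
  \<open>x\<close>, hence continuous.\<close>

lemma rule_excess_neg_nearby:
  fixes D :: "real \<Rightarrow> ('w, 'n::finite) qd_space" and \<pi> :: "real \<Rightarrow> real ^ 'n"
  assumes D: "\<And>x. x \<in> {0..1} \<Longrightarrow> detection_model \<mu> lam (\<pi> x) (D x)"
    and \<pi>: "\<And>x. \<pi> x $ i = x" "\<And>x y j. j \<noteq> i \<Longrightarrow> \<pi> x $ j = \<pi> y $ j"
    and x: "x \<in> {0..1}" and rule: "stopping_rule \<mu> \<delta> A" and neg: "rule_excess (D x) c \<delta> N A < 0"
  shows "\<exists>d>0. \<forall>x'\<in>{0..1}. \<bar>x' - x\<bar> < d \<longrightarrow> rule_excess (D x') c \<delta> N A < 0"
proof -
  have eq: "rule_excess (D x') c \<delta> N A = (1 - x') * rule_excess (D 0) c \<delta> N A + x' * rule_excess (D 1) c \<delta> N A"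
    if "x' \<in> {0..1}" for x'
  proof (rule rule_excess_affine[where i = i])
    show "\<pi> x' $ i = (1 - x') * \<pi> 0 $ i + x' * \<pi> 1 $ i" by (simp add: \<pi>(1))
    show "\<pi> 0 $ j = \<pi> x' $ j" "\<pi> 1 $ j = \<pi> x' $ j" if "j \<noteq> i" for j
      using that by (rule \<pi>(2))+
  qed (use that D rule in auto)
  have "(1 - x) * rule_excess (D 0) c \<delta> N A + x * rule_excess (D 1) c \<delta> N A < 0"
    using neg unfolding eq[OF x] .
  from affine_neg_nearby[OF this] obtain d where "0 < d"
    "\<forall>x'. \<bar>x' - x\<bar> < d \<longrightarrow> (1 - x') * rule_excess (D 0) c \<delta> N A + x' * rule_excess (D 1) c \<delta> N A < 0"
    by (elim exE conjE)
  then show ?thesis by (intro exI[of _ d] conjI ballI impI) (simp_all only: eq)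
qed

text \<open>The order-theoretic part, with \<open>b x\<close> the supremum of the vertical section.
  A section is down-closed, open in [0, 1] and misses 1, so it is exactly \<open>{0..<b x}\<close>.
  Openness in the horizontal direction at a fixed height becomes lower semicontinuity of
  \<open>b\<close>.\<close>

lemma staircase_region:
  fixes P :: "real \<Rightarrow> real \<Rightarrow> bool" and B1 B2 :: real
  assumes B: "0 < B1" "0 < B2"
    and left: "\<And>x y. 0 \<le> x \<Longrightarrow> x < B1 \<Longrightarrow> x \<le> 1 \<Longrightarrow> y \<in> {0..1} \<Longrightarrow> P x y"
    and bottom: "\<And>x y. x \<in> {0..1} \<Longrightarrow> 0 \<le> y \<Longrightarrow> y < B2 \<Longrightarrow> y \<le> 1 \<Longrightarrow> P x y"
    and top: "\<And>x. x \<in> {B1..1} \<Longrightarrow> \<not> P x 1"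
    and mono1: "\<And>x x' y. y \<in> {0..1} \<Longrightarrow> 0 \<le> x' \<Longrightarrow> x' \<le> x \<Longrightarrow> x \<le> 1 \<Longrightarrow> P x y \<Longrightarrow> P x' y"
    and mono2: "\<And>x y y'. x \<in> {0..1} \<Longrightarrow> 0 \<le> y' \<Longrightarrow> y' \<le> y \<Longrightarrow> y \<le> 1 \<Longrightarrow> P x y \<Longrightarrow> P x y'"
    and open1: "\<And>x y. x \<in> {0..1} \<Longrightarrow> y \<in> {0..1} \<Longrightarrow> P x y \<Longrightarrow> \<exists>d>0. \<forall>x'\<in>{0..1}. \<bar>x' - x\<bar> < d \<longrightarrow> P x' y"
    and open2: "\<And>x y. x \<in> {0..1} \<Longrightarrow> y \<in> {0..1} \<Longrightarrow> P x y \<Longrightarrow> \<exists>d>0. \<forall>y'\<in>{0..1}. \<bar>y' - y\<bar> < d \<longrightarrow> P x y'"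
  shows "\<exists>b. b \<in> {B1..1} \<rightarrow> {B2..1} \<and> antimono_on {B1..1} b \<and> lower_semicontinuous_on {B1..1} b \<and>
    (\<forall>x\<in>{0..1}. \<forall>y\<in>{0..1}. P x y \<longleftrightarrow> B1 \<le> x \<and> y < b x \<or> x < B1)"
proof -
  define S where "S x = {y \<in> {0..1}. P x y}" for x
  define b where "b x = Sup (S x)" for x
  have bdd: "bdd_above (S x)" for x by (rule bdd_aboveI[of _ 1]) (auto simp: S_def)
  have in01: "x \<in> {0..1}" if "x \<in> {B1..1}" for x using that B by auto
  have S0: "0 \<in> S x" if "x \<in> {B1..1}" for x
    using bottom[OF in01[OF that]] B by (simp add: S_def)
  have b01: "b x \<in> {0..1}" if "x \<in> {B1..1}" for x
  proof -
    have "0 \<le> b x" unfolding b_def by (rule cSup_upper[OF S0[OF that] bdd])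
    moreover have "b x \<le> 1" unfolding b_def using S0[OF that] by (intro cSup_least) (blast, simp add: S_def)
    ultimately show ?thesis by simp
  qed
  have iff: "P x y \<longleftrightarrow> y < b x" if x: "x \<in> {B1..1}" and y: "y \<in> {0..1}" for x y
  proof
    assume P: "P x y"
    then have "y \<noteq> 1" using top[OF x] by auto
    with y have "y < 1" by simp
    obtain d where d: "0 < d" "\<forall>y'\<in>{0..1}. \<bar>y' - y\<bar> < d \<longrightarrow> P x y'"
      using open2[OF in01[OF x] y P] by blast
    \<comment> \<open>A point of the section strictly above \<open>y\<close>, within the radius and
      not above 1; \<open>y < 1\<close> makes the step positive.\<close>
    define y' where "y' = y + min (d / 2) (1 - y)"
    have y': "y < y'" "y' \<in> {0..1}" "\<bar>y' - y\<bar> < d"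
      using y d(1) \<open>y < 1\<close> by (auto simp: y'_def min_def)
    then have "y' \<in> S x" using d(2) by (simp add: S_def)
    then have "y' \<le> b x" unfolding b_def by (rule cSup_upper[OF _ bdd])
    then show "y < b x" using y'(1) by simp
  next
    assume "y < b x"
    then obtain y' where "y' \<in> S x" "y < y'"
      unfolding b_def using S0[OF x] by (auto elim: less_cSupE)
    then show "P x y" using mono2[OF in01[OF x], of y y'] y by (auto simp: S_def)
  qed
  have range: "b x \<in> {B2..1}" if x: "x \<in> {B1..1}" for x
  proof (rule ccontr)
    assume "b x \<notin> {B2..1}"
    then have "b x < B2" using b01[OF x] by auto
    then have "P x (b x)" using bottom[OF in01[OF x], of "b x"] b01[OF x] by simp
    then show False using iff[OF x b01[OF x]] by simp
  qed
  have "antimono_on {B1..1} b"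
  proof (rule monotone_onI)
    fix x x' assume x: "x \<in> {B1..1}" and x': "x' \<in> {B1..1}" and le: "x \<le> x'"
    have "y < b x" if y: "y \<in> {0..1}" "y < b x'" for y
      using mono1[of y x x'] y x' in01[OF x] le iff[OF x y(1)] iff[OF x' y(1)] by auto
    \<comment> \<open>At height \<open>b x\<close> itself: \<open>b x < b x'\<close> would give
      \<open>b x < b x\<close>.\<close>
    from this[of "b x"] b01[OF x] show "b x' \<le> b x" by (meson less_irrefl not_le)
  qed
  moreover have "lower_semicontinuous_on {B1..1} b"
    unfolding lower_semicontinuous_on_def
  proof (intro ballI allI impI)
    fix x a assume x: "x \<in> {B1..1}" and a: "a < b x"
    \<comment> \<open>The level \<open>a\<close> may be negative, while the region is only described
      for heights in [0, 1].\<close>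
    define y where "y = max a 0"
    have y: "y \<in> {0..1}" "y < b x" "a \<le> y" using a range[OF x] b01[OF x] B by (auto simp: y_def)
    then obtain d where d: "0 < d" "\<forall>x'\<in>{0..1}. \<bar>x' - x\<bar> < d \<longrightarrow> P x' y"
      using open1[OF in01[OF x] y(1)] iff[OF x y(1)] by blast
    have "a < b x'" if x': "x' \<in> {B1..1}" "\<bar>x' - x\<bar> < d" for x'
      using d(2) in01[OF x'(1)] x'(2) iff[OF x'(1) y(1)] y(3) by auto
    then show "\<forall>\<^sub>F x' in at x within {B1..1}. a < b x'"
      unfolding eventually_at dist_real_def using d(1) by blast
  qed
  moreover have "P x y \<longleftrightarrow> B1 \<le> x \<and> y < b x \<or> x < B1" if "x \<in> {0..1}" "y \<in> {0..1}" for x y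
    using left[of x y] iff[of x y] that by (cases "x < B1") auto
  ultimately show ?thesis using range by (intro exI[of _ b]) auto
qed

theorem proposition5p2:
  fixes \<mu>\<^sub>1 \<mu>\<^sub>2 lam\<^sub>1 lam\<^sub>2 c B\<^sub>1 B\<^sub>2 :: real
    and D :: "real ^ 2 \<Rightarrow> ('w, 2) qd_space"
    and D\<^sub>1 :: "real \<Rightarrow> ('u, 1) qd_space"
    and D\<^sub>2 :: "real \<Rightarrow> ('v, 1) qd_space"
  assumes pos: "\<mu>\<^sub>1 > 0" "\<mu>\<^sub>2 > 0" "lam\<^sub>1 > 0" "lam\<^sub>2 > 0" "c > 0"
    and model: "\<And>\<pi>. \<pi> \<in> cbox 0 1 \<Longrightarrow> qd_model (vector [\<mu>\<^sub>1, \<mu>\<^sub>2]) (vector [lam\<^sub>1, lam\<^sub>2]) \<pi> (D \<pi>)"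
    and model1: "\<And>x. x \<in> {0..1} \<Longrightarrow> qd_model (vec \<mu>\<^sub>1) (vec lam\<^sub>1) (vec x) (D\<^sub>1 x)"
    and model2: "\<And>x. x \<in> {0..1} \<Longrightarrow> qd_model (vec \<mu>\<^sub>2) (vec lam\<^sub>2) (vec x) (D\<^sub>2 x)"
    and B1: "B\<^sub>1 \<in> {0<..<1}" "QD_continuation \<mu>\<^sub>1 c D\<^sub>1 = {0..<B\<^sub>1}"
    and B2: "B\<^sub>2 \<in> {0<..<1}" "QD_continuation \<mu>\<^sub>2 c D\<^sub>2 = {0..<B\<^sub>2}"
  shows "\<exists>b. b \<in> {B\<^sub>1..1} \<rightarrow> {B\<^sub>2..1} \<and>
             antimono_on {B\<^sub>1..1} b \<and>
             lower_semicontinuous_on {B\<^sub>1..1} b \<and>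
             QD2_continuation (vector [\<mu>\<^sub>1, \<mu>\<^sub>2]) c D =
               {\<pi> \<in> cbox 0 1. B\<^sub>1 \<le> \<pi> $ 1 \<and> \<pi> $ 2 < b (\<pi> $ 1)} \<union>
               {\<pi> \<in> cbox 0 1. \<pi> $ 1 \<in> {0..<B\<^sub>1} \<and> \<pi> $ 2 \<in> {0..1}}"
proof -
  define \<mu> :: "real ^ 2" where "\<mu> = vector [\<mu>\<^sub>1, \<mu>\<^sub>2]"
  define lam :: "real ^ 2" where "lam = vector [lam\<^sub>1, lam\<^sub>2]"
  define v :: "real \<Rightarrow> real \<Rightarrow> real ^ 2" where "v x y = vector [x, y]" for x y
  have [simp]: "\<mu> $ 1 = \<mu>\<^sub>1" "\<mu> $ 2 = \<mu>\<^sub>2" "lam $ 1 = lam\<^sub>1" "lam $ 2 = lam\<^sub>2" "v x y $ 1 = x" "v x y $ 2 = y" for x y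
    by (simp_all add: \<mu>_def lam_def v_def vector_2)
  have c: "0 \<le> c" using pos by simp
  have neq: "(1::2) \<noteq> 2" "(2::2) \<noteq> 1" by simp_all
  have other1: "j = 2" if "j \<noteq> 1" for j :: 2 using that exhaust_2[of j] by blast
  have other2: "j = 1" if "j \<noteq> 2" for j :: 2 using that exhaust_2[of j] by blast
  have box: "v x y \<in> cbox 0 1 \<longleftrightarrow> x \<in> {0..1} \<and> y \<in> {0..1}" for x y
    by (auto simp: mem_box_cart forall_2)
  have M: "detection_model \<mu> lam (v x y) (D (v x y))" if "x \<in> {0..1}" "y \<in> {0..1}" for x y
    using model[of "v x y"] that box by (simp add: detection_model_def \<mu>_def lam_def)
  have M1: "detection_model (vec \<mu>\<^sub>1) (vec lam\<^sub>1) (vec x) (D\<^sub>1 x)" if "x \<in> {0..1}" for x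
    using model1[OF that] by (simp add: detection_model_def)
  have M2: "detection_model (vec \<mu>\<^sub>2) (vec lam\<^sub>2) (vec x) (D\<^sub>2 x)" if "x \<in> {0..1}" for x
    using model2[OF that] by (simp add: detection_model_def)
  define P where "P x y \<longleftrightarrow> v x y \<in> QD2_continuation \<mu> c D" for x y
  have P: "P x y \<longleftrightarrow> (\<exists>\<delta> N A. stopping_rule \<mu> \<delta> A \<and> rule_excess (D (v x y)) c \<delta> N A < 0)"
    if "x \<in> {0..1}" "y \<in> {0..1}" for x y
    using stopping_value_less_iff_QD2[OF M[OF that] c] that box
    by (simp add: P_def QD2_continuation_def QD2_value_def)
  have Q1: "x < B\<^sub>1 \<longleftrightarrow> (\<exists>\<delta> N A. stopping_rule (vec \<mu>\<^sub>1) \<delta> A \<and> rule_excess (D\<^sub>1 x) c \<delta> N A < 0)" if "x \<in> {0..1}" for x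
    using QD_continuation_iff[where D = D\<^sub>1, OF M1[OF that] c that] that by (simp add: B1)
  have Q2: "x < B\<^sub>2 \<longleftrightarrow> (\<exists>\<delta> N A. stopping_rule (vec \<mu>\<^sub>2) \<delta> A \<and> rule_excess (D\<^sub>2 x) c \<delta> N A < 0)" if "x \<in> {0..1}" for x
    using QD_continuation_iff[where D = D\<^sub>2, OF M2[OF that] c that] that by (simp add: B2)
  have left: "P x y" if x: "x \<in> {0..1}" "x < B\<^sub>1" and y: "y \<in> {0..1}" for x y
  proof -
    obtain \<delta> N A where "stopping_rule (vec (\<mu> $ 1)) \<delta> A" "rule_excess (D\<^sub>1 x) c \<delta> N A < 0"
      using Q1[OF x(1)] x(2) by auto
    then show ?thesis
      unfolding P[OF x(1) y]
      by (intro rule_from_one_coordinate[OF M[OF x(1) y] _ neq(2)]) (use M1[OF x(1)] pos in simp_all)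
  qed
  have bottom: "P x y" if x: "x \<in> {0..1}" and y: "y \<in> {0..1}" "y < B\<^sub>2" for x y
  proof -
    obtain \<delta> N A where "stopping_rule (vec (\<mu> $ 2)) \<delta> A" "rule_excess (D\<^sub>2 y) c \<delta> N A < 0"
      using Q2[OF y(1)] y(2) by auto
    then show ?thesis
      unfolding P[OF x y(1)]
      by (intro rule_from_one_coordinate[OF M[OF x y(1)] _ neq(1)]) (use M2[OF y(1)] pos in simp_all)
  qed
  \<comment> \<open>On this edge every rule has nonnegative excess, as needed both for
    \<open>b\<close> to exist and for monotonicity in the second coordinate; \<open>right\<close> is
    the mirror image for the first.\<close>
  have top: "0 \<le> rule_excess (D (v x 1)) c \<delta> N A" if x: "x \<in> {0..1}" "B\<^sub>1 \<le> x" and rule: "stopping_rule \<mu> \<delta> A" for x \<delta> N A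
  proof (rule no_rule_if_other_coordinate_certain[OF M _ neq(1) _ _ rule])
    show "detection_model (vec (\<mu> $ 1)) (vec (lam $ 1)) (vec (v x 1 $ 1)) (D\<^sub>1 x)" using M1[OF x(1)] by simp
    show "0 \<le> rule_excess (D\<^sub>1 x) c \<delta> N A" if "stopping_rule (vec (\<mu> $ 1)) \<delta> A" for \<delta> N A
      using Q1[OF x(1)] x(2) that by (metis \<open>\<mu> $ 1 = \<mu>\<^sub>1\<close> not_le)
  qed (use x in auto)
  have right: "0 \<le> rule_excess (D (v 1 y)) c \<delta> N A" if y: "y \<in> {0..1}" "B\<^sub>2 \<le> y" and rule: "stopping_rule \<mu> \<delta> A" for y \<delta> N A
  proof (rule no_rule_if_other_coordinate_certain[OF M _ neq(2) _ _ rule])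
    show "detection_model (vec (\<mu> $ 2)) (vec (lam $ 2)) (vec (v 1 y $ 2)) (D\<^sub>2 y)" using M2[OF y(1)] by simp
    show "0 \<le> rule_excess (D\<^sub>2 y) c \<delta> N A" if "stopping_rule (vec (\<mu> $ 2)) \<delta> A" for \<delta> N A
      using Q2[OF y(1)] y(2) that by (metis \<open>\<mu> $ 2 = \<mu>\<^sub>2\<close> not_le)
  qed (use y in auto)
  have "\<exists>b. b \<in> {B\<^sub>1..1} \<rightarrow> {B\<^sub>2..1} \<and> antimono_on {B\<^sub>1..1} b \<and> lower_semicontinuous_on {B\<^sub>1..1} b \<and>
    (\<forall>x\<in>{0..1}. \<forall>y\<in>{0..1}. P x y \<longleftrightarrow> B\<^sub>1 \<le> x \<and> y < b x \<or> x < B\<^sub>1)"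
  proof (rule staircase_region)
    show "0 < B\<^sub>1" "0 < B\<^sub>2" using B1 B2 by auto
    show "P x y" if "0 \<le> x" "x < B\<^sub>1" "x \<le> 1" "y \<in> {0..1}" for x y using left that by simp
    show "P x y" if "x \<in> {0..1}" "0 \<le> y" "y < B\<^sub>2" "y \<le> 1" for x y using bottom that by simp
    show "\<not> P x 1" if "x \<in> {B\<^sub>1..1}" for x
      using top[of x] that B1 by (subst P) (auto simp: not_less)
    show "P x' y" if y: "y \<in> {0..1}" and x: "0 \<le> x'" "x' \<le> x" "x \<le> 1" and Pxy: "P x y" for x x' y
    \<comment> \<open>Below \<open>B\<^sub>2\<close> the whole row belongs to the region. Otherwise
      \<open>right\<close> gives the same rule nonnegative excess at the end point 1, and affinity
      carries its negativity from \<open>x\<close> to \<open>x'\<close>.\<close>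
    proof (cases "y < B\<^sub>2")
      case True
      then show ?thesis using bottom[of x' y] x y by simp
    next
      case False
      have x01: "x \<in> {0..1}" "x' \<in> {0..1}" using x by auto
      from Pxy obtain \<delta> N A where rule: "stopping_rule \<mu> \<delta> A" and neg: "rule_excess (D (v x y)) c \<delta> N A < 0"
        unfolding P[OF x01(1) y] by blast
      have "rule_excess (D (v x' y)) c \<delta> N A < 0"
        by (rule rule_excess_neg_decreasing[OF M[OF x01(1) y] M[OF x01(2) y] M[OF _ y, of 1] _ _ _ _ rule neg, of 1])
           (use x right[OF y _ rule] False in \<open>auto dest: other1\<close>)
      with rule show ?thesis unfolding P[OF x01(2) y] by blast
    qed
    show "P x y'" if x: "x \<in> {0..1}" and y: "0 \<le> y'" "y' \<le> y" "y \<le> 1" and Pxy: "P x y" for x y y'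
    proof (cases "x < B\<^sub>1")
      case True
      then show ?thesis using left[of x y'] x y by simp
    next
      case False
      have y01: "y \<in> {0..1}" "y' \<in> {0..1}" using y by auto
      from Pxy obtain \<delta> N A where rule: "stopping_rule \<mu> \<delta> A" and neg: "rule_excess (D (v x y)) c \<delta> N A < 0"
        unfolding P[OF x y01(1)] by blast
      have "rule_excess (D (v x y')) c \<delta> N A < 0"
        by (rule rule_excess_neg_decreasing[OF M[OF x y01(1)] M[OF x y01(2)] M[OF x, of 1] _ _ _ _ rule neg, of 2])
           (use y top[OF x _ rule] False in \<open>auto dest: other2\<close>)
      with rule show ?thesis unfolding P[OF x y01(2)] by blast
    qed
    show "\<exists>d>0. \<forall>x'\<in>{0..1}. \<bar>x' - x\<bar> < d \<longrightarrow> P x' y" if x: "x \<in> {0..1}" and y: "y \<in> {0..1}" and Pxy: "P x y" for x y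
    proof -
      from Pxy obtain \<delta> N A where rule: "stopping_rule \<mu> \<delta> A" and neg: "rule_excess (D (v x y)) c \<delta> N A < 0"
        unfolding P[OF x y] by blast
      have "\<exists>d>0. \<forall>x'\<in>{0..1}. \<bar>x' - x\<bar> < d \<longrightarrow> rule_excess (D (v x' y)) c \<delta> N A < 0"
        by (rule rule_excess_neg_nearby[of \<mu> lam "\<lambda>x. v x y" "\<lambda>x. D (v x y)" 1, OF M[OF _ y] _ _ x rule neg])
           (auto dest: other1)
      with rule P[OF _ y] show ?thesis by meson
    qed
    show "\<exists>d>0. \<forall>y'\<in>{0..1}. \<bar>y' - y\<bar> < d \<longrightarrow> P x y'" if x: "x \<in> {0..1}" and y: "y \<in> {0..1}" and Pxy: "P x y" for x y
    proof -
      from Pxy obtain \<delta> N A where rule: "stopping_rule \<mu> \<delta> A" and neg: "rule_excess (D (v x y)) c \<delta> N A < 0"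
        unfolding P[OF x y] by blast
      have "\<exists>d>0. \<forall>y'\<in>{0..1}. \<bar>y' - y\<bar> < d \<longrightarrow> rule_excess (D (v x y')) c \<delta> N A < 0"
        by (rule rule_excess_neg_nearby[of \<mu> lam "\<lambda>y. v x y" "\<lambda>y. D (v x y)" 2, OF M[OF x] _ _ y rule neg])
           (auto dest: other2)
      with rule P[OF x] show ?thesis by meson
    qed
  qed
  then obtain b where b: "b \<in> {B\<^sub>1..1} \<rightarrow> {B\<^sub>2..1}" "antimono_on {B\<^sub>1..1} b" "lower_semicontinuous_on {B\<^sub>1..1} b"
    and iff: "\<And>x y. x \<in> {0..1} \<Longrightarrow> y \<in> {0..1} \<Longrightarrow> P x y \<longleftrightarrow> B\<^sub>1 \<le> x \<and> y < b x \<or> x < B\<^sub>1"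
    by blast
  have "QD2_continuation (vector [\<mu>\<^sub>1, \<mu>\<^sub>2]) c D =
      {\<pi> \<in> cbox 0 1. B\<^sub>1 \<le> \<pi> $ 1 \<and> \<pi> $ 2 < b (\<pi> $ 1)} \<union>
      {\<pi> \<in> cbox 0 1. \<pi> $ 1 \<in> {0..<B\<^sub>1} \<and> \<pi> $ 2 \<in> {0..1}}" (is "?C = ?R")
  proof (rule set_eqI)
    fix \<pi> :: "real ^ 2"
    have \<pi>: "\<pi> = v (\<pi> $ 1) (\<pi> $ 2)" by (simp add: vec_eq_iff forall_2)
    show "\<pi> \<in> ?C \<longleftrightarrow> \<pi> \<in> ?R"
    proof (cases "\<pi> \<in> cbox 0 1")
      case True
      then have "\<pi> $ 1 \<in> {0..1}" "\<pi> $ 2 \<in> {0..1}" by (auto simp: mem_box_cart forall_2)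
      moreover have "\<pi> \<in> ?C \<longleftrightarrow> P (\<pi> $ 1) (\<pi> $ 2)" unfolding P_def \<pi>[symmetric] by (simp add: \<mu>_def)
      ultimately show ?thesis using iff[of "\<pi> $ 1" "\<pi> $ 2"] True by auto
    qed (simp add: QD2_continuation_def)
  qed
  with b show ?thesis by blast
qed

end
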